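(* Let $\mathbb{K}$ be a field and let $q\in\mathbb{K}^*$ be a primitive $\ell$-th root of unity with $\ell>2$ and $\ell$ odd. Let $\lambda=(\lambda_1\geq\dots\geq\lambda_m)$ be a partition with Young diagram $Y_\lambda$. Then $$\mathrm{PI}\text{-}\mathrm{deg}\big(\mathcal{O}_q(Y_\lambda)\big)=\ell^{\frac{N-r}{2}},$$ where $N=\sum_{i=1}^m\lambda_i$ is the number of boxes in $Y_\lambda$ and $r$ is the number of odd cycles in the disjoint cycle decomposition of the toric permutation associated to $\lambda$.
   Context: PI-deg denotes the PI degree of a prime PI algebra. Quantum matrices: $\mathcal{O}_q(M_{m,n}(\mathbb{K}))$ is the $\mathbb{K}$-algebra generated by $X_{i,j}$ ($1\le i\le m$, $1\le j\le n$) with relations, for $(i,j)<(s,t)$ in lexicographic order: $X_{i,j}X_{s,t}=X_{s,t}X_{i,j}$ if $i<s,\ j>t$; $X_{i,j}X_{s,t}=qX_{s,t}X_{i,j}$ if ($i=s$, $j<t$) or ($i<s$, $j=t$); $X_{i,j}X_{s,t}=X_{s,t}X_{i,j}+(q-q^{-1})X_{i,t}X_{s,j}$ if $i<s,\ j<t$. Partition subalgebra: for $n\geq\lambda_1$, $\mathcal{O}_q(Y_\lambda)$ is the subalgebra of $\mathcal{O}_q(M_{m,n}(\mathbb{K}))$ generated by the $X_{i,j}$ with $1\le i\le m$, $1\le j\le\lambda_i$ (i.e. those fitting into $Y_\lambda$). Toric permutation: an $m\times n$ diagram is an $m\times n$ grid whose boxes are coloured black or white. Label the right side and the left side of the rows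 by $1,\dots,m$ from bottom to top, and the bottom side and the top side of the columns by $m+1,\dots,m+n$ from left to right. On each black box place a cross: a pipe goes straight through (entering from the right it exits to the left; entering from below it exits at the top). On each white box place a hyperbola: a pipe entering from the right exits at the top, and a pipe entering from below exits to the left. The toric permutation $\tau\in S_{m+n}$ is defined by: $\tau(i)$ is the label (on the left or top side) reached by following the pipe that starts at label $i$ (on the right or bottom side). The toric permutation associated to $\lambda$ is that of the $m\times n$ diagram ($n\ge\lambda_1$) whose box $(i,j)$ (row $i$ from the top, column $j$ from the left) is white if $j\leq\lambda_i$ and black otherwise. An odd cycle is a cycle that is an odd permutation, i.e. a cycle of even length. *)

theory Defs
  imports
    Complex_Main
    "HOL-Library.Poly_Mapping"
    "HOL-Combinatorics.Orbits"
    "HOL-Algebra.QuotRing"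
    "HOL-Algebra.Generated_Rings"
    "HOL-Algebra.Embedded_Algebras"
begin

section \<open>Free algebras\<close>

text \<open>The free monoid on an alphabet, written additively, so that the type
  \<open>'x free_mon \<Rightarrow>\<^sub>0 'k\<close> of finitely supported functions, with its
  convolution product, is the free associative algebra on \<open>'x\<close>.\<close>

datatype 'x free_mon = Free_Mon (letters: "'x list")

instantiation free_mon :: (type) monoid_add
begin

definition zero_free_mon :: "'a free_mon" where
  "0 = Free_Mon []"

definition plus_free_mon :: "'a free_mon \<Rightarrow> 'a free_mon \<Rightarrow> 'a free_mon" where
  "v + w = Free_Mon (letters v @ letters w)"

instance
  by standard (simp_all add: zero_free_mon_def plus_free_mon_def)

end

definition free_var :: "'x \<Rightarrow> ('x free_mon \<Rightarrow>\<^sub>0 'k::comm_ring_1)" where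
  "free_var x = Poly_Mapping.single (Free_Mon [x]) 1"

definition free_const :: "'k::comm_ring_1 \<Rightarrow> ('x free_mon \<Rightarrow>\<^sub>0 'k)" where
  "free_const c = Poly_Mapping.single 0 c"

definition free_algebra :: "'x set \<Rightarrow> ('x free_mon \<Rightarrow>\<^sub>0 'k::comm_ring_1) ring" where
  "free_algebra G =
    \<lparr>carrier = {p. \<forall>w\<in>Poly_Mapping.keys p. set (letters w) \<subseteq> G},
     mult = (*), one = 1, zero = 0, add = (+)\<rparr>"


section \<open>Prime PI rings and the PI degree\<close>

definition ring_center :: "('a, 'b) ring_scheme \<Rightarrow> 'a set" where
  "ring_center R = {z \<in> carrier R. \<forall>x\<in>carrier R. z \<otimes>\<^bsub>R\<^esub> x = x \<otimes>\<^bsub>R\<^esub> z}"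

definition prime_ring :: "('a, 'b) ring_scheme \<Rightarrow> bool" where
  "prime_ring R \<longleftrightarrow> ring R \<and> \<one>\<^bsub>R\<^esub> \<noteq> \<zero>\<^bsub>R\<^esub> \<and>
    (\<forall>a\<in>carrier R. \<forall>b\<in>carrier R.
      (\<forall>x\<in>carrier R. a \<otimes>\<^bsub>R\<^esub> x \<otimes>\<^bsub>R\<^esub> b = \<zero>\<^bsub>R\<^esub>) \<longrightarrow> a = \<zero>\<^bsub>R\<^esub> \<or> b = \<zero>\<^bsub>R\<^esub>)"

definition eval_word :: "('a, 'b) ring_scheme \<Rightarrow> ('x \<Rightarrow> 'a) \<Rightarrow> 'x free_mon \<Rightarrow> 'a" where
  "eval_word R s w = foldr (\<lambda>x y. s x \<otimes>\<^bsub>R\<^esub> y) (letters w) \<one>\<^bsub>R\<^esub>"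

definition eval_free :: "('a, 'b) ring_scheme \<Rightarrow> ('x \<Rightarrow> 'a) \<Rightarrow> ('x free_mon \<Rightarrow>\<^sub>0 int) \<Rightarrow> 'a" where
  "eval_free R s f =
    (\<Oplus>\<^bsub>R\<^esub>w\<in>Poly_Mapping.keys f. [Poly_Mapping.lookup f w] \<cdot>\<^bsub>R\<^esub> eval_word R s w)"

text \<open>An element of \<open>\<int>\<langle>x\<^sub>0, x\<^sub>1, \<dots>\<rangle>\<close> is monic if some word of highest total degree
  occurs in it with coefficient 1; a PI ring satisfies a monic polynomial.\<close>

definition monic_free :: "('x free_mon \<Rightarrow>\<^sub>0 int) \<Rightarrow> bool" where
  "monic_free f \<longleftrightarrow>
    (\<exists>w\<in>Poly_Mapping.keys f. Poly_Mapping.lookup f w = 1 \<and>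
      (\<forall>v\<in>Poly_Mapping.keys f. length (letters v) \<le> length (letters w)))"

definition PI_ring :: "('a, 'b) ring_scheme \<Rightarrow> bool" where
  "PI_ring R \<longleftrightarrow> ring R \<and>
    (\<exists>f :: nat free_mon \<Rightarrow>\<^sub>0 int. monic_free f \<and>
      (\<forall>s. range s \<subseteq> carrier R \<longrightarrow> eval_free R s f = \<zero>\<^bsub>R\<^esub>))"

text \<open>Ring of fractions \<open>S\<^sup>-\<^sup>1 R\<close> for a multiplicatively closed set \<open>S\<close> of central
  elements; the pair \<open>(a, s)\<close> stands for the fraction \<open>s\<^sup>-\<^sup>1 a\<close>.\<close>

definition frac_rel ::
  "('a, 'b) ring_scheme \<Rightarrow> 'a set \<Rightarrow> (('a \<times> 'a) \<times> ('a \<times> 'a)) set" where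
  "frac_rel R S = {((a, s), (b, t)).
    a \<in> carrier R \<and> s \<in> S \<and> b \<in> carrier R \<and> t \<in> S \<and>
    (\<exists>u\<in>S. u \<otimes>\<^bsub>R\<^esub> (t \<otimes>\<^bsub>R\<^esub> a \<ominus>\<^bsub>R\<^esub> s \<otimes>\<^bsub>R\<^esub> b) = \<zero>\<^bsub>R\<^esub>)}"

definition fraction_ring :: "('a, 'b) ring_scheme \<Rightarrow> 'a set \<Rightarrow> ('a \<times> 'a) set ring" where
  "fraction_ring R S =
    \<lparr>carrier = (carrier R \<times> S) // frac_rel R S,
     mult = (\<lambda>X Y. \<Union>(a, s)\<in>X. \<Union>(b, t)\<in>Y.
       frac_rel R S `` {(a \<otimes>\<^bsub>R\<^esub> b, s \<otimes>\<^bsub>R\<^esub> t)}),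
     one = frac_rel R S `` {(\<one>\<^bsub>R\<^esub>, \<one>\<^bsub>R\<^esub>)},
     zero = frac_rel R S `` {(\<zero>\<^bsub>R\<^esub>, \<one>\<^bsub>R\<^esub>)},
     add = (\<lambda>X Y. \<Union>(a, s)\<in>X. \<Union>(b, t)\<in>Y.
       frac_rel R S `` {(t \<otimes>\<^bsub>R\<^esub> a \<oplus>\<^bsub>R\<^esub> s \<otimes>\<^bsub>R\<^esub> b, s \<otimes>\<^bsub>R\<^esub> t)})\<rparr>"

definition central_localization :: "('a, 'b) ring_scheme \<Rightarrow> ('a \<times> 'a) set ring" where
  "central_localization R = fraction_ring R (ring_center R - {\<zero>\<^bsub>R\<^esub>})"

text \<open>By Posner's theorem the central localization \<open>Q\<close> of a prime PI ring is a central
  simple algebra; its dimension over its centre is \<open>d\<^sup>2\<close>, where \<open>d\<close> is the PI degree.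
  The value 0, used for rings that are not prime PI, is never the PI degree of a prime
  PI ring.\<close>

definition PI_deg :: "('a, 'b) ring_scheme \<Rightarrow> nat" where
  "PI_deg R =
    (if prime_ring R \<and> PI_ring R
     then let Q = central_localization R
          in THE d. ring.dimension Q (d\<^sup>2) (ring_center Q) (carrier Q)
     else 0)"


section \<open>Quantum matrices and partition subalgebras\<close>

definition primitive_root :: "nat \<Rightarrow> 'k::field \<Rightarrow> bool" where
  "primitive_root l q \<longleftrightarrow> l > 0 \<and> q ^ l = 1 \<and> (\<forall>k. 0 < k \<and> k < l \<longrightarrow> q ^ k \<noteq> 1)"

definition qmat_free ::
  "nat \<Rightarrow> nat \<Rightarrow> ((nat \<times> nat) free_mon \<Rightarrow>\<^sub>0 'k::field) ring" where
  "qmat_free m n = free_algebra ({1..m} \<times> {1..n})"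

text \<open>Each defining relation \<open>a = b\<close> is recorded as the element \<open>a - b\<close>.\<close>

definition qmat_relations ::
  "'k::field \<Rightarrow> nat \<Rightarrow> nat \<Rightarrow> ((nat \<times> nat) free_mon \<Rightarrow>\<^sub>0 'k) set" where
  "qmat_relations q m n = (let X = (\<lambda>i j. free_var (i, j)) in
     {X i j * X s t - X s t * X i j | i j s t.
        {i, s} \<subseteq> {1..m} \<and> {j, t} \<subseteq> {1..n} \<and> i < s \<and> j > t} \<union>
     {X i j * X s t - free_const q * X s t * X i j | i j s t.
        {i, s} \<subseteq> {1..m} \<and> {j, t} \<subseteq> {1..n} \<and> (i = s \<and> j < t \<or> i < s \<and> j = t)} \<union>
     {X i j * X s t - (X s t * X i j + free_const (q - inverse q) * X i t * X s j) | i j s t.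
        {i, s} \<subseteq> {1..m} \<and> {j, t} \<subseteq> {1..n} \<and> i < s \<and> j < t})"

definition qmat_ideal ::
  "'k::field \<Rightarrow> nat \<Rightarrow> nat \<Rightarrow> ((nat \<times> nat) free_mon \<Rightarrow>\<^sub>0 'k) set" where
  "qmat_ideal q m n = Idl\<^bsub>qmat_free m n\<^esub> (qmat_relations q m n)"

definition qmat ::
  "'k::field \<Rightarrow> nat \<Rightarrow> nat \<Rightarrow> ((nat \<times> nat) free_mon \<Rightarrow>\<^sub>0 'k) set ring" where
  "qmat q m n = qmat_free m n Quot qmat_ideal q m n"

definition qmat_proj ::
  "'k::field \<Rightarrow> nat \<Rightarrow> nat \<Rightarrow> ((nat \<times> nat) free_mon \<Rightarrow>\<^sub>0 'k)
    \<Rightarrow> ((nat \<times> nat) free_mon \<Rightarrow>\<^sub>0 'k) set" where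
  "qmat_proj q m n p = qmat_ideal q m n +>\<^bsub>qmat_free m n\<^esub> p"

text \<open>A partition with (at most) \<open>m\<close> parts, given as \<open>lam 1 \<ge> \<dots> \<ge> lam m\<close>.\<close>

definition is_partition :: "nat \<Rightarrow> (nat \<Rightarrow> nat) \<Rightarrow> bool" where
  "is_partition m lam \<longleftrightarrow> (\<forall>i j. 1 \<le> i \<and> i \<le> j \<and> j \<le> m \<longrightarrow> lam j \<le> lam i)"

text \<open>Adjoining the images of the scalars makes the generated subring a subalgebra.\<close>

definition partition_subalgebra ::
  "'k::field \<Rightarrow> nat \<Rightarrow> nat \<Rightarrow> (nat \<Rightarrow> nat)
    \<Rightarrow> ((nat \<times> nat) free_mon \<Rightarrow>\<^sub>0 'k) set ring" where
  "partition_subalgebra q m n lam =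
    qmat q m n \<lparr>carrier := generate_ring (qmat q m n)
      (range (\<lambda>c. qmat_proj q m n (free_const c)) \<union>
       {qmat_proj q m n (free_var (i, j)) | i j. i \<in> {1..m} \<and> j \<in> {1..lam i}})\<rparr>"


section \<open>Toric permutations\<close>

text \<open>Boxes of an \<open>m \<times> n\<close> diagram are indexed by \<open>(i, j)\<close>, row \<open>i\<close> from the top and column
  \<open>j\<close> from the left, and \<open>white i j\<close> gives the colouring.  The label reached by a pipe entering
  box \<open>(i, j)\<close> from the right is \<open>pipe_right m white i j\<close>, and \<open>pipe_below m white i j\<close> if it
  enters from below.  Column index 0 means that the pipe has left row \<open>i\<close> on the left side, and
  row index 0 that it has left column \<open>j\<close> at the top.  The case of \<open>pipe_right\<close> with row index 0
  does not occur.\<close>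

fun pipe_right :: "nat \<Rightarrow> (nat \<Rightarrow> nat \<Rightarrow> bool) \<Rightarrow> nat \<Rightarrow> nat \<Rightarrow> nat"
  and pipe_below :: "nat \<Rightarrow> (nat \<Rightarrow> nat \<Rightarrow> bool) \<Rightarrow> nat \<Rightarrow> nat \<Rightarrow> nat" where
  "pipe_right m white i 0 = m + 1 - i"
| "pipe_right m white 0 (Suc j) = undefined"
| "pipe_right m white (Suc i) (Suc j) =
    (if white (Suc i) (Suc j) then pipe_below m white i (Suc j)
     else pipe_right m white (Suc i) j)"
| "pipe_below m white 0 j = m + j"
| "pipe_below m white (Suc i) j =
    (if white (Suc i) j then pipe_right m white (Suc i) (j - 1)
     else pipe_below m white i j)"

definition toric_permutation :: "nat \<Rightarrow> nat \<Rightarrow> (nat \<Rightarrow> nat \<Rightarrow> bool) \<Rightarrow> nat \<Rightarrow> nat" where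
  "toric_permutation m n white k =
    (if 1 \<le> k \<and> k \<le> m then pipe_right m white (m + 1 - k) n
     else if m < k \<and> k \<le> m + n then pipe_below m white m (k - m)
     else k)"

definition partition_toric :: "nat \<Rightarrow> nat \<Rightarrow> (nat \<Rightarrow> nat) \<Rightarrow> nat \<Rightarrow> nat" where
  "partition_toric m n lam = toric_permutation m n (\<lambda>i j. j \<le> lam i)"

text \<open>The cycles of a permutation \<open>p\<close> of a finite set \<open>A\<close> correspond to its orbits on \<open>A\<close>;
  a cycle is an odd permutation iff its length is even.\<close>

definition odd_cycle_count :: "('a \<Rightarrow> 'a) \<Rightarrow> 'a set \<Rightarrow> nat" where
  "odd_cycle_count p A = card {C \<in> orbit p ` A. even (card C)}"

end

theory Submission
  imports Defs "HOL-Combinatorics.Cycles" "HOL-Combinatorics.Permutations" "HOL-Number_Theory.Cong"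
    "HOL-Library.Product_Lexorder"
begin

text \<open>The partition subalgebra \<open>R\<close> is compared with a quantum torus, whose PI degree is the square root
of its rank over its centre; that rank is a count of vectors modulo \<open>l\<close>, and the pipes of the
toric diagram translate the count into cycles of the toric permutation.

\<^emph>\<open>Embedding.\<close> Let \<open>T\<close> be the quantum torus on invertible \<open>M (e x)\<close>, one for each box \<open>x\<close>, with
\<open>M (e x) * M (e y) = q * M (e y) * M (e x)\<close> if \<open>y\<close> lies to the right of \<open>x\<close> in its row or below \<open>x\<close> in
its column, and commuting otherwise. Starting from the matrix of the \<open>M (e x)\<close>, one adds
\<open>x i h * inverse (x k h) * x k j\<close> to the entries \<open>x i j\<close> below and to the right of a pivot \<open>(k, h)\<close>,
the pivots running through all positions in descending order; \<open>qrel_pivoted\<close> says that each step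
makes the relations with upper left corner at the pivot into those of quantum matrices. (This is
Cauchon's deletion of derivations, run backwards.) The resulting matrix \<open>X\<close> satisfies the relations
of quantum matrices and \<open>X x\<close> has leading term \<open>M (e x)\<close>. Products of generators can be straightened
into sorted words over the same diagram (\<open>straighten\<close>), and the images of distinct sorted words have
distinct leading exponents (\<open>ev_nonzero\<close>), so that \<open>R\<close> embeds into the torus \<open>T\<^sub>Y\<close> on the boxes of
the diagram (\<open>R_embedded\<close>). In particular \<open>R\<close> is a domain.

\<^emph>\<open>Localization.\<close> Since \<open>q\<close> is an \<open>l\<close>-th root of unity, \<open>M (l * u)\<close> is central in \<open>T\<^sub>Y\<close>. So inverting
\<open>M u\<close> amounts to inverting a central element, and every element of \<open>T\<^sub>Y\<close> is a fraction of an element of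
\<open>R\<close> by a central one (\<open>M_e_D\<close>, \<open>M_D\<close>). Hence \<open>R\<close> and \<open>T\<^sub>Y\<close> have the same rank over their centres.
The torus is a free module over its centre: the centre is spanned by the \<open>M u\<close> with \<open>u\<close> in the radical
of the commutation form, and a transversal of the radical gives a basis (\<open>rank_independent\<close>,
\<open>rank_span\<close>). So the square of the PI degree is the index of the radical, which is \<open>l ^ N\<close> divided by
the number of vectors modulo \<open>l\<close> that the commutation matrix of the diagram annihilates
(\<open>transversal_exists\<close>). As the commutation factors take finitely many values, two of sufficiently many
monomials have the same commutation behaviour, and an alternating sum over all orders of
multiplication vanishes: \<open>R\<close> satisfies a standard identity.

\<^emph>\<open>Counting.\<close> Give the edge between two neighbouring boxes in a row the sum of the entries before it
minus the sum of the entries after it, and likewise in columns. The equation of the kernel at a box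
says that the values on the right and the upper edge are opposite, so values are constant along
pipes up to sign. Kernel vectors therefore correspond to the functions \<open>f\<close> modulo \<open>l\<close> on the labels
with \<open>f (\<tau> k) = - f k\<close> (\<open>card_mod_kernel\<close>). On a cycle such an \<open>f\<close> is determined by one value, which
is arbitrary if the length is even and zero if it is odd, \<open>l\<close> being odd. So there are \<open>l ^ r\<close> of them
and the squared PI degree is \<open>l ^ (N - r)\<close>. Finally \<open>N - r\<close> is even: \<open>\<tau>\<close> is a product of one
transposition for each of the \<open>N\<close> white boxes, so its sign is \<open>(-1) ^ N\<close>, and also \<open>(-1) ^ r\<close>.\<close>

section \<open>Functions alternating along a permutation\<close>

definition alternating_functions :: "int \<Rightarrow> ('a \<Rightarrow> 'a) \<Rightarrow> 'a set \<Rightarrow> ('a \<Rightarrow> int) set" where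
  "alternating_functions l p A =
    {f \<in> A \<rightarrow>\<^sub>E {0..<l}. \<forall>a\<in>A. l dvd f (p a) + f a}"

lemma funpow_cycle_of_list_nth:
  assumes "distinct cs" "i < length cs"
  shows "(cycle_of_list cs ^^ n) (cs ! i) = cs ! ((i + n) mod length cs)"
proof -
  have "(cycle_of_list cs ^^ n) (cs ! i) = map (cycle_of_list cs ^^ n) cs ! i"
    using assms by simp
  also have "\<dots> = rotate n cs ! i"
    using cyclic_rotation[OF assms(1)] by simp
  also have "\<dots> = cs ! ((i + n) mod length cs)"
    using assms by (simp add: nth_rotate add.commute)
  finally show ?thesis .
qed

text \<open>Links the two descriptions of a cycle: cycles as orbits, in which odd cycles are counted, and cycles
as lists, into which a permutation decomposes.\<close>

lemma orbit_cycle_of_list: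
  assumes "distinct cs" "x \<in> set cs"
  shows "orbit (cycle_of_list cs) x = set cs"
proof -
  obtain i where i: "i < length cs" "x = cs ! i"
    using assms(2) by (metis in_set_conv_nth)
  have "orbit (cycle_of_list cs) x = {cs ! ((i + n) mod length cs) | n. 0 < n}"
    unfolding orbit_altdef i(2) using funpow_cycle_of_list_nth[OF assms(1) i(1)] by simp
  also have "\<dots> = set cs"
  proof (intro equalityI subsetI)
    fix y assume "y \<in> {cs ! ((i + n) mod length cs) | n. 0 < n}"
    then obtain n where "y = cs ! ((i + n) mod length cs)" by blast
    moreover have "(i + n) mod length cs < length cs" using i(1) by (intro mod_less_divisor) linarith
    ultimately show "y \<in> set cs" using nth_mem by blast
  next
    fix y assume "y \<in> set cs"
    then obtain j where j: "j < length cs" "y = cs ! j" by (metis in_set_conv_nth)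
    have "i + (j + length cs - i) = j + length cs" using i(1) by linarith
    then have "y = cs ! ((i + (j + length cs - i)) mod length cs)"
      using j by (simp only: mod_add_self2 mod_less)
    moreover have "0 < j + length cs - i" using i(1) by linarith
    ultimately show "y \<in> {cs ! ((i + n) mod length cs) | n. 0 < n}" by blast
  qed
  finally show ?thesis .
qed

lemma sign_cycle_of_list:
  assumes "distinct cs" "cs \<noteq> []"
  shows "sign (cycle_of_list cs) = (if even (length cs) then - 1 else 1)"
  using assms
proof (induction cs rule: cycle_of_list.induct)
  case (1 i j cs)
  have "sign (transpose i j \<circ> cycle_of_list (j # cs)) = - sign (cycle_of_list (j # cs))"
    using 1 by (subst sign_compose) (auto simp: permutation_of_cycle permutation_swap_id sign_swap_id)
  then have "sign (cycle_of_list (i # j # cs)) = - sign (cycle_of_list (j # cs))"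
    by (simp only: cycle_of_list.simps)
  then show ?case using 1 by (simp del: cycle_of_list.simps)
qed auto

text \<open>A function alternating along a cycle is determined by its value at one point. Going around once
multiplies that value by \<open>(-1) ^ length cs\<close>, so for odd length it has to vanish modulo the odd
number \<open>l\<close>.\<close>

lemma card_alternating_functions_cycle:
  assumes d: "distinct cs" and ne: "cs \<noteq> []" and l: "odd l" "l > 0"
  shows "card (alternating_functions (int l) (cycle_of_list cs) (set cs)) =
    (if even (length cs) then l else 1)"
proof -
  let ?c = "cycle_of_list cs" and ?k = "length cs"
  let ?S = "alternating_functions (int l) ?c (set cs)"
  \<comment> \<open>the position of an element in the list, which gives its sign relative to the first one\<close>
  let ?ix = "inv_into {..<?k} (nth cs)"
  let ?X = "if even ?k then {0..<int l} else {0}"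
  let ?g = "\<lambda>x. \<lambda>a\<in>set cs. ((-1) ^ ?ix a * x) mod int l"
  have k: "?k > 0" using ne by simp
  have ix: "?ix (cs ! i) = i" if "i < ?k" for i
    using that d by (intro inv_into_f_f) (auto simp: inj_on_nth)
  have step: "?c (cs ! i) = cs ! (Suc i mod ?k)" if "i < ?k" for i
    using funpow_cycle_of_list_nth[OF d that, of 1] by simp
  have fi: "int l dvd f (cs ! i) - (-1)^i * f (cs ! 0)" if f: "f \<in> ?S" and i: "i < ?k" for f i
    using i
  proof (induction i)
    case (Suc i)
    have "int l dvd f (?c (cs ! i)) + f (cs ! i)"
      using f Suc.prems by (auto simp: alternating_functions_def)
    then have "int l dvd f (cs ! Suc i) + f (cs ! i)"
      using step[of i] Suc.prems by simp
    moreover have "int l dvd f (cs ! i) - (-1)^i * f (cs ! 0)" using Suc by simp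
    ultimately have "int l dvd (f (cs ! Suc i) + f (cs ! i)) - (f (cs ! i) - (-1)^i * f (cs ! 0))"
      by (rule dvd_diff)
    then show ?case by simp
  qed simp
  have rng: "f a \<in> {0..<int l}" if "f \<in> ?S" "a \<in> set cs" for f a
    using that by (auto simp: alternating_functions_def)
  have "bij_betw (\<lambda>f. f (cs ! 0)) ?S ?X"
  proof (rule bij_betw_byWitness[where f' = ?g])
    show "\<forall>f\<in>?S. ?g (f (cs ! 0)) = f"
    proof (intro ballI ext)
      fix f a assume f: "f \<in> ?S"
      show "?g (f (cs ! 0)) a = f a"
      proof (cases "a \<in> set cs")
        case True
        then obtain i where i: "i < ?k" "a = cs ! i" by (metis in_set_conv_nth)
        have "((-1)^i * f (cs ! 0)) mod int l = f (cs ! i) mod int l"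
          using fi[OF f i(1)] by (metis mod_eq_dvd_iff)
        then show ?thesis using rng[OF f True] i True ix[OF i(1)] by simp
      next
        case False then show ?thesis using f by (auto simp: alternating_functions_def PiE_def extensional_def)
      qed
    qed
    show "\<forall>x\<in>?X. ?g x (cs ! 0) = x"
      using ix[OF k] k by (auto split: if_splits)
    show "(\<lambda>f. f (cs ! 0)) ` ?S \<subseteq> ?X"
    proof (intro image_subsetI)
      fix f assume f: "f \<in> ?S"
      have r0: "f (cs ! 0) \<in> {0..<int l}" using rng[OF f] k by simp
      show "f (cs ! 0) \<in> ?X"
      proof (cases "even ?k")
        case False
        have "int l dvd f (?c (cs ! (?k - 1))) + f (cs ! (?k - 1))"
          using f k by (auto simp: alternating_functions_def)
        then have "int l dvd f (cs ! 0) + f (cs ! (?k - 1))"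
          using step[of "?k - 1"] k by simp
        moreover have "int l dvd f (cs ! (?k - 1)) - f (cs ! 0)"
          using fi[OF f, of "?k - 1"] k False by simp
        ultimately have "int l dvd (f (cs ! 0) + f (cs ! (?k - 1))) - (f (cs ! (?k - 1)) - f (cs ! 0))"
          by (rule dvd_diff)
        then have "int l dvd 2 * f (cs ! 0)" by simp
        moreover have "coprime (int l) 2" using l by simp
        ultimately have "int l dvd f (cs ! 0)" using coprime_dvd_mult_right_iff by blast
        then have "f (cs ! 0) = 0" using r0 zdvd_not_zless[of "f (cs!0)" "int l"] by force
        then show ?thesis using False by simp
      qed (use r0 in simp)
    qed
    show "?g ` ?X \<subseteq> ?S"
    proof (intro image_subsetI)
      fix x assume x: "x \<in> ?X"
      have "int l dvd ?g x (?c a) + ?g x a" if a: "a \<in> set cs" for a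
      proof -
        obtain i where i: "i < ?k" "a = cs ! i" using a by (metis in_set_conv_nth)
        have ca: "?c a = cs ! (Suc i mod ?k)" using step i by simp
        have m: "Suc i mod ?k < ?k" using k by simp
        have "int l dvd (-1) ^ (Suc i mod ?k) * x + (-1)^i * x"
        proof (cases "Suc i = ?k")
          case True
          then have "even ?k \<longleftrightarrow> odd i" by (metis even_Suc)
          then show ?thesis using x True by (cases "even i") auto
        next
          case False
          then show ?thesis using i by simp
        qed
        then have "int l dvd ((-1) ^ (Suc i mod ?k) * x) mod int l + ((-1)^i * x) mod int l"
          by (subst (asm) dvd_eq_mod_eq_0, subst dvd_eq_mod_eq_0, subst mod_add_eq)
        moreover have "?g x (?c a) = ((-1) ^ (Suc i mod ?k) * x) mod int l"
          using ca m ix[OF m] by simp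
        moreover have "?g x a = ((-1)^i * x) mod int l" using i a ix[OF i(1)] by simp
        ultimately show ?thesis by (simp only:)
      qed
      moreover have "?g x \<in> set cs \<rightarrow>\<^sub>E {0..<int l}" using l by auto
      ultimately show "?g x \<in> ?S" unfolding alternating_functions_def by blast
    qed
  qed
  then show ?thesis by (simp add: bij_betw_same_card split: if_splits)
qed

lemma card_alternating_functions_Un:
  assumes "A \<inter> B = {}" "\<And>a. a \<in> A \<Longrightarrow> q a = c a \<and> c a \<in> A" "\<And>a. a \<in> B \<Longrightarrow> q a = p a \<and> p a \<in> B"
  shows "card (alternating_functions l q (A \<union> B)) =
    card (alternating_functions l c A) * card (alternating_functions l p B)"
proof -
  have "bij_betw (\<lambda>f. (restrict f A, restrict f B)) (alternating_functions l q (A \<union> B))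
    (alternating_functions l c A \<times> alternating_functions l p B)"
  proof (rule bij_betw_byWitness[where f' = "\<lambda>(g, h). \<lambda>x. if x \<in> A then g x else h x"])
    show "\<forall>f\<in>alternating_functions l q (A \<union> B).
      (\<lambda>(g, h). \<lambda>x. if x \<in> A then g x else h x) (restrict f A, restrict f B) = f"
      by (auto simp: alternating_functions_def PiE_def extensional_def fun_eq_iff)
    show "\<forall>gh\<in>alternating_functions l c A \<times> alternating_functions l p B.
      (\<lambda>f. (restrict f A, restrict f B)) ((\<lambda>(g, h). \<lambda>x. if x \<in> A then g x else h x) gh) = gh"
      using assms(1)
      by (auto simp: alternating_functions_def PiE_def extensional_def fun_eq_iff restrict_def)
    show "(\<lambda>f. (restrict f A, restrict f B)) ` alternating_functions l q (A \<union> B)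
      \<subseteq> alternating_functions l c A \<times> alternating_functions l p B"
    proof (intro image_subsetI)
      fix f assume f: "f \<in> alternating_functions l q (A \<union> B)"
      then have D: "\<forall>a\<in>A \<union> B. l dvd f (q a) + f a"
        by (simp add: alternating_functions_def)
      have "l dvd f (c a) + f a" if "a \<in> A" for a
        using bspec[OF D, of a] assms(2)[OF that] that by simp
      moreover have "l dvd f (p a) + f a" if "a \<in> B" for a
        using bspec[OF D, of a] assms(3)[OF that] that by simp
      ultimately show "(restrict f A, restrict f B)
          \<in> alternating_functions l c A \<times> alternating_functions l p B"
        using f assms(2,3) by (auto simp: alternating_functions_def)
    qed
    show "(\<lambda>(g, h). \<lambda>x. if x \<in> A then g x else h x) ` (alternating_functions l c A \<times> alternating_functions l p B)
      \<subseteq> alternating_functions l q (A \<union> B)"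
    proof (clarify)
      fix g h assume gh: "g \<in> alternating_functions l c A" "h \<in> alternating_functions l p B"
      have nb: "x \<notin> A" if "x \<in> B" for x using that assms(1) by auto
      show "(\<lambda>x. if x \<in> A then g x else h x) \<in> alternating_functions l q (A \<union> B)"
        using gh assms(2,3) nb by (auto simp: alternating_functions_def PiE_def extensional_def Pi_def)
    qed
  qed
  then show ?thesis by (simp add: bij_betw_same_card card_cartesian_product)
qed

lemma card_filter_insert:
  assumes "finite B" "c \<notin> B"
  shows "card {C \<in> insert c B. P C} =
    (if P c then Suc (card {C \<in> B. P C}) else card {C \<in> B. P C})"
proof -
  have "{C \<in> insert c B. P C} = (if P c then insert c {C \<in> B. P C} else {C \<in> B. P C})"
    by auto
  then show ?thesis using assms by simp
qed

text \<open>Sign and number of alternating functions are both multiplicative over disjoint cycles, with factors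
\<open>-1\<close> and \<open>l\<close> for a cycle of even length and \<open>1\<close> and \<open>1\<close> for one of odd length.\<close>

theorem permutation_cycle_parity_and_count:
  assumes p: "p permutes A" and fin: "finite A" and l: "odd l" "l > 0"
  shows "sign p = (-1) ^ odd_cycle_count p A \<and>
    card (alternating_functions (int l) p A) = l ^ odd_cycle_count p A"
proof -
  have "p permutes A \<and> finite A \<and> sign p = (-1) ^ odd_cycle_count p A \<and>
    card (alternating_functions (int l) p A) = l ^ odd_cycle_count p A"
    using cycle_decomposition[OF p fin]
  proof induction
    case empty
    then show ?case
      by (auto simp: odd_cycle_count_def alternating_functions_def permutes_def id_def)
  next
    case (comp I p cs)
    show ?case
    proof (cases "cs = []")
      case True then show ?thesis using comp by simp
    next
      case False
      let ?c = "cycle_of_list cs"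
      let ?q = "?c \<circ> p"
      have pI: "p permutes I" and finI: "finite I" using comp by auto
      have cp: "?c permutes set cs" by (rule cycle_permutes)
      have qc: "?q a = ?c a \<and> ?c a \<in> set cs" if "a \<in> set cs" for a
      proof -
        have "p a = a" using that comp(3) pI by (metis disjoint_iff permutes_not_in)
        then show ?thesis using permutes_in_image[OF cp] that by simp
      qed
      have qp: "?q a = p a \<and> p a \<in> I" if "a \<in> I" for a
      proof -
        have "p a \<in> I" using permutes_in_image[OF pI] that by simp
        then show ?thesis using comp(3) cp by (metis comp_apply disjoint_iff permutes_not_in)
      qed
      have perm: "?q permutes (set cs \<union> I)"
        using permutes_compose[of p "set cs \<union> I" ?c] pI cp by (meson permutes_subset sup_ge1 sup_ge2)
      have sg: "sign ?q = sign ?c * sign p"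
        using pI finI permutation_of_cycle[of cs] permutation_permutes
        by (intro sign_compose) blast+
      have o1: "orbit ?q a = set cs" if "a \<in> set cs" for a
      proof -
        have "orbit ?c a = orbit ?q a"
        proof (rule orbit_cong0[OF that])
          show "?c \<in> set cs \<rightarrow> set cs" using qc by blast
          show "?c y = ?q y" if "y \<in> set cs" for y using qc[OF that] by (rule sym[OF conjunct1])
        qed
        then show ?thesis using orbit_cycle_of_list[OF comp(2) that] by (rule trans[OF sym])
      qed
      have o2: "orbit ?q a = orbit p a" if "a \<in> I" for a
      proof (rule sym, rule orbit_cong0[OF that])
        show "p \<in> I \<rightarrow> I" using qp by blast
        show "p y = ?q y" if "y \<in> I" for y using qp[OF that] by (rule sym[OF conjunct1])
      qed
      have "orbit ?q ` set cs = (\<lambda>_. set cs) ` set cs" using o1 by (rule image_cong[OF refl])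
      moreover have "(\<lambda>_. set cs) ` set cs = {set cs}"
        using False by (metis image_constant_conv set_empty)
      ultimately have "orbit ?q ` set cs = {set cs}" by (rule trans)
      moreover have "orbit ?q ` I = orbit p ` I" using o2 by (rule image_cong[OF refl])
      ultimately have im: "orbit ?q ` (set cs \<union> I) = insert (set cs) (orbit p ` I)"
        by (simp only: image_Un Un_insert_left Un_empty_left)
      have notin: "set cs \<notin> orbit p ` I"
      proof
        assume "set cs \<in> orbit p ` I"
        then obtain a where a: "set cs = orbit p a" "a \<in> I" by (rule imageE)
        have "set cs \<subseteq> I" unfolding a(1) by (rule permutes_orbit_subset[OF pI a(2)])
        then have "set cs = {}" using comp(3) by (simp only: Int_absorb2)
        then show False using False by simp
      qed
      have cnt: "odd_cycle_count ?q (set cs \<union> I) =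
        (if even (length cs) then Suc (odd_cycle_count p I) else odd_cycle_count p I)"
        unfolding odd_cycle_count_def im distinct_card[OF comp(2), symmetric]
        by (rule card_filter_insert[OF finite_imageI[OF finI] notin])
      have "card (alternating_functions (int l) ?q (set cs \<union> I)) =
        card (alternating_functions (int l) ?c (set cs)) * card (alternating_functions (int l) p I)"
        by (rule card_alternating_functions_Un[where q = ?q and c = ?c and p = p, OF comp(3) qc qp])
      then have "card (alternating_functions (int l) ?q (set cs \<union> I)) =
          l ^ odd_cycle_count ?q (set cs \<union> I)"
        unfolding cnt card_alternating_functions_cycle[OF comp(2) False l] using comp(4)
        by (simp only: power_Suc mult_1 if_split) simp
      moreover have "sign ?q = (-1) ^ odd_cycle_count ?q (set cs \<union> I)"
        unfolding cnt sg sign_cycle_of_list[OF comp(2) False] using comp(4)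
        by (simp only: power_Suc mult_1 if_split) simp
      moreover have "finite (set cs \<union> I)" using finI by simp
      ultimately show ?thesis using perm by blast
    qed
  qed
  then show ?thesis by simp
qed

section \<open>Toric permutations as products of transpositions\<close>

text \<open>The product over the white boxes, read row by row up to box \<open>(i, j)\<close>, of the transposition of the
label of the row with the label of the column of the box. The factors of later boxes act first, as a
pipe starting on the right or at the bottom meets them first.\<close>

fun box_product :: "nat \<Rightarrow> nat \<Rightarrow> (nat \<Rightarrow> nat \<Rightarrow> bool) \<Rightarrow> nat \<Rightarrow> nat \<Rightarrow> nat \<Rightarrow> nat" where
  "box_product m n white 0 j = id"
| "box_product m n white (Suc i) 0 = box_product m n white i n"
| "box_product m n white (Suc i) (Suc j) =
    (if white (Suc i) (Suc j)
     then box_product m n white (Suc i) j \<circ> transpose (m - i) (m + Suc j)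
     else box_product m n white (Suc i) j)"

text \<open>Follows pipes through the part of the diagram that consists of the boxes up to \<open>(i, j)\<close> in the
order of reading. The boundary of this part crosses each row and each column once, and its edges
carry the labels of the row or column they belong to; adding a white box swaps the two edges
that it touches, adding a black one leaves the pipes straight.\<close>

lemma box_product_eq_pipe:
  assumes "i \<le> m" "j \<le> n"
  shows "(\<forall>r. 1 \<le> r \<and> r \<le> m \<longrightarrow> box_product m n white i j (m + 1 - r) =
      (if r > i then m + 1 - r else if r = i then pipe_right m white i j
       else pipe_right m white r n)) \<and>
    (\<forall>c. 1 \<le> c \<and> c \<le> n \<longrightarrow> box_product m n white i j (m + c) =
      (if c \<le> j then pipe_below m white i c else pipe_below m white (i - 1) c)) \<and>
    (\<forall>k. k = 0 \<or> k > m + n \<longrightarrow> box_product m n white i j k = k)"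
  using assms
proof (induction m n white i j rule: box_product.induct)
  case (1 m n white j)
  then show ?case by auto
next
  case (2 m n white i)
  have *: "i \<le> m" "n \<le> n" using 2 by auto
  show ?case
    using 2(1)[OF *] by (auto simp: not_less less_Suc_eq)
next
  case (3 m n white i j)
  have le: "Suc i \<le> m" "j \<le> n" using 3 by auto
  show ?case
  proof (cases "white (Suc i) (Suc j)")
    case True
    note IH = 3(1)[OF True rangeI le]
    let ?G = "box_product m n white (Suc i) j"
    have eq: "box_product m n white (Suc i) (Suc j) k = ?G (transpose (m - i) (m + Suc j) k)" for k
      using True by simp
    have A: "?G (m + Suc j) = pipe_below m white i (Suc j)"
      using IH 3(4) by (auto dest!: spec[of _ "Suc j"])
    have B: "?G (m - i) = pipe_right m white (Suc i) j"
      using IH 3(3) by (auto dest!: spec[of _ "Suc i"])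
    have t1: "transpose (m - i) (m + Suc j) (m + 1 - r) = m + 1 - r" if "r \<noteq> Suc i" "1 \<le> r" "r \<le> m" for r
      using that 3(3) by (intro transpose_apply_other) auto
    have t2: "transpose (m - i) (m + Suc j) (m + c) = m + c" if "c \<noteq> Suc j" "1 \<le> c" for c
      using that 3(3) by (intro transpose_apply_other) auto
    have t3: "transpose (m - i) (m + Suc j) k = k" if "k = 0 \<or> k > m + n" for k
      using that 3(3,4) by (intro transpose_apply_other) auto
    show ?thesis
    proof (intro conjI allI impI)
      fix r assume r: "1 \<le> r \<and> r \<le> m"
      show "box_product m n white (Suc i) (Suc j) (m + 1 - r) =
        (if Suc i < r then m + 1 - r else if r = Suc i then pipe_right m white (Suc i) (Suc j)
         else pipe_right m white r n)"
      proof (cases "r = Suc i")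
        case True' [simp]: True
        have "m + 1 - r = m - i" by simp
        then show ?thesis using eq A True by simp
      next
        case False
        then show ?thesis using eq t1[OF False] IH r by auto
      qed
    next
      fix c assume c: "1 \<le> c \<and> c \<le> n"
      show "box_product m n white (Suc i) (Suc j) (m + c) =
         (if c \<le> Suc j then pipe_below m white (Suc i) c else pipe_below m white (Suc i - 1) c)"
      proof (cases "c = Suc j")
        case True' [simp]: True
        then show ?thesis using eq B True by simp
      next
        case False
        then show ?thesis using eq t2[OF False] IH c by auto
      qed
    next
      fix k assume "k = 0 \<or> m + n < k"
      then show "box_product m n white (Suc i) (Suc j) k = k" using eq t3 IH by auto
    qed
  next
    case False
    note IH = 3(2)[OF False le]
    show ?thesis
    proof (intro conjI allI impI)
      fix r assume r: "1 \<le> r \<and> r \<le> m"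
      show "box_product m n white (Suc i) (Suc j) (m + 1 - r) =
        (if Suc i < r then m + 1 - r else if r = Suc i then pipe_right m white (Suc i) (Suc j)
         else pipe_right m white r n)"
        using IH r False by auto
    next
      fix c assume c: "1 \<le> c \<and> c \<le> n"
      show "box_product m n white (Suc i) (Suc j) (m + c) =
         (if c \<le> Suc j then pipe_below m white (Suc i) c else pipe_below m white (Suc i - 1) c)"
        using IH c False by (auto simp: le_Suc_eq)
    next
      fix k assume "k = 0 \<or> m + n < k"
      then show "box_product m n white (Suc i) (Suc j) k = k" using IH False by auto
    qed
  qed
qed

lemma toric_permutation_eq_box_product:
  "toric_permutation m n white = box_product m n white m n"
proof
  fix k
  note E = box_product_eq_pipe[of m m n n white]
  consider "1 \<le> k" "k \<le> m" | "m < k" "k \<le> m + n" | "k = 0 \<or> m + n < k" by linarith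
  then show "toric_permutation m n white k = box_product m n white m n k"
  proof cases
    case 1
    define r where "r = m + 1 - k"
    have r: "1 \<le> r" "r \<le> m" "k = m + 1 - r" using 1 by (auto simp: r_def)
    show ?thesis using E r 1 by (auto simp: toric_permutation_def r_def[symmetric])
  next
    case 2
    then obtain c where c: "k = m + c" "1 \<le> c" "c \<le> n" by (metis Nat.le_diff_conv2 add.commute le_add_diff_inverse less_eq_Suc_le nat_add_left_cancel_le not_less plus_1_eq_Suc nat_less_le)
    show ?thesis using E c by (auto simp: toric_permutation_def)
  next
    case 3
    then show ?thesis using E by (auto simp: toric_permutation_def)
  qed
qed

definition diagram :: "nat \<Rightarrow> nat \<Rightarrow> (nat \<Rightarrow> nat \<Rightarrow> bool) \<Rightarrow> (nat \<times> nat) set" where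
  "diagram m n white = {(i, j). i \<in> {1..m} \<and> j \<in> {1..n} \<and> white i j}"

lemma finite_diagram [simp]: "finite (diagram m n white)"
  by (rule finite_subset[of _ "{1..m} \<times> {1..n}"]) (auto simp: diagram_def)

lemma box_product_permutes_sign:
  assumes "i \<le> m" "j \<le> n"
  shows "box_product m n white i j permutes {1..m + n} \<and>
    sign (box_product m n white i j) =
     (-1) ^ card {(r, c). 1 \<le> r \<and> 1 \<le> c \<and> white r c \<and> (r < i \<and> c \<le> n \<or> r = i \<and> c \<le> j)}"
  using assms
proof (induction m n white i j rule: box_product.induct)
  case (1 m n white j)
  have "{(r, c). 1 \<le> r \<and> 1 \<le> c \<and> white r c \<and> (r < 0 \<and> c \<le> n \<or> r = 0 \<and> c \<le> j)} = {}"
    by auto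
  then show ?case using permutes_id[of "{1..m+n}"] by (simp only: box_product.simps sign_id card.empty power_0)
next
  case (2 m n white i)
  have "{(r, c). 1 \<le> r \<and> 1 \<le> c \<and> white r c \<and> (r < Suc i \<and> c \<le> n \<or> r = Suc i \<and> c \<le> 0)} =
     {(r, c). 1 \<le> r \<and> 1 \<le> c \<and> white r c \<and> (r < i \<and> c \<le> n \<or> r = i \<and> c \<le> n)}"
    by auto
  then show ?case using 2 by simp
next
  case (3 m n white i j)
  have le: "Suc i \<le> m" "j \<le> n" using 3 by auto
  let ?S = "\<lambda>j. {(r, c). 1 \<le> r \<and> 1 \<le> c \<and> white r c \<and> (r < Suc i \<and> c \<le> n \<or> r = Suc i \<and> c \<le> j)}"
  show ?case
  proof (cases "white (Suc i) (Suc j)")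
    case True
    note IH = 3(1)[OF True rangeI le]
    let ?G = "box_product m n white (Suc i) j"
    have t: "transpose (m - i) (m + Suc j) permutes {1..m + n}"
      using 3 by (intro permutes_swap_id) auto
    have G: "?G permutes {1..m + n}" using IH by simp
    have eq: "box_product m n white (Suc i) (Suc j) = ?G \<circ> transpose (m - i) (m + Suc j)"
      using True by simp
    have p: "box_product m n white (Suc i) (Suc j) permutes {1..m + n}"
      unfolding eq by (rule permutes_compose[OF t G])
    have S: "?S (Suc j) = insert (Suc i, Suc j) (?S j)" using True 3(4) by auto
    have fin: "finite (?S j)"
      by (rule finite_subset[of _ "{1..Suc i} \<times> {1..n + j}"]) auto
    have card: "card (?S (Suc j)) = Suc (card (?S j))"
      unfolding S using fin by (subst card_insert_disjoint) auto
    have "permutation ?G" "permutation (transpose (m - i) (m + Suc j))"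
      using G t permutation_permutes finite_atLeastAtMost by blast+
    then have "sign (?G \<circ> transpose (m - i) (m + Suc j)) =
        sign ?G * sign (transpose (m - i) (m + Suc j))"
      by (rule sign_compose)
    also have "\<dots> = - sign ?G" using 3 by (simp add: sign_swap_id)
    finally have sg: "sign (box_product m n white (Suc i) (Suc j)) = - sign ?G"
      by (simp only: eq)
    have "sign (box_product m n white (Suc i) (Suc j)) = (-1) ^ card (?S (Suc j))"
      unfolding sg card using IH by (simp only: power_Suc)
    then show ?thesis using p by blast
  next
    case False
    then have "?S (Suc j) = ?S j" by (auto simp: le_Suc_eq)
    then show ?thesis using 3(2)[OF False le] False by simp
  qed
qed

theorem toric_permutation_permutes: "toric_permutation m n white permutes {1..m + n}"
  and sign_toric_permutation: "sign (toric_permutation m n white) = (-1) ^ card (diagram m n white)"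
proof -
  have "{(r, c). 1 \<le> r \<and> 1 \<le> c \<and> white r c \<and> (r < m \<and> c \<le> n \<or> r = m \<and> c \<le> n)} =
    diagram m n white" by (auto simp: diagram_def)
  then show "toric_permutation m n white permutes {1..m + n}"
    "sign (toric_permutation m n white) = (-1) ^ card (diagram m n white)"
    using box_product_permutes_sign[of m m n n white] toric_permutation_eq_box_product by auto
qed

section \<open>The commutation matrix of a diagram\<close>

text \<open>The pairs of boxes whose variables \<open>q\<close>-commute: \<open>y\<close> is to the right of \<open>x\<close> in the same row or
below \<open>x\<close> in the same column.\<close>

definition precedes :: "nat \<times> nat \<Rightarrow> nat \<times> nat \<Rightarrow> bool" where
  "precedes x y \<longleftrightarrow> fst x = fst y \<and> snd x < snd y \<or> snd x = snd y \<and> fst x < fst y"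

definition comm_exp :: "nat \<times> nat \<Rightarrow> nat \<times> nat \<Rightarrow> int" where
  "comm_exp x y = of_bool (precedes x y) - of_bool (precedes y x)"

lemma comm_exp_row_col:
  "comm_exp (i, j) (s, t) =
    (if i = s then sgn (int t - int j) else 0) + (if j = t then sgn (int s - int i) else 0)"
  by (auto simp: comm_exp_def precedes_def sgn_if)

definition mod_kernel :: "int \<Rightarrow> (nat \<times> nat) set \<Rightarrow> (nat \<times> nat \<Rightarrow> int) set" where
  "mod_kernel l Y = {v \<in> Y \<rightarrow>\<^sub>E {0..<l}. \<forall>y\<in>Y. l dvd (\<Sum>x\<in>Y. comm_exp x y * v x)}"

text \<open>The value on the vertical edge between the boxes \<open>(i, j)\<close> and \<open>(i, j + 1)\<close>. The two sums are signed so
that the equations of the commutation matrix become local, see \<open>sum_grid_comm_exp\<close>.\<close>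

definition edge_row :: "nat \<Rightarrow> (nat \<times> nat \<Rightarrow> int) \<Rightarrow> nat \<Rightarrow> nat \<Rightarrow> int" where
  "edge_row n w i j = (\<Sum>t=1..n. if t \<le> j then w (i, t) else - w (i, t))"

text \<open>The value on the horizontal edge between the boxes \<open>(i, j)\<close> and \<open>(i + 1, j)\<close>.\<close>

definition edge_col :: "nat \<Rightarrow> (nat \<times> nat \<Rightarrow> int) \<Rightarrow> nat \<Rightarrow> nat \<Rightarrow> int" where
  "edge_col m w i j = (\<Sum>s=1..m. if s \<le> i then w (s, j) else - w (s, j))"

lemma signed_sum_step:
  fixes w :: "nat \<Rightarrow> int"
  assumes "j < n"
  shows "(\<Sum>t=1..n. if t \<le> Suc j then w t else - w t) =
    (\<Sum>t=1..n. if t \<le> j then w t else - w t) + 2 * w (Suc j)"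
proof -
  have "(\<Sum>t=1..n. if t \<le> Suc j then w t else - w t) =
    (\<Sum>t=1..n. (if t \<le> j then w t else - w t) + (if t = Suc j then 2 * w t else 0))"
    by (rule sum.cong) auto
  also have "\<dots> = (\<Sum>t=1..n. if t \<le> j then w t else - w t) + 2 * w (Suc j)"
    using assms by (simp add: sum.distrib)
  finally show ?thesis .
qed

lemma edge_row_Suc: "j < n \<Longrightarrow> edge_row n w i (Suc j) = edge_row n w i j + 2 * w (i, Suc j)"
  and edge_col_Suc: "i < m \<Longrightarrow> edge_col m w (Suc i) j = edge_col m w i j + 2 * w (Suc i, j)"
  unfolding edge_row_def edge_col_def by (rule signed_sum_step, assumption)+

lemma edge_row_0: "edge_row n w i 0 = - (\<Sum>t=1..n. w (i, t))"
  and edge_col_0: "edge_col m w 0 j = - (\<Sum>s=1..m. w (s, j))"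
  unfolding edge_row_def edge_col_def sum_negf[symmetric] by (rule sum.cong; simp)+

lemma edge_row_full: "edge_row n w i n = (\<Sum>t=1..n. w (i, t))"
  and edge_col_full: "edge_col m w m j = (\<Sum>s=1..m. w (s, j))"
  unfolding edge_row_def edge_col_def by (rule sum.cong; simp)+

text \<open>The equation of the commutation matrix at a box involves only the right and the upper edge of that
box: these are the edges that a white box connects by a pipe.\<close>

lemma sum_grid_comm_exp:
  assumes "s \<in> {1..m}" "t \<in> {1..n}"
  shows "(\<Sum>x\<in>{1..m} \<times> {1..n}. comm_exp x (s, t) * w x) = edge_row n w s t + edge_col m w (s - 1) t"
proof -
  have "(\<Sum>x\<in>{1..m} \<times> {1..n}. comm_exp x (s, t) * w x) =
    (\<Sum>i=1..m. \<Sum>j=1..n. comm_exp (i, j) (s, t) * w (i, j))"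
    by (simp add: sum.cartesian_product case_prod_unfold)
  also have "\<dots> = (\<Sum>i=1..m. \<Sum>j=1..n. (if i = s then sgn (int t - int j) * w (i, j) else 0) +
      (if j = t then sgn (int s - int i) * w (i, j) else 0))"
    by (intro sum.cong refl) (simp add: comm_exp_row_col)
  also have "\<dots> = (\<Sum>i=1..m. if i = s then (\<Sum>j=1..n. sgn (int t - int j) * w (i, j)) else 0) +
      (\<Sum>i=1..m. sgn (int s - int i) * w (i, t))"
  proof -
    have "(\<Sum>j=1..n. (if i = s then sgn (int t - int j) * w (i, j) else 0) +
        (if j = t then sgn (int s - int i) * w (i, j) else 0)) =
      (if i = s then (\<Sum>j=1..n. sgn (int t - int j) * w (i, j)) else 0) + sgn (int s - int i) * w (i, t)" for i
      using assms(2) by (simp add: sum.distrib)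
    then show ?thesis by (simp only: sum.distrib)
  qed
  also have "\<dots> = (\<Sum>j=1..n. sgn (int t - int j) * w (s, j)) + (\<Sum>i=1..m. sgn (int s - int i) * w (i, t))"
    using assms(1) by simp
  also have "(\<Sum>j=1..n. sgn (int t - int j) * w (s, j)) = edge_row n w s t - w (s, t)"
  proof -
    have "edge_row n w s t = (\<Sum>j=1..n. sgn (int t - int j) * w (s, j) + (if j = t then w (s, j) else 0))"
      unfolding edge_row_def by (rule sum.cong) (auto simp: sgn_if)
    also have "\<dots> = (\<Sum>j=1..n. sgn (int t - int j) * w (s, j)) + w (s, t)"
      using assms(2) by (simp add: sum.distrib)
    finally show ?thesis by simp
  qed
  also have "(\<Sum>i=1..m. sgn (int s - int i) * w (i, t)) = edge_col m w (s - 1) t + w (s, t)"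
  proof -
    have "edge_col m w (s - 1) t = (\<Sum>i=1..m. sgn (int s - int i) * w (i, t) - (if i = s then w (i, t) else 0))"
      unfolding edge_col_def using assms(1) by (intro sum.cong refl) (auto simp: sgn_if)
    also have "\<dots> = (\<Sum>i=1..m. sgn (int s - int i) * w (i, t)) - w (s, t)"
      using assms(1) by (simp add: sum_subtractf)
    finally show ?thesis by simp
  qed
  finally show ?thesis by simp
qed

definition zero_ext :: "'a set \<Rightarrow> ('a \<Rightarrow> int) \<Rightarrow> 'a \<Rightarrow> int" where
  "zero_ext Y v x = (if x \<in> Y then v x else 0)"

lemma sum_comm_exp_diagram:
  assumes "(s, t) \<in> diagram m n white"
  shows "(\<Sum>x\<in>diagram m n white. comm_exp x (s, t) * v x) =
    edge_row n (zero_ext (diagram m n white) v) s t + edge_col m (zero_ext (diagram m n white) v) (s - 1) t"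
proof -
  have "(\<Sum>x\<in>diagram m n white. comm_exp x (s, t) * v x) =
    (\<Sum>x\<in>{1..m} \<times> {1..n}. comm_exp x (s, t) * zero_ext (diagram m n white) v x)"
    by (rule sum.mono_neutral_cong_left) (auto simp: diagram_def zero_ext_def)
  then show ?thesis using sum_grid_comm_exp[of s m t n] assms by (simp add: diagram_def)
qed

text \<open>Equal to the value on the entering edge at labels of rows and opposite to it at labels of columns.
The value on the leaving edge with the same label is the negative of the one on the entering edge;
hence the values at the two ends of a pipe add up to zero for kernel vectors.\<close>

definition boundary_value :: "nat \<Rightarrow> nat \<Rightarrow> (nat \<times> nat \<Rightarrow> int) \<Rightarrow> nat \<Rightarrow> int" where
  "boundary_value m n w k =
    (if k \<le> m then (\<Sum>t=1..n. w (m + 1 - k, t)) else - (\<Sum>s=1..m. w (s, k - m)))"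

text \<open>For a white box the equation of the kernel passes the value from the right to the upper edge with
the opposite sign; the values on the left and the lower edge differ from these by twice the entry
of the box and so are opposite as well. At a black box the entry is zero and the value passes
straight through.\<close>

lemma pipe_constant:
  shows "(\<And>s t. (s, t) \<in> diagram m n white \<Longrightarrow> l dvd edge_row n w s t + edge_col m w (s - 1) t) \<Longrightarrow>
      (\<And>s t. (s, t) \<notin> diagram m n white \<Longrightarrow> w (s, t) = 0) \<Longrightarrow> 1 \<le> i \<Longrightarrow> i \<le> m \<Longrightarrow> j \<le> n \<Longrightarrow>
      [edge_row n w i j = - boundary_value m n w (pipe_right m white i j)] (mod l)"
    and "(\<And>s t. (s, t) \<in> diagram m n white \<Longrightarrow> l dvd edge_row n w s t + edge_col m w (s - 1) t) \<Longrightarrow>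
      (\<And>s t. (s, t) \<notin> diagram m n white \<Longrightarrow> w (s, t) = 0) \<Longrightarrow> 1 \<le> j \<Longrightarrow> i \<le> m \<Longrightarrow> j \<le> n \<Longrightarrow>
      [edge_col m w i j = boundary_value m n w (pipe_below m white i j)] (mod l)"
proof (induction m white i j and m white i j rule: pipe_right_pipe_below.induct)
  case (1 m white i)
  then have "m + 1 - (m + 1 - i) = i" "m + 1 - i \<le> m" by simp_all
  then show ?case by (simp add: edge_row_0 boundary_value_def)
next
  case (2 m white j)
  then show ?case by simp
next
  case (3 m white i j)
  have Y: "(Suc i, Suc j) \<in> diagram m n white \<longleftrightarrow> white (Suc i) (Suc j)"
    using 3 by (simp add: diagram_def)
  show ?case
  proof (cases "white (Suc i) (Suc j)")
    case True
    have "[edge_row n w (Suc i) (Suc j) + edge_col m w i (Suc j) = 0] (mod l)"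
      using 3(3)[of "Suc i" "Suc j"] Y True by (simp add: cong_0_iff)
    moreover have "[edge_col m w i (Suc j) = boundary_value m n w (pipe_below m white i (Suc j))] (mod l)"
      using 3(1)[OF True 3(3,4)] 3(6,7) by simp
    ultimately have "[edge_row n w (Suc i) (Suc j) + edge_col m w i (Suc j) - edge_col m w i (Suc j)
      = 0 - boundary_value m n w (pipe_below m white i (Suc j))] (mod l)" by (rule cong_diff)
    then show ?thesis using True by simp
  next
    case False
    have "w (Suc i, Suc j) = 0" using 3(4) Y False by simp
    then show ?thesis using 3(2)[OF False 3(3,4)] 3(5-7) False by (simp add: edge_row_Suc)
  qed
next
  case (4 m white j)
  then show ?case by (simp add: edge_col_0 boundary_value_def)
next
  case (5 m white i j)
  have Y: "(Suc i, j) \<in> diagram m n white \<longleftrightarrow> white (Suc i) j"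
    using 5 by (simp add: diagram_def)
  show ?case
  proof (cases "white (Suc i) j")
    case True
    have "edge_row n w (Suc i) j = edge_row n w (Suc i) (j - 1) + 2 * w (Suc i, j)"
      using edge_row_Suc[of "j - 1" n w "Suc i"] 5 by simp
    moreover have "edge_col m w (Suc i) j = edge_col m w i j + 2 * w (Suc i, j)"
      using edge_col_Suc 5 by simp
    ultimately have "edge_col m w (Suc i) j + edge_row n w (Suc i) (j - 1) =
      edge_row n w (Suc i) j + edge_col m w i j" by simp
    then have "[edge_col m w (Suc i) j + edge_row n w (Suc i) (j - 1) = 0] (mod l)"
      using 5(3)[of "Suc i" j] Y True by (simp add: cong_0_iff)
    moreover have "[edge_row n w (Suc i) (j - 1) = - boundary_value m n w (pipe_right m white (Suc i) (j - 1))] (mod l)"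
      using 5(1)[OF True 5(3,4)] 5(6,7) by simp
    ultimately have "[edge_col m w (Suc i) j + edge_row n w (Suc i) (j - 1) - edge_row n w (Suc i) (j - 1)
      = 0 - (- boundary_value m n w (pipe_right m white (Suc i) (j - 1)))] (mod l)" by (rule cong_diff)
    then show ?thesis using True by simp
  next
    case False
    have "w (Suc i, j) = 0" using 5(4) Y False by simp
    then show ?thesis using 5(2)[OF False 5(3,4)] 5(5-7) False by (simp add: edge_col_Suc)
  qed
qed

lemma pipe_range:
  shows "1 \<le> i \<Longrightarrow> i \<le> m \<Longrightarrow> j \<le> n \<Longrightarrow> pipe_right m white i j \<in> {1..m + n}"
    and "1 \<le> j \<Longrightarrow> i \<le> m \<Longrightarrow> j \<le> n \<Longrightarrow> pipe_below m white i j \<in> {1..m + n}"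
  by (induction m white i j and m white i j rule: pipe_right_pipe_below.induct) auto

lemma toric_row: "1 \<le> i \<Longrightarrow> i \<le> m \<Longrightarrow> toric_permutation m n white (m + 1 - i) = pipe_right m white i n"
  and toric_col: "1 \<le> j \<Longrightarrow> j \<le> n \<Longrightarrow> toric_permutation m n white (m + j) = pipe_below m white m j"
proof -
  assume i: "1 \<le> i" "i \<le> m"
  then have "1 \<le> m + 1 - i" "m + 1 - i \<le> m" "m + 1 - (m + 1 - i) = i" by linarith+
  then show "toric_permutation m n white (m + 1 - i) = pipe_right m white i n"
    unfolding toric_permutation_def by (simp only: simp_thms if_True)
qed (simp add: toric_permutation_def)

lemma boundary_label_cases:
  fixes k m n :: nat
  assumes "k \<in> {1..m + n}"
  obtains i where "1 \<le> i" "i \<le> m" "k = m + 1 - i" | j where "1 \<le> j" "j \<le> n" "k = m + j"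
proof (cases "k \<le> m")
  case True
  then have "1 \<le> m + 1 - k \<and> m + 1 - k \<le> m \<and> k = m + 1 - (m + 1 - k)"
    using assms unfolding atLeastAtMost_iff by arith
  then show ?thesis by (elim conjE) (rule that(1))
next
  case False
  then have "1 \<le> k - m \<and> k - m \<le> n \<and> k = m + (k - m)"
    using assms unfolding atLeastAtMost_iff by arith
  then show ?thesis by (elim conjE) (rule that(2))
qed

lemma boundary_value_row: "1 \<le> i \<Longrightarrow> i \<le> m \<Longrightarrow> boundary_value m n w (m + 1 - i) = (\<Sum>t=1..n. w (i, t))"
  and boundary_value_col: "1 \<le> j \<Longrightarrow> boundary_value m n w (m + j) = - (\<Sum>s=1..m. w (s, j))"
  by (simp_all add: boundary_value_def)

lemma cong_telescope:
  fixes w f :: "nat \<Rightarrow> int"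
  assumes "\<And>t. t \<in> {1..n} \<Longrightarrow> [2 * w t = f t - f (t - 1)] (mod l)" "j \<le> n"
  shows "[2 * (\<Sum>t=1..j. w t) = f j - f 0] (mod l)"
  using assms(2)
proof (induction j)
  case (Suc j)
  have "[2 * (\<Sum>t=1..j. w t) + 2 * w (Suc j) = (f j - f 0) + (f (Suc j) - f (Suc j - 1))] (mod l)"
    using Suc assms(1)[of "Suc j"] by (intro cong_add) simp_all
  then show ?case by (simp add: algebra_simps)
qed simp

lemma edge_row_partial: "j \<le> n \<Longrightarrow> edge_row n w i j = 2 * (\<Sum>t=1..j. w (i, t)) - (\<Sum>t=1..n. w (i, t))"
  by (induction j) (simp_all add: edge_row_0 edge_row_Suc)

lemma edge_col_partial: "i \<le> m \<Longrightarrow> edge_col m w i j = 2 * (\<Sum>s=1..i. w (s, j)) - (\<Sum>s=1..m. w (s, j))"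
  by (induction i) (simp_all add: edge_col_0 edge_col_Suc)

lemma odd_cong_halve:
  fixes l :: int
  assumes "odd l" "[2 * a = 2 * b] (mod l)"
  shows "[a = b] (mod l)"
  using assms by (simp add: cong_mult_lcancel coprime_commute)

lemma cong_minus_swap:
  fixes a b l :: int
  assumes "[a = - b] (mod l)"
  shows "[- a = b] (mod l)"
  using assms cong_minus_minus_iff[of a "- b" l] by simp

text \<open>A kernel vector is sent to its boundary values, which alternate along the toric permutation because
edge values are constant along pipes. Conversely, an alternating function determines all edge
values by following pipes, and the entry at a box is half the difference of its right and left edge
values; halving is possible modulo an odd number.\<close>

theorem card_mod_kernel:
  fixes l :: int
  assumes l: "odd l" "l > 0"
  shows "card (mod_kernel l (diagram m n white)) =
    card (alternating_functions l (toric_permutation m n white) {1..m + n})"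
proof -
  let ?Y = "diagram m n white" and ?t = "toric_permutation m n white" and ?L = "{1..m + n}"
  let ?bv = "\<lambda>v. boundary_value m n (zero_ext ?Y v)"
  let ?pr = "pipe_right m white" and ?pb = "pipe_below m white"
  \<comment> \<open>the inverse of 2 modulo the odd number \<open>l\<close>\<close>
  define c where "c = (l + 1) div 2"
  have c2: "2 * c = l + 1" unfolding c_def using l(1) by presburger
  have c_cancel: "[c * (2 * a) = a] (mod l)" for a
  proof -
    have "c * (2 * a) = (2 * c) * a" by simp
    also have "\<dots> = a + a * l" unfolding c2 by (simp add: algebra_simps)
    finally have "c * (2 * a) = a + a * l" .
    then show ?thesis by (simp add: cong_def)
  qed
  \<comment> \<open>boundary values of a vector, and the vector with prescribed values on pipes\<close>
  define fwd where "fwd v = (\<lambda>k\<in>?L. ?bv v k mod l)" for v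
  define bwd where "bwd f = (\<lambda>x\<in>?Y. (c * (f (?pr (fst x) (snd x - 1)) - f (?pr (fst x) (snd x)))) mod l)" for f
  have tL: "?t k \<in> ?L" if "k \<in> ?L" for k
    using permutes_in_image[OF toric_permutation_permutes] that by blast
  have fwd_cong: "[fwd v k = ?bv v k] (mod l)" if "k \<in> ?L" for v k
    using that by (simp add: fwd_def cong_def)
  have K: "l dvd edge_row n (zero_ext ?Y v) s t + edge_col m (zero_ext ?Y v) (s - 1) t"
    if "v \<in> mod_kernel l ?Y" "(s, t) \<in> ?Y" for v s t
  proof -
    have "\<forall>y\<in>?Y. l dvd (\<Sum>x\<in>?Y. comm_exp x y * v x)" using that(1) by (simp add: mod_kernel_def)
    from bspec[OF this that(2)] show ?thesis unfolding sum_comm_exp_diagram[OF that(2)] .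
  qed
  have Z: "zero_ext ?Y v (s, t) = 0" if "(s, t) \<notin> ?Y" for v s t
    using that by (simp add: zero_ext_def)
  have CR: "[edge_row n (zero_ext ?Y v) i j = - ?bv v (?pr i j)] (mod l)"
    if "v \<in> mod_kernel l ?Y" "1 \<le> i" "i \<le> m" "j \<le> n" for v i j
    by (rule pipe_constant(1)[OF K[OF that(1)] Z that(2-4)])
  have CB: "[edge_col m (zero_ext ?Y v) i j = ?bv v (?pb i j)] (mod l)"
    if "v \<in> mod_kernel l ?Y" "1 \<le> j" "i \<le> m" "j \<le> n" for v i j
    by (rule pipe_constant(2)[OF K[OF that(1)] Z that(2-4)])
  have "bij_betw fwd (mod_kernel l ?Y) (alternating_functions l ?t ?L)"
  proof (rule bij_betw_byWitness[where f' = bwd])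
    show "\<forall>v\<in>mod_kernel l ?Y. bwd (fwd v) = v"
    proof (intro ballI ext)
      fix v and x :: "nat \<times> nat" assume v: "v \<in> mod_kernel l ?Y"
      obtain i j where x: "x = (i, j)" by (cases x)
      show "bwd (fwd v) x = v x"
      proof (cases "(i, j) \<in> ?Y")
        case False
        then show ?thesis using v x unfolding bwd_def mod_kernel_def PiE_def extensional_def by simp
      next
        case True
        then have ij: "1 \<le> i" "i \<le> m" "1 \<le> j" "j \<le> n" by (simp_all add: diagram_def)
        have jm: "j - 1 \<le> n" using ij by simp
        let ?w = "zero_ext ?Y v"
        have A: "[fwd v (?pr i (j - 1)) = ?bv v (?pr i (j - 1))] (mod l)"
          by (rule fwd_cong, rule pipe_range(1)[OF ij(1,2) jm])
        have B: "[fwd v (?pr i j) = ?bv v (?pr i j)] (mod l)"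
          by (rule fwd_cong, rule pipe_range(1)[OF ij(1,2,4)])
        have "[- edge_row n ?w i (j - 1) = ?bv v (?pr i (j - 1))] (mod l)"
          by (rule cong_minus_swap[OF CR[OF v ij(1,2) jm]])
        moreover have "[- edge_row n ?w i j = ?bv v (?pr i j)] (mod l)"
          by (rule cong_minus_swap[OF CR[OF v ij(1,2,4)]])
        ultimately have "[- edge_row n ?w i (j - 1) - (- edge_row n ?w i j) =
            ?bv v (?pr i (j - 1)) - ?bv v (?pr i j)] (mod l)" by (rule cong_diff)
        moreover have "- edge_row n ?w i (j - 1) - (- edge_row n ?w i j) = 2 * v (i, j)"
          using edge_row_Suc[of "j - 1" n ?w i] ij True by (simp add: zero_ext_def)
        ultimately have "[2 * v (i, j) = ?bv v (?pr i (j - 1)) - ?bv v (?pr i j)] (mod l)" by simp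
        then have "[fwd v (?pr i (j - 1)) - fwd v (?pr i j) = 2 * v (i, j)] (mod l)"
          using cong_diff[OF A B] cong_trans cong_sym by blast
        then have "[c * (fwd v (?pr i (j - 1)) - fwd v (?pr i j)) = c * (2 * v (i, j))] (mod l)"
          by (rule cong_scalar_left)
        then have "[c * (fwd v (?pr i (j - 1)) - fwd v (?pr i j)) = v (i, j)] (mod l)"
          using c_cancel cong_trans by blast
        moreover have "v (i, j) \<in> {0..<l}" using v True by (auto simp: mod_kernel_def PiE_def Pi_def)
        ultimately show ?thesis using x True by (simp add: bwd_def cong_def)
      qed
    qed
    show "fwd ` mod_kernel l ?Y \<subseteq> alternating_functions l ?t ?L"
    proof (intro image_subsetI)
      fix v assume v: "v \<in> mod_kernel l ?Y"
      have "[?bv v (?t k) = - ?bv v k] (mod l)" if k: "k \<in> ?L" for k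
        using k
      proof (cases rule: boundary_label_cases)
        case (1 i)
        have "[edge_row n (zero_ext ?Y v) i n = - ?bv v (?t k)] (mod l)"
          using CR[OF v 1(1,2) le_refl] unfolding 1(3) toric_row[OF 1(1,2)] .
        from cong_sym[OF cong_minus_swap[OF this]] show ?thesis
          unfolding 1(3) boundary_value_row[OF 1(1,2)] edge_row_full .
      next
        case (2 j)
        have "[edge_col m (zero_ext ?Y v) m j = ?bv v (?t k)] (mod l)"
          using CB[OF v 2(1) le_refl 2(2)] unfolding 2(3) toric_col[OF 2(1,2)] .
        from cong_sym[OF this] show ?thesis
          unfolding 2(3) boundary_value_col[OF 2(1)] edge_col_full minus_minus .
      qed
      then have "l dvd fwd v (?t k) + fwd v k" if k: "k \<in> ?L" for k
      proof -
        have "[fwd v (?t k) + fwd v k = - ?bv v k + ?bv v k] (mod l)"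
          by (rule cong_add[OF cong_trans[OF fwd_cong[OF tL[OF k]]] fwd_cong[OF k]])
            (rule \<open>\<And>k. k \<in> ?L \<Longrightarrow> [?bv v (?t k) = - ?bv v k] (mod l)\<close>[OF k])
        then show ?thesis by (simp add: cong_0_iff)
      qed
      moreover have "fwd v \<in> ?L \<rightarrow>\<^sub>E {0..<l}" using l by (auto simp: fwd_def)
      ultimately show "fwd v \<in> alternating_functions l ?t ?L" unfolding alternating_functions_def by simp
    qed
    have main: "bwd f \<in> mod_kernel l ?Y \<and> fwd (bwd f) = f" if f: "f \<in> alternating_functions l ?t ?L" for f
    proof -
      define w where "w = zero_ext ?Y (bwd f)"
      have ft: "[f (?t k) = - f k] (mod l)" if "k \<in> ?L" for k
        using f that by (simp add: alternating_functions_def cong_iff_dvd_diff)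
      have dr: "[2 * w (i, j) = f (?pr i (j - 1)) - f (?pr i j)] (mod l)"
        if "i \<in> {1..m}" "j \<in> {1..n}" for i j
      proof (cases "(i, j) \<in> ?Y")
        case True
        have "[2 * w (i, j) = 2 * (c * (f (?pr i (j - 1)) - f (?pr i j)))] (mod l)"
          using True by (intro cong_scalar_left) (simp add: w_def zero_ext_def bwd_def cong_def)
        also have "2 * (c * (f (?pr i (j - 1)) - f (?pr i j))) = c * (2 * (f (?pr i (j - 1)) - f (?pr i j)))"
          by simp
        finally show ?thesis using c_cancel cong_trans by blast
      next
        case False
        then have "\<not> white i j" using that by (simp add: diagram_def)
        then have "?pr i j = ?pr i (j - 1)" using that by (cases i; cases j) auto
        then show ?thesis using False by (simp add: w_def zero_ext_def)
      qed
      have dc: "[2 * w (i, j) = f (?pb i j) - f (?pb (i - 1) j)] (mod l)"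
        if ij: "i \<in> {1..m}" "j \<in> {1..n}" for i j
      proof (cases "white i j")
        case True
        then have "?pr i j = ?pb (i - 1) j" "?pb i j = ?pr i (j - 1)"
          using ij by (cases i; cases j; simp)+
        then show ?thesis using dr[OF ij] by simp
      next
        case False
        then have "?pb i j = ?pb (i - 1) j" using ij by (cases i; cases j) auto
        moreover have "(i, j) \<notin> ?Y" using False by (simp add: diagram_def)
        ultimately show ?thesis by (simp add: w_def zero_ext_def)
      qed
      have tr: "[2 * (\<Sum>t=1..j. w (i, t)) = f (m + 1 - i) - f (?pr i j)] (mod l)"
        if "i \<in> {1..m}" "j \<le> n" for i j
      proof -
        have "[2 * (\<Sum>t=1..j. w (i, t)) = - f (?pr i j) - (- f (?pr i 0))] (mod l)"
          by (rule cong_telescope[where f = "\<lambda>j. - f (?pr i j)", OF _ that(2)]) (use dr[OF that(1)] in simp)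
        then show ?thesis by simp
      qed
      have tc: "[2 * (\<Sum>s=1..i. w (s, j)) = f (?pb i j) - f (m + j)] (mod l)"
        if "j \<in> {1..n}" "i \<le> m" for i j
      proof -
        have "[2 * (\<Sum>s=1..i. w (s, j)) = f (?pb i j) - f (?pb 0 j)] (mod l)"
          by (rule cong_telescope[where f = "\<lambda>i. f (?pb i j)", OF _ that(2)]) (use dc that(1) in simp)
        then show ?thesis by simp
      qed
      have rs: "[(\<Sum>t=1..n. w (i, t)) = f (m + 1 - i)] (mod l)" if i: "i \<in> {1..m}" for i
      proof (rule odd_cong_halve[OF l(1)])
        have k: "m + 1 - i \<in> ?L" using i by auto
        have "[f (?pr i n) = - f (m + 1 - i)] (mod l)"
          using ft[OF k] toric_row[of i m n white] i by simp
        then have "[f (m + 1 - i) - f (?pr i n) = f (m + 1 - i) - (- f (m + 1 - i))] (mod l)"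
          by (rule cong_diff[OF cong_refl])
        from cong_trans[OF tr[OF i le_refl] this]
        show "[2 * (\<Sum>t=1..n. w (i, t)) = 2 * f (m + 1 - i)] (mod l)" by simp
      qed
      have cs: "[(\<Sum>s=1..m. w (s, j)) = - f (m + j)] (mod l)" if j: "j \<in> {1..n}" for j
      proof (rule odd_cong_halve[OF l(1)])
        have k: "m + j \<in> ?L" using j by auto
        have "[f (?pb m j) = - f (m + j)] (mod l)"
          using ft[OF k] toric_col[of j n m white] j by simp
        then have "[f (?pb m j) - f (m + j) = - f (m + j) - f (m + j)] (mod l)"
          by (rule cong_diff[OF _ cong_refl])
        from cong_trans[OF tc[OF j le_refl] this]
        show "[2 * (\<Sum>s=1..m. w (s, j)) = 2 * (- f (m + j))] (mod l)" by simp
      qed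
      have er: "[edge_row n w i j = - f (?pr i j)] (mod l)" if "i \<in> {1..m}" "j \<le> n" for i j
        using cong_diff[OF tr[OF that] rs[OF that(1)]] by (simp add: edge_row_partial[OF that(2)])
      have ec: "[edge_col m w i j = f (?pb i j)] (mod l)" if "j \<in> {1..n}" "i \<le> m" for i j
        using cong_diff[OF tc[OF that] cs[OF that(1)]] by (simp add: edge_col_partial[OF that(2)])
      have "l dvd (\<Sum>x\<in>?Y. comm_exp x y * bwd f x)" if y: "y \<in> ?Y" for y
      proof -
        obtain i j where y': "y = (i, j)" by (cases y)
        have ij: "i \<in> {1..m}" "j \<in> {1..n}" "white i j" using y y' by (simp_all add: diagram_def)
        have "?pr i j = ?pb (i - 1) j" using ij by (cases i; cases j; simp)
        moreover have "[edge_row n w i j + edge_col m w (i - 1) j = - f (?pr i j) + f (?pb (i - 1) j)] (mod l)"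
          using ij by (intro cong_add er ec) auto
        ultimately have "l dvd edge_row n w i j + edge_col m w (i - 1) j" by (simp add: cong_0_iff)
        then show ?thesis using sum_comm_exp_diagram y y' by (simp add: w_def)
      qed
      moreover have "bwd f \<in> ?Y \<rightarrow>\<^sub>E {0..<l}" using l by (auto simp: bwd_def)
      ultimately have k: "bwd f \<in> mod_kernel l ?Y" unfolding mod_kernel_def by simp
      have "fwd (bwd f) k = f k" for k
      proof (cases "k \<in> ?L")
        case True
        have "[?bv (bwd f) k = f k] (mod l)"
          using True
        proof (cases rule: boundary_label_cases)
          case (1 i)
          then show ?thesis
            unfolding 1(3) boundary_value_row[OF 1(1,2)] using rs[of i] by (simp add: w_def)
        next
          case (2 j)
          then show ?thesis
            unfolding 2(3) boundary_value_col[OF 2(1)] using cong_minus_swap[OF cs[of j]]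
            by (simp add: w_def)
        qed
        moreover have "f k \<in> {0..<l}" using f True by (auto simp: alternating_functions_def PiE_def Pi_def)
        ultimately show ?thesis using True by (simp add: fwd_def cong_def)
      next
        case False
        have "f \<in> extensional ?L" using f by (simp add: alternating_functions_def PiE_def)
        from extensional_arb[OF this False] show ?thesis
          by (simp only: fwd_def restrict_def False if_False)
      qed
      with k show ?thesis by auto
    qed
    then show "\<forall>f\<in>alternating_functions l ?t ?L. fwd (bwd f) = f" by simp
    show "bwd ` alternating_functions l ?t ?L \<subseteq> mod_kernel l ?Y" using main by (intro image_subsetI) simp
  qed
  then show ?thesis by (rule bij_betw_same_card)
qed

section \<open>Rings of fractions and the PI degree\<close>

lemma UN_const_eq: "a \<in> A \<Longrightarrow> (\<And>y. y \<in> A \<Longrightarrow> f y = c) \<Longrightarrow> (\<Union>y\<in>A. f y) = c"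
  by auto

lemma set_map_subsetI: "(\<And>x. x \<in> set xs \<Longrightarrow> f x \<in> A) \<Longrightarrow> set (map f xs) \<subseteq> A"
  by auto

text \<open>A ring that an injective homomorphism identifies with a subring of a ring of type class
\<open>ring_1\<close> in which the products of nonzero image elements are nonzero. Computations take place in the
target, where the laws of rings need no side conditions about carriers.\<close>

locale embedded_domain = ring R for R :: "('r, 'm) ring_scheme" (structure) +
  fixes \<phi> :: "'r \<Rightarrow> 'a::ring_1"
  assumes phi_mult: "x \<in> carrier R \<Longrightarrow> y \<in> carrier R \<Longrightarrow> \<phi> (x \<otimes> y) = \<phi> x * \<phi> y"
    and phi_add: "x \<in> carrier R \<Longrightarrow> y \<in> carrier R \<Longrightarrow> \<phi> (x \<oplus> y) = \<phi> x + \<phi> y"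
    and phi_one: "\<phi> \<one> = 1"
    and phi_inj: "x \<in> carrier R \<Longrightarrow> y \<in> carrier R \<Longrightarrow> \<phi> x = \<phi> y \<Longrightarrow> x = y"
    and phi_domain: "x \<in> carrier R \<Longrightarrow> y \<in> carrier R \<Longrightarrow> \<phi> x * \<phi> y = 0 \<Longrightarrow> \<phi> x = 0 \<or> \<phi> y = 0"
begin

lemma phi_zero: "\<phi> \<zero> = 0"
  using phi_add[of \<zero> \<zero>] by simp

lemma phi_neg: "x \<in> carrier R \<Longrightarrow> \<phi> (\<ominus> x) = - \<phi> x"
  using phi_add[of x "\<ominus> x"] by (simp add: r_neg phi_zero add_eq_0_iff)

lemma phi_minus: "x \<in> carrier R \<Longrightarrow> y \<in> carrier R \<Longrightarrow> \<phi> (x \<ominus> y) = \<phi> x - \<phi> y"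
  by (simp add: a_minus_def phi_add phi_neg)

lemma phi_eq_0_iff: "x \<in> carrier R \<Longrightarrow> \<phi> x = 0 \<longleftrightarrow> x = \<zero>"
  using phi_inj[of x \<zero>] phi_zero by auto

lemma one_neq_zero: "\<one> \<noteq> \<zero>"
  using phi_one phi_zero by force

lemma prime: "prime_ring R"
proof -
  have "a = \<zero> \<or> b = \<zero>"
    if "a \<in> carrier R" "b \<in> carrier R" "\<forall>x\<in>carrier R. a \<otimes> x \<otimes> b = \<zero>" for a b
  proof -
    have "a \<otimes> b = \<zero>" using bspec[OF that(3) one_closed] that by simp
    then have "\<phi> a * \<phi> b = 0" using phi_mult[OF that(1,2)] phi_zero by simp
    then show ?thesis using phi_domain[OF that(1,2)] phi_eq_0_iff that by simp
  qed
  then show ?thesis unfolding prime_ring_def using ring_axioms one_neq_zero by simp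
qed

abbreviation "Z \<equiv> ring_center R"
definition S :: "'r set" where "S = ring_center R - {\<zero>}"
abbreviation "Q \<equiv> central_localization R"

lemma ZD: "z \<in> Z \<Longrightarrow> z \<in> carrier R"
  by (simp add: ring_center_def)

lemma Z_comm: "z \<in> Z \<Longrightarrow> x \<in> carrier R \<Longrightarrow> \<phi> x * \<phi> z = \<phi> z * \<phi> x"
  by (simp add: ring_center_def phi_mult[symmetric])

lemma Z_comm2: "z \<in> Z \<Longrightarrow> x \<in> carrier R \<Longrightarrow> \<phi> x * (\<phi> z * w) = \<phi> z * (\<phi> x * w)"
  using arg_cong[OF Z_comm, of z x "\<lambda>y. y * w"] by (simp only: mult.assoc)

lemma ZI:
  assumes "z \<in> carrier R" "\<And>x. x \<in> carrier R \<Longrightarrow> \<phi> z * \<phi> x = \<phi> x * \<phi> z"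
  shows "z \<in> Z"
  unfolding ring_center_def using assms phi_inj by (simp add: phi_mult)

lemma Z_comm_R: "z \<in> Z \<Longrightarrow> x \<in> carrier R \<Longrightarrow> z \<otimes> x = x \<otimes> z"
  by (simp add: ring_center_def)

lemma Z_mult: assumes "z \<in> Z" "w \<in> Z" shows "z \<otimes> w \<in> Z"
proof (rule ZI)
  show "\<phi> (z \<otimes> w) * \<phi> x = \<phi> x * \<phi> (z \<otimes> w)" if x: "x \<in> carrier R" for x
    by (simp only: phi_mult[OF ZD[OF assms(1)] ZD[OF assms(2)]] mult.assoc
        Z_comm2[OF assms(1) x] Z_comm[OF assms(2) x])
qed (simp add: ZD assms)

lemma Z_add: assumes "z \<in> Z" "w \<in> Z" shows "z \<oplus> w \<in> Z"
proof (rule ZI)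
  show "\<phi> (z \<oplus> w) * \<phi> x = \<phi> x * \<phi> (z \<oplus> w)" if x: "x \<in> carrier R" for x
    by (simp only: phi_add[OF ZD[OF assms(1)] ZD[OF assms(2)]] distrib_left distrib_right
        Z_comm[OF assms(1) x] Z_comm[OF assms(2) x])
qed (simp add: ZD assms)

lemma Z_neg: assumes "z \<in> Z" shows "\<ominus> z \<in> Z"
proof (rule ZI)
  show "\<phi> (\<ominus> z) * \<phi> x = \<phi> x * \<phi> (\<ominus> z)" if x: "x \<in> carrier R" for x
    by (simp add: phi_neg[OF ZD[OF assms]] Z_comm[OF assms x])
qed (simp add: ZD assms)

lemma Z_one: "\<one> \<in> Z" by (rule ZI) (simp_all add: phi_one)
lemma Z_zero: "\<zero> \<in> Z" by (rule ZI) (simp_all add: phi_zero)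

lemma SD: "s \<in> S \<Longrightarrow> s \<in> carrier R" "s \<in> S \<Longrightarrow> \<phi> s \<noteq> 0" "s \<in> S \<Longrightarrow> s \<in> Z"
  using ZD phi_eq_0_iff unfolding S_def by auto

lemma SI: "s \<in> Z \<Longrightarrow> \<phi> s \<noteq> 0 \<Longrightarrow> s \<in> S"
  using phi_zero unfolding S_def by auto

lemma S_one: "\<one> \<in> S" by (rule SI) (simp_all add: Z_one phi_one)

lemma S_mult: "s \<in> S \<Longrightarrow> t \<in> S \<Longrightarrow> s \<otimes> t \<in> S"
proof (rule SI)
  assume st: "s \<in> S" "t \<in> S"
  show "s \<otimes> t \<in> Z" using Z_mult SD st by simp
  show "\<phi> (s \<otimes> t) \<noteq> 0"
    using phi_domain[OF SD(1)[OF st(1)] SD(1)[OF st(2)]] SD(2)[OF st(1)] SD(2)[OF st(2)]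
    by (auto simp: phi_mult[OF SD(1)[OF st(1)] SD(1)[OF st(2)]])
qed

lemma S_cancel:
  assumes "s \<in> S" "x \<in> carrier R" "y \<in> carrier R" "\<phi> s * \<phi> x = \<phi> s * \<phi> y"
  shows "\<phi> x = \<phi> y"
proof -
  note c = SD(1)[OF assms(1)]
  have "\<phi> s * \<phi> (x \<ominus> y) = 0" using assms by (simp add: phi_minus right_diff_distrib)
  then have "\<phi> (x \<ominus> y) = 0" using phi_domain[of s "x \<ominus> y"] SD[OF assms(1)] assms by simp
  then show ?thesis using assms by (simp add: phi_minus)
qed

text \<open>In a domain the multiplier in the definition of equality of fractions can be cancelled, which leaves
the equation of cross products.\<close>

lemma frac_rel_iff:
  "((a, s), (b, t)) \<in> frac_rel R S \<longleftrightarrow> a \<in> carrier R \<and> s \<in> S \<and> b \<in> carrier R \<and> t \<in> S \<and>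
    \<phi> t * \<phi> a = \<phi> s * \<phi> b"
proof -
  have "(\<exists>u\<in>S. u \<otimes> (t \<otimes> a \<ominus> s \<otimes> b) = \<zero>) \<longleftrightarrow> \<phi> t * \<phi> a = \<phi> s * \<phi> b"
    if H: "a \<in> carrier R" "s \<in> S" "b \<in> carrier R" "t \<in> S"
  proof -
    have c: "s \<in> carrier R" "t \<in> carrier R" using SD H by simp_all
    have e: "\<phi> (t \<otimes> a \<ominus> s \<otimes> b) = \<phi> t * \<phi> a - \<phi> s * \<phi> b" using H c by (simp add: phi_minus phi_mult)
    show ?thesis
    proof
      assume "\<exists>u\<in>S. u \<otimes> (t \<otimes> a \<ominus> s \<otimes> b) = \<zero>"
      then obtain u where u: "u \<in> S" "u \<otimes> (t \<otimes> a \<ominus> s \<otimes> b) = \<zero>" by blast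
      have "\<phi> u * \<phi> (t \<otimes> a \<ominus> s \<otimes> b) = \<phi> (u \<otimes> (t \<otimes> a \<ominus> s \<otimes> b))"
        using H c SD(1)[OF u(1)] by (simp add: phi_mult)
      then have "\<phi> u * \<phi> (t \<otimes> a \<ominus> s \<otimes> b) = 0" using u(2) by (simp add: phi_zero)
      then have "\<phi> (t \<otimes> a \<ominus> s \<otimes> b) = 0"
        using phi_domain[of u "t \<otimes> a \<ominus> s \<otimes> b"] SD(1,2)[OF u(1)] H c by simp
      then show "\<phi> t * \<phi> a = \<phi> s * \<phi> b" using e by simp
    next
      assume "\<phi> t * \<phi> a = \<phi> s * \<phi> b"
      then have "t \<otimes> a \<ominus> s \<otimes> b = \<zero>" using e phi_eq_0_iff[of "t \<otimes> a \<ominus> s \<otimes> b"] H c by simp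
      then have "\<one> \<otimes> (t \<otimes> a \<ominus> s \<otimes> b) = \<zero>" by simp
      then show "\<exists>u\<in>S. u \<otimes> (t \<otimes> a \<ominus> s \<otimes> b) = \<zero>" by (rule bexI[OF _ S_one])
    qed
  qed
  then show ?thesis unfolding frac_rel_def by auto
qed

lemma frac_equiv: "equiv (carrier R \<times> S) (frac_rel R S)"
proof (rule equivI)
  show "frac_rel R S \<subseteq> (carrier R \<times> S) \<times> (carrier R \<times> S)" using frac_rel_iff by auto
  show "refl_on (carrier R \<times> S) (frac_rel R S)"
    by (rule refl_onI) (use frac_rel_iff in auto)
  show "sym (frac_rel R S)"
    by (rule symI) (use frac_rel_iff in auto)
  show "trans (frac_rel R S)"
  proof (rule transI)
    fix x y z assume xy: "(x, y) \<in> frac_rel R S" and yz: "(y, z) \<in> frac_rel R S"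
    obtain a s b t c u where e: "x = (a, s)" "y = (b, t)" "z = (c, u)" by (cases x; cases y; cases z)
    have A: "a \<in> carrier R" "s \<in> S" "b \<in> carrier R" "t \<in> S" "\<phi> t * \<phi> a = \<phi> s * \<phi> b"
      "c \<in> carrier R" "u \<in> S" "\<phi> u * \<phi> b = \<phi> t * \<phi> c"
      using xy yz unfolding e frac_rel_iff by blast+
    note c = SD(1)[OF A(2)] SD(1)[OF A(4)] SD(1)[OF A(7)]
    have "\<phi> t * \<phi> (u \<otimes> a) = \<phi> u * (\<phi> t * \<phi> a)"
      by (simp only: phi_mult[OF c(3) A(1)] Z_comm2[OF SD(3)[OF A(7)] c(2)])
    also have "\<dots> = \<phi> s * (\<phi> u * \<phi> b)"
      by (simp only: A(5) Z_comm2[OF SD(3)[OF A(2)] c(3)])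
    also have "\<dots> = \<phi> t * \<phi> (s \<otimes> c)"
      by (simp only: A(8) phi_mult[OF c(1) A(6)] Z_comm2[OF SD(3)[OF A(4)] c(1)])
    finally have "\<phi> (u \<otimes> a) = \<phi> (s \<otimes> c)"
      by (rule S_cancel[OF A(4) m_closed[OF c(3) A(1)] m_closed[OF c(1) A(6)]])
    then show "(x, z) \<in> frac_rel R S" unfolding e frac_rel_iff using A c by (simp add: phi_mult)
  qed
qed

definition fr :: "'r \<Rightarrow> 'r \<Rightarrow> ('r \<times> 'r) set" where
  "fr a s = frac_rel R S `` {(a, s)}"

lemma fr_eq_iff:
  assumes "a \<in> carrier R" "s \<in> S" "b \<in> carrier R" "t \<in> S"
  shows "fr a s = fr b t \<longleftrightarrow> \<phi> t * \<phi> a = \<phi> s * \<phi> b"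
  unfolding fr_def using eq_equiv_class_iff[OF frac_equiv, of "(a, s)" "(b, t)"] assms frac_rel_iff by simp

lemma fr_mem: "(b, t) \<in> fr a s \<longleftrightarrow> a \<in> carrier R \<and> s \<in> S \<and> b \<in> carrier R \<and> t \<in> S \<and>
    \<phi> t * \<phi> a = \<phi> s * \<phi> b"
  unfolding fr_def using frac_rel_iff by simp

lemma Q_carrier: "X \<in> carrier Q \<longleftrightarrow> (\<exists>a\<in>carrier R. \<exists>s\<in>S. X = fr a s)"
  unfolding central_localization_def fraction_ring_def fr_def quotient_def S_def by auto

lemma fr_closed: "a \<in> carrier R \<Longrightarrow> s \<in> S \<Longrightarrow> fr a s \<in> carrier Q"
  using Q_carrier by auto

lemma Q_one: "\<one>\<^bsub>Q\<^esub> = fr \<one> \<one>" and Q_zero: "\<zero>\<^bsub>Q\<^esub> = fr \<zero> \<one>"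
  by (simp_all add: central_localization_def fraction_ring_def fr_def S_def)

lemma Q_mult:
  assumes H: "a \<in> carrier R" "s \<in> S" "b \<in> carrier R" "t \<in> S"
  shows "fr a s \<otimes>\<^bsub>Q\<^esub> fr b t = fr (a \<otimes> b) (s \<otimes> t)"
proof -
  have e: "fr a s \<otimes>\<^bsub>Q\<^esub> fr b t = (\<Union>(a, s)\<in>fr a s. \<Union>(b, t)\<in>fr b t. fr (a \<otimes> b) (s \<otimes> t))"
    by (simp add: central_localization_def fraction_ring_def fr_def S_def)
  have W: "fr (a' \<otimes> b') (s' \<otimes> t') = fr (a \<otimes> b) (s \<otimes> t)"
    if "(a', s') \<in> fr a s" "(b', t') \<in> fr b t" for a' s' b' t'
  proof -
    have A: "a' \<in> carrier R" "s' \<in> S" "\<phi> s' * \<phi> a = \<phi> s * \<phi> a'"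
       "b' \<in> carrier R" "t' \<in> S" "\<phi> t' * \<phi> b = \<phi> t * \<phi> b'"
      using that unfolding fr_mem by blast+
    note c = SD(1)[OF A(2)] SD(1)[OF A(5)] SD(1)[OF H(2)] SD(1)[OF H(4)]
    have "\<phi> (s \<otimes> t) * \<phi> (a' \<otimes> b') = (\<phi> s * \<phi> a') * (\<phi> t * \<phi> b')"
      using A H c by (simp add: phi_mult mult.assoc Z_comm2[OF SD(3)[OF H(4)] A(1)])
    also have "\<dots> = (\<phi> s' * \<phi> a) * (\<phi> t' * \<phi> b)" using A by simp
    also have "\<dots> = \<phi> (s' \<otimes> t') * \<phi> (a \<otimes> b)"
      using H c by (simp add: phi_mult mult.assoc Z_comm2[OF SD(3)[OF A(5)] H(1)])
    finally show ?thesis using A H c by (subst fr_eq_iff) (auto simp: S_mult)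
  qed
  have m: "(a, s) \<in> fr a s" "(b, t) \<in> fr b t" using H by (simp_all add: fr_mem)
  show ?thesis unfolding e
  proof (rule UN_const_eq[OF m(1)], clarify)
    fix a' s' assume "(a', s') \<in> fr a s"
    note W' = W[OF this]
    show "(\<Union>(b, t)\<in>fr b t. fr (a' \<otimes> b) (s' \<otimes> t)) = fr (a \<otimes> b) (s \<otimes> t)"
      by (rule UN_const_eq[OF m(2)], clarify) (rule W')
  qed
qed

lemma Q_add:
  assumes H: "a \<in> carrier R" "s \<in> S" "b \<in> carrier R" "t \<in> S"
  shows "fr a s \<oplus>\<^bsub>Q\<^esub> fr b t = fr (t \<otimes> a \<oplus> s \<otimes> b) (s \<otimes> t)"
proof -
  have e: "fr a s \<oplus>\<^bsub>Q\<^esub> fr b t = (\<Union>(a, s)\<in>fr a s. \<Union>(b, t)\<in>fr b t. fr (t \<otimes> a \<oplus> s \<otimes> b) (s \<otimes> t))"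
    by (simp add: central_localization_def fraction_ring_def fr_def S_def)
  have W: "fr (t' \<otimes> a' \<oplus> s' \<otimes> b') (s' \<otimes> t') = fr (t \<otimes> a \<oplus> s \<otimes> b) (s \<otimes> t)"
    if "(a', s') \<in> fr a s" "(b', t') \<in> fr b t" for a' s' b' t'
  proof -
    have A: "a' \<in> carrier R" "s' \<in> S" "\<phi> s' * \<phi> a = \<phi> s * \<phi> a'"
       "b' \<in> carrier R" "t' \<in> S" "\<phi> t' * \<phi> b = \<phi> t * \<phi> b'"
      using that unfolding fr_mem by blast+
    note c = SD(1)[OF A(2)] SD(1)[OF A(5)] SD(1)[OF H(2)] SD(1)[OF H(4)]
    have z: "s \<in> Z" "t \<in> Z" "s' \<in> Z" "t' \<in> Z" using SD(3) A H by blast+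
    have "\<phi> (s \<otimes> t) * \<phi> (t' \<otimes> a' \<oplus> s' \<otimes> b') =
        \<phi> t * (\<phi> t' * (\<phi> s * \<phi> a')) + \<phi> s * (\<phi> s' * (\<phi> t * \<phi> b'))"
    proof -
      have "\<phi> s * (\<phi> t * (\<phi> t' * \<phi> a')) = \<phi> t * (\<phi> t' * (\<phi> s * \<phi> a'))"
        by (simp only: Z_comm2[OF z(1) c(4)] Z_comm2[OF z(1) c(2)])
      moreover have "\<phi> s * (\<phi> t * (\<phi> s' * \<phi> b')) = \<phi> s * (\<phi> s' * (\<phi> t * \<phi> b'))"
        by (simp only: Z_comm2[OF z(2) c(1)])
      ultimately show ?thesis using A H c by (simp only: phi_mult phi_add distrib_left mult.assoc m_closed a_closed)
    qed
    also have "\<dots> = \<phi> t * (\<phi> t' * (\<phi> s' * \<phi> a)) + \<phi> s * (\<phi> s' * (\<phi> t' * \<phi> b))" using A by simp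
    also have "\<dots> = \<phi> (s' \<otimes> t') * \<phi> (t \<otimes> a \<oplus> s \<otimes> b)"
    proof -
      have "\<phi> t * (\<phi> t' * (\<phi> s' * \<phi> a)) = \<phi> s' * (\<phi> t' * (\<phi> t * \<phi> a))"
        by (simp only: Z_comm2[OF z(3) c(2)] Z_comm2[OF z(3) c(4)] Z_comm2[OF z(4) c(4)])
      moreover have "\<phi> s * (\<phi> s' * (\<phi> t' * \<phi> b)) = \<phi> s' * (\<phi> t' * (\<phi> s * \<phi> b))"
        by (simp only: Z_comm2[OF z(3) c(3)] Z_comm2[OF z(4) c(3)])
      ultimately show ?thesis using A H c by (simp only: phi_mult phi_add distrib_left mult.assoc m_closed a_closed)
    qed
    finally show ?thesis using A H c by (subst fr_eq_iff) (auto simp: S_mult)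
  qed
  have m: "(a, s) \<in> fr a s" "(b, t) \<in> fr b t" using H by (simp_all add: fr_mem)
  show ?thesis unfolding e
  proof (rule UN_const_eq[OF m(1)], clarify)
    fix a' s' assume "(a', s') \<in> fr a s"
    note W' = W[OF this]
    show "(\<Union>(b, t)\<in>fr b t. fr (t \<otimes> a' \<oplus> s' \<otimes> b) (s' \<otimes> t)) = fr (t \<otimes> a \<oplus> s \<otimes> b) (s \<otimes> t)"
      by (rule UN_const_eq[OF m(2)], clarify) (rule W')
  qed
qed

lemma fr_eqI: "a \<in> carrier R \<Longrightarrow> s \<in> S \<Longrightarrow> b \<in> carrier R \<Longrightarrow> t \<in> S \<Longrightarrow>
    \<phi> t * \<phi> a = \<phi> s * \<phi> b \<Longrightarrow> fr a s = fr b t"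
  by (simp add: fr_eq_iff)

lemma Q_ring: "ring Q"
proof (rule ringI)
  show "abelian_group Q"
  proof (rule abelian_groupI)
    fix X Y assume XY: "X \<in> carrier Q" "Y \<in> carrier Q"
    obtain a s where x: "a \<in> carrier R" "s \<in> S" "X = fr a s" using XY(1) Q_carrier by blast
    obtain b t where y: "b \<in> carrier R" "t \<in> S" "Y = fr b t" using XY(2) Q_carrier by blast
    note c = SD(1)[OF x(2)] SD(1)[OF y(2)]
    show "X \<oplus>\<^bsub>Q\<^esub> Y \<in> carrier Q"
      unfolding x(3) y(3) Q_add[OF x(1,2) y(1,2)] by (rule fr_closed) (simp_all add: x y c S_mult)
    show "X \<oplus>\<^bsub>Q\<^esub> Y = Y \<oplus>\<^bsub>Q\<^esub> X"
      unfolding x(3) y(3) Q_add[OF x(1,2) y(1,2)] Q_add[OF y(1,2) x(1,2)]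
        Z_comm_R[OF SD(3)[OF x(2)] c(2)]
      using x y c by (simp add: a_comm)
    fix W assume "W \<in> carrier Q"
    then obtain e u where w: "e \<in> carrier R" "u \<in> S" "W = fr e u" using Q_carrier by blast
    note c = c SD(1)[OF w(2)]
    have cl: "t \<otimes> a \<oplus> s \<otimes> b \<in> carrier R" "s \<otimes> t \<in> S" "u \<otimes> b \<oplus> t \<otimes> e \<in> carrier R" "t \<otimes> u \<in> S"
      using x y w c by (simp_all add: S_mult)
    have "u \<otimes> (t \<otimes> a \<oplus> s \<otimes> b) \<oplus> s \<otimes> t \<otimes> e = (t \<otimes> u) \<otimes> a \<oplus> s \<otimes> (u \<otimes> b \<oplus> t \<otimes> e)"
    proof (rule phi_inj)
      show "\<phi> (u \<otimes> (t \<otimes> a \<oplus> s \<otimes> b) \<oplus> s \<otimes> t \<otimes> e) = \<phi> ((t \<otimes> u) \<otimes> a \<oplus> s \<otimes> (u \<otimes> b \<oplus> t \<otimes> e))"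
        using x y w c by (simp only: phi_mult phi_add m_closed a_closed distrib_left mult.assoc add.assoc
            Z_comm2[OF SD(3)[OF y(2)] c(3)] Z_comm2[OF SD(3)[OF x(2)] c(3)])
    qed (use x y w c in simp_all)
    moreover have "s \<otimes> t \<otimes> u = s \<otimes> (t \<otimes> u)" using c by (simp add: m_assoc)
    ultimately show "X \<oplus>\<^bsub>Q\<^esub> Y \<oplus>\<^bsub>Q\<^esub> W = X \<oplus>\<^bsub>Q\<^esub> (Y \<oplus>\<^bsub>Q\<^esub> W)"
      unfolding x(3) y(3) w(3) Q_add[OF x(1,2) y(1,2)] Q_add[OF y(1,2) w(1,2)]
        Q_add[OF cl(1,2) w(1,2)] Q_add[OF x(1,2) cl(3,4)] by simp
  next
    show "\<zero>\<^bsub>Q\<^esub> \<in> carrier Q" unfolding Q_zero by (rule fr_closed) (simp_all add: S_one)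
  next
    fix X assume "X \<in> carrier Q"
    then obtain a s where x: "a \<in> carrier R" "s \<in> S" "X = fr a s" using Q_carrier by blast
    note c = SD(1)[OF x(2)]
    show "\<zero>\<^bsub>Q\<^esub> \<oplus>\<^bsub>Q\<^esub> X = X"
      unfolding x(3) Q_zero Q_add[OF zero_closed S_one x(1,2)] using x(1) c by simp
    have n: "\<ominus> a \<in> carrier R" using x by simp
    have "fr (\<ominus> a) s \<oplus>\<^bsub>Q\<^esub> X = \<zero>\<^bsub>Q\<^esub>"
      unfolding x(3) Q_zero Q_add[OF n x(2) x(1,2)]
      by (rule fr_eqI) (use x c in \<open>simp_all add: S_mult S_one phi_mult phi_add phi_neg phi_zero\<close>)
    then show "\<exists>Y\<in>carrier Q. Y \<oplus>\<^bsub>Q\<^esub> X = \<zero>\<^bsub>Q\<^esub>"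
      using fr_closed[OF n x(2)] by blast
  qed
  show "Group.monoid Q"
  proof (rule monoidI)
    fix X Y assume XY: "X \<in> carrier Q" "Y \<in> carrier Q"
    obtain a s where x: "a \<in> carrier R" "s \<in> S" "X = fr a s" using XY(1) Q_carrier by blast
    obtain b t where y: "b \<in> carrier R" "t \<in> S" "Y = fr b t" using XY(2) Q_carrier by blast
    note c = SD(1)[OF x(2)] SD(1)[OF y(2)]
    show "X \<otimes>\<^bsub>Q\<^esub> Y \<in> carrier Q"
      unfolding x(3) y(3) Q_mult[OF x(1,2) y(1,2)] by (rule fr_closed) (simp_all add: x y S_mult)
    fix W assume "W \<in> carrier Q"
    then obtain e u where w: "e \<in> carrier R" "u \<in> S" "W = fr e u" using Q_carrier by blast
    note c = c SD(1)[OF w(2)]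
    show "X \<otimes>\<^bsub>Q\<^esub> Y \<otimes>\<^bsub>Q\<^esub> W = X \<otimes>\<^bsub>Q\<^esub> (Y \<otimes>\<^bsub>Q\<^esub> W)"
      unfolding x(3) y(3) w(3) Q_mult[OF x(1,2) y(1,2)] Q_mult[OF y(1,2) w(1,2)]
        Q_mult[OF m_closed[OF x(1) y(1)] S_mult[OF x(2) y(2)] w(1,2)]
        Q_mult[OF x(1,2) m_closed[OF y(1) w(1)] S_mult[OF y(2) w(2)]]
      using x y w c by (simp add: m_assoc)
  next
    show "\<one>\<^bsub>Q\<^esub> \<in> carrier Q" unfolding Q_one by (rule fr_closed) (simp_all add: S_one)
  next
    fix X assume "X \<in> carrier Q"
    then obtain a s where x: "a \<in> carrier R" "s \<in> S" "X = fr a s" using Q_carrier by blast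
    note c = SD(1)[OF x(2)]
    show "\<one>\<^bsub>Q\<^esub> \<otimes>\<^bsub>Q\<^esub> X = X"
      unfolding x(3) Q_one Q_mult[OF one_closed S_one x(1,2)] using x(1) c by simp
    show "X \<otimes>\<^bsub>Q\<^esub> \<one>\<^bsub>Q\<^esub> = X"
      unfolding x(3) Q_one Q_mult[OF x(1,2) one_closed S_one] using x(1) c by simp
  qed
  fix X Y W assume XYW: "X \<in> carrier Q" "Y \<in> carrier Q" "W \<in> carrier Q"
  obtain a s where x: "a \<in> carrier R" "s \<in> S" "X = fr a s" using XYW(1) Q_carrier by blast
  obtain b t where y: "b \<in> carrier R" "t \<in> S" "Y = fr b t" using XYW(2) Q_carrier by blast
  obtain e u where w: "e \<in> carrier R" "u \<in> S" "W = fr e u" using XYW(3) Q_carrier by blast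
  note c = SD(1)[OF x(2)] SD(1)[OF y(2)] SD(1)[OF w(2)]
  note z = SD(3)[OF x(2)] SD(3)[OF y(2)] SD(3)[OF w(2)]
  have cl: "t \<otimes> a \<oplus> s \<otimes> b \<in> carrier R" "s \<otimes> t \<in> S" using x y c by (simp_all add: S_mult)
  have sw: "\<phi> t * (\<phi> s * v) = \<phi> s * (\<phi> t * v)" "\<phi> u * (\<phi> s * v) = \<phi> s * (\<phi> u * v)"
    "\<phi> u * (\<phi> t * v) = \<phi> t * (\<phi> u * v)" "\<phi> e * (\<phi> s * v) = \<phi> s * (\<phi> e * v)"
    "\<phi> e * (\<phi> t * v) = \<phi> t * (\<phi> e * v)" for v
    using Z_comm2[OF z(1) c(2)] Z_comm2[OF z(1) c(3)] Z_comm2[OF z(2) c(3)]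
      Z_comm2[OF z(1) w(1)] Z_comm2[OF z(2) w(1)] by blast+
  show "(X \<oplus>\<^bsub>Q\<^esub> Y) \<otimes>\<^bsub>Q\<^esub> W = X \<otimes>\<^bsub>Q\<^esub> W \<oplus>\<^bsub>Q\<^esub> Y \<otimes>\<^bsub>Q\<^esub> W"
    unfolding x(3) y(3) w(3) Q_add[OF x(1,2) y(1,2)] Q_mult[OF x(1,2) w(1,2)] Q_mult[OF y(1,2) w(1,2)]
      Q_mult[OF cl w(1,2)]
      Q_add[OF m_closed[OF x(1) w(1)] S_mult[OF x(2) w(2)] m_closed[OF y(1) w(1)] S_mult[OF y(2) w(2)]]
  proof (rule fr_eqI)
    show "\<phi> (s \<otimes> u \<otimes> (t \<otimes> u)) * \<phi> ((t \<otimes> a \<oplus> s \<otimes> b) \<otimes> e) =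
        \<phi> (s \<otimes> t \<otimes> u) * \<phi> (t \<otimes> u \<otimes> (a \<otimes> e) \<oplus> s \<otimes> u \<otimes> (b \<otimes> e))"
      using x(1) y(1) w(1) c
      by (simp only: phi_mult phi_add m_closed a_closed distrib_left distrib_right mult.assoc sw)
  qed (use x y w c in \<open>simp_all add: S_mult\<close>)
  show "W \<otimes>\<^bsub>Q\<^esub> (X \<oplus>\<^bsub>Q\<^esub> Y) = W \<otimes>\<^bsub>Q\<^esub> X \<oplus>\<^bsub>Q\<^esub> W \<otimes>\<^bsub>Q\<^esub> Y"
    unfolding x(3) y(3) w(3) Q_add[OF x(1,2) y(1,2)] Q_mult[OF w(1,2) x(1,2)] Q_mult[OF w(1,2) y(1,2)]
      Q_mult[OF w(1,2) cl]
      Q_add[OF m_closed[OF w(1) x(1)] S_mult[OF w(2) x(2)] m_closed[OF w(1) y(1)] S_mult[OF w(2) y(2)]]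
  proof (rule fr_eqI)
    show "\<phi> (u \<otimes> s \<otimes> (u \<otimes> t)) * \<phi> (e \<otimes> (t \<otimes> a \<oplus> s \<otimes> b)) =
        \<phi> (u \<otimes> (s \<otimes> t)) * \<phi> (u \<otimes> t \<otimes> (e \<otimes> a) \<oplus> u \<otimes> s \<otimes> (e \<otimes> b))"
      using x(1) y(1) w(1) c
      by (simp only: phi_mult phi_add m_closed a_closed distrib_left distrib_right mult.assoc sw)
  qed (use x y w c in \<open>simp_all add: S_mult\<close>)
qed

lemma Q_center: "ring_center Q = {fr z s | z s. z \<in> Z \<and> s \<in> S}"
proof (intro equalityI subsetI)
  fix X assume X: "X \<in> ring_center Q"
  then have XQ: "X \<in> carrier Q" by (simp add: ring_center_def)
  then obtain a s where x: "a \<in> carrier R" "s \<in> S" "X = fr a s" using Q_carrier by blast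
  have c: "s \<in> carrier R" using SD(1)[OF x(2)] .
  have "a \<in> Z"
  proof (rule ZI[OF x(1)])
    fix b assume b: "b \<in> carrier R"
    have "X \<otimes>\<^bsub>Q\<^esub> fr b \<one> = fr b \<one> \<otimes>\<^bsub>Q\<^esub> X"
      using X fr_closed[OF b S_one] by (simp add: ring_center_def)
    then have "fr (a \<otimes> b) s = fr (b \<otimes> a) s"
      unfolding x(3) Q_mult[OF x(1,2) b S_one] Q_mult[OF b S_one x(1,2)] using c by simp
    then have "\<phi> s * \<phi> (a \<otimes> b) = \<phi> s * \<phi> (b \<otimes> a)"
      using fr_eq_iff[of "a \<otimes> b" s "b \<otimes> a" s] x b by simp
    from S_cancel[OF x(2) _ _ this] show "\<phi> a * \<phi> b = \<phi> b * \<phi> a" using x b by (simp add: phi_mult)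
  qed
  then show "X \<in> {fr z s | z s. z \<in> Z \<and> s \<in> S}" using x by blast
next
  fix X assume "X \<in> {fr z s | z s. z \<in> Z \<and> s \<in> S}"
  then obtain z s where x: "z \<in> Z" "s \<in> S" "X = fr z s" by blast
  have zc: "z \<in> carrier R" by (rule ZD[OF x(1)])
  have "X \<otimes>\<^bsub>Q\<^esub> Y = Y \<otimes>\<^bsub>Q\<^esub> X" if "Y \<in> carrier Q" for Y
  proof -
    obtain b t where y: "b \<in> carrier R" "t \<in> S" "Y = fr b t" using \<open>Y \<in> carrier Q\<close> Q_carrier by blast
    show ?thesis unfolding x(3) y(3) Q_mult[OF zc x(2) y(1,2)] Q_mult[OF y(1,2) zc x(2)]
        Z_comm_R[OF x(1) y(1)] Z_comm_R[OF SD(3)[OF x(2)] SD(1)[OF y(2)]] by (rule refl)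
  qed
  then show "X \<in> ring_center Q" using fr_closed[OF zc x(2)] x(3) by (simp add: ring_center_def)
qed

lemma center_frI: "z \<in> Z \<Longrightarrow> s \<in> S \<Longrightarrow> fr z s \<in> ring_center Q"
  unfolding Q_center by blast

lemma center_frE:
  assumes "X \<in> ring_center Q"
  obtains z s where "z \<in> Z" "s \<in> S" "X = fr z s"
  using assms unfolding Q_center by blast

lemma Q_one_neq_zero: "\<one>\<^bsub>Q\<^esub> \<noteq> \<zero>\<^bsub>Q\<^esub>"
  unfolding Q_one Q_zero using fr_eq_iff[OF one_closed S_one zero_closed S_one]
  by (simp add: phi_one phi_zero)

lemma fr_eq_zero_iff: "a \<in> carrier R \<Longrightarrow> s \<in> S \<Longrightarrow> fr a s = \<zero>\<^bsub>Q\<^esub> \<longleftrightarrow> \<phi> a = 0"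
  unfolding Q_zero using fr_eq_iff[of a s \<zero> \<one>] S_one by (simp add: phi_one phi_zero)

text \<open>The centre of the localization consists of the fractions of central elements, and these are
invertible since all nonzero central elements have been inverted.\<close>

lemma center_subfield: "subfield (ring_center Q) Q"
proof -
  interpret Q: ring Q by (rule Q_ring)
  have sub: "subring (ring_center Q) Q"
  proof (rule Q.subringI)
    show "ring_center Q \<subseteq> carrier Q" unfolding ring_center_def by (rule Collect_restrict)
    show "\<one>\<^bsub>Q\<^esub> \<in> ring_center Q" unfolding Q_one by (rule center_frI[OF Z_one S_one])
    fix X assume "X \<in> ring_center Q"
    then obtain z s where x: "z \<in> Z" "s \<in> S" "X = fr z s" by (rule center_frE)
    note zc = ZD[OF x(1)] and sc = SD(1)[OF x(2)]
    have nc: "\<ominus> z \<in> carrier R" using zc by simp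
    have "fr (\<ominus> z) s \<oplus>\<^bsub>Q\<^esub> X = \<zero>\<^bsub>Q\<^esub>"
      unfolding x(3) Q_zero Q_add[OF nc x(2) zc x(2)]
      by (rule fr_eqI) (use x zc sc in \<open>simp_all add: S_mult S_one phi_mult phi_add phi_neg phi_zero\<close>)
    then have "\<ominus>\<^bsub>Q\<^esub> X = fr (\<ominus> z) s"
      by (rule Q.minus_equality) (simp_all add: x(2,3) fr_closed zc)
    then show "\<ominus>\<^bsub>Q\<^esub> X \<in> ring_center Q" using center_frI[OF Z_neg[OF x(1)] x(2)] by simp
    fix Y assume "Y \<in> ring_center Q"
    then obtain w t where y: "w \<in> Z" "t \<in> S" "Y = fr w t" by (rule center_frE)
    note wc = ZD[OF y(1)]
    show "X \<otimes>\<^bsub>Q\<^esub> Y \<in> ring_center Q"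
      unfolding x(3) y(3) Q_mult[OF zc x(2) wc y(2)] by (rule center_frI[OF Z_mult[OF x(1) y(1)] S_mult[OF x(2) y(2)]])
    show "X \<oplus>\<^bsub>Q\<^esub> Y \<in> ring_center Q"
      unfolding x(3) y(3) Q_add[OF zc x(2) wc y(2)]
      by (rule center_frI[OF Z_add[OF Z_mult[OF SD(3)[OF y(2)] x(1)] Z_mult[OF SD(3)[OF x(2)] y(1)]]
        S_mult[OF x(2) y(2)]])
  qed
  have subc: "subcring (ring_center Q) Q"
    by (rule Q.subcringI[OF sub]) (unfold ring_center_def, blast)
  have "Units (Q\<lparr>carrier := ring_center Q\<rparr>) = ring_center Q - {\<zero>\<^bsub>Q\<^esub>}"
  proof (intro equalityI subsetI)
    fix Y assume "Y \<in> Units (Q\<lparr>carrier := ring_center Q\<rparr>)"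
    then have Y: "Y \<in> ring_center Q" and ex: "\<exists>X\<in>ring_center Q. X \<otimes>\<^bsub>Q\<^esub> Y = \<one>\<^bsub>Q\<^esub> \<and> Y \<otimes>\<^bsub>Q\<^esub> X = \<one>\<^bsub>Q\<^esub>"
      unfolding Units_def by simp_all
    from ex obtain X where X: "X \<in> ring_center Q" "X \<otimes>\<^bsub>Q\<^esub> Y = \<one>\<^bsub>Q\<^esub>" by (elim bexE conjE)
    have XQ: "X \<in> carrier Q" using X(1) by (simp add: ring_center_def)
    have "Y \<noteq> \<zero>\<^bsub>Q\<^esub>"
    proof
      assume "Y = \<zero>\<^bsub>Q\<^esub>"
      then have "\<one>\<^bsub>Q\<^esub> = \<zero>\<^bsub>Q\<^esub>" using X(2) Q.r_null[OF XQ] by simp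
      then show False using Q_one_neq_zero by (rule notE[rotated])
    qed
    then show "Y \<in> ring_center Q - {\<zero>\<^bsub>Q\<^esub>}" using Y by simp
  next
    fix Y assume Y: "Y \<in> ring_center Q - {\<zero>\<^bsub>Q\<^esub>}"
    then have "Y \<in> ring_center Q" by (rule DiffD1)
    then obtain z s where x: "z \<in> Z" "s \<in> S" "Y = fr z s" by (rule center_frE)
    note zc = ZD[OF x(1)] and sc = SD(1)[OF x(2)]
    have "z \<in> S" by (rule SI[OF x(1)]) (use Y fr_eq_zero_iff[OF zc x(2)] x(3) in simp)
    have e: "z \<otimes> s = s \<otimes> z" by (rule Z_comm_R[OF x(1) sc])
    have inv: "fr (s \<otimes> z) (s \<otimes> z) = \<one>\<^bsub>Q\<^esub>"
      unfolding Q_one by (rule fr_eqI) (use zc sc x \<open>z \<in> S\<close> in \<open>simp_all add: S_mult S_one phi_one\<close>)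
    have "fr s z \<otimes>\<^bsub>Q\<^esub> Y = \<one>\<^bsub>Q\<^esub>" "Y \<otimes>\<^bsub>Q\<^esub> fr s z = \<one>\<^bsub>Q\<^esub>"
      unfolding x(3) Q_mult[OF sc \<open>z \<in> S\<close> zc x(2)] Q_mult[OF zc x(2) sc \<open>z \<in> S\<close>] e inv by simp_all
    moreover have "fr s z \<in> ring_center Q" by (rule center_frI[OF SD(3)[OF x(2)] \<open>z \<in> S\<close>])
    ultimately have "\<exists>X\<in>ring_center Q. X \<otimes>\<^bsub>Q\<^esub> Y = \<one>\<^bsub>Q\<^esub> \<and> Y \<otimes>\<^bsub>Q\<^esub> X = \<one>\<^bsub>Q\<^esub>"
      by (intro bexI[of _ "fr s z"] conjI)
    then show "Y \<in> Units (Q\<lparr>carrier := ring_center Q\<rparr>)" using Y unfolding Units_def by simp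
  qed
  then show ?thesis by (rule Q.subfieldI[OF subc])
qed

lemma common_denominator:
  assumes "set Ks \<subseteq> ring_center Q"
  shows "\<exists>s\<in>S. \<exists>zs. set zs \<subseteq> Z \<and> Ks = map (\<lambda>z. fr z s) zs"
  using assms
proof (induction Ks)
  case Nil
  then show ?case using S_one by (intro bexI[of _ \<one>] exI[of _ "[]"]) simp_all
next
  case (Cons K Ks)
  have "set Ks \<subseteq> ring_center Q" "K \<in> ring_center Q" using Cons.prems by simp_all
  from Cons.IH[OF this(1)] obtain t zs where t: "t \<in> S" "set zs \<subseteq> Z" "Ks = map (\<lambda>z. fr z t) zs"
    by (elim bexE exE conjE)
  from \<open>K \<in> ring_center Q\<close> obtain z s where z: "z \<in> Z" "s \<in> S" "K = fr z s" by (rule center_frE)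
  note c = SD(1)[OF t(1)] SD(1)[OF z(2)] ZD[OF z(1)]
  have "fr z s = fr (t \<otimes> z) (s \<otimes> t)"
    by (rule fr_eqI[OF c(3) z(2) m_closed[OF c(1,3)] S_mult[OF z(2) t(1)]])
      (simp only: phi_mult[OF c(2,1)] phi_mult[OF c(1,3)] mult.assoc)
  moreover have "fr w t = fr (s \<otimes> w) (s \<otimes> t)" if "w \<in> set zs" for w
  proof (rule fr_eqI)
    show w: "w \<in> carrier R" using subsetD[OF t(2) that] by (rule ZD)
    show "s \<otimes> w \<in> carrier R" by (rule m_closed[OF c(2) w])
    show "t \<in> S" "s \<otimes> t \<in> S" by (rule t(1), rule S_mult[OF z(2) t(1)])
    show "\<phi> (s \<otimes> t) * \<phi> w = \<phi> t * \<phi> (s \<otimes> w)"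
      by (simp only: phi_mult[OF c(2,1)] phi_mult[OF c(2) w] mult.assoc Z_comm2[OF SD(3)[OF z(2)] c(1)])
  qed
  ultimately have "K # Ks = map (\<lambda>z. fr z (s \<otimes> t)) ((t \<otimes> z) # map (\<lambda>w. s \<otimes> w) zs)"
    using z(3) t(3) by simp
  moreover have "set ((t \<otimes> z) # map (\<lambda>w. s \<otimes> w) zs) \<subseteq> Z"
  proof -
    have "s \<otimes> w \<in> Z" if "w \<in> set zs" for w by (rule Z_mult[OF SD(3)[OF z(2)] subsetD[OF t(2) that]])
    then show ?thesis using Z_mult[OF SD(3)[OF t(1)] z(1)] by (simp add: image_subset_iff)
  qed
  ultimately show ?case by (intro bexI[OF _ S_mult[OF z(2) t(1)]] exI conjI)
qed

lemma combine_fr: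
  assumes s: "s \<in> S" and len: "length zs = length bs" and "set zs \<subseteq> Z" "set bs \<subseteq> carrier R"
  shows "\<exists>x\<in>carrier R. ring.combine Q (map (\<lambda>z. fr z s) zs) (map (\<lambda>b. fr b \<one>) bs) = fr x s \<and>
    \<phi> x = (\<Sum>i<length bs. \<phi> (zs ! i) * \<phi> (bs ! i))"
proof -
  interpret Q: ring Q by (rule Q_ring)
  show ?thesis using len assms(3,4)
  proof (induction zs bs rule: list_induct2)
    case Nil
    have "\<zero>\<^bsub>Q\<^esub> = fr \<zero> s" using fr_eq_zero_iff[OF zero_closed s] phi_zero by simp
    then show ?case using phi_zero by (intro bexI[of _ \<zero>]) simp_all
  next
    case (Cons z zs b bs)
    then obtain x where x: "x \<in> carrier R" "Q.combine (map (\<lambda>z. fr z s) zs) (map (\<lambda>b. fr b \<one>) bs) = fr x s"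
      "\<phi> x = (\<Sum>i<length bs. \<phi> (zs ! i) * \<phi> (bs ! i))" by auto
    have c: "z \<in> carrier R" "b \<in> carrier R" "s \<in> carrier R" using Cons.prems ZD SD(1)[OF s] by auto
    have "fr z s \<otimes>\<^bsub>Q\<^esub> fr b \<one> = fr (z \<otimes> b) s"
      unfolding Q_mult[OF c(1) s c(2) S_one] using c by simp
    moreover have "fr (z \<otimes> b) s \<oplus>\<^bsub>Q\<^esub> fr x s = fr (z \<otimes> b \<oplus> x) s"
      unfolding Q_add[OF m_closed[OF c(1,2)] s x(1) s]
      by (rule fr_eqI) (use c s x(1) in \<open>simp_all add: S_mult phi_mult phi_add distrib_left mult.assoc\<close>)
    ultimately have "Q.combine (map (\<lambda>z. fr z s) (z # zs)) (map (\<lambda>b. fr b \<one>) (b # bs)) = fr (z \<otimes> b \<oplus> x) s"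
      using x(2) by simp
    moreover have "\<phi> (z \<otimes> b \<oplus> x) = (\<Sum>i<length (b # bs). \<phi> ((z # zs) ! i) * \<phi> ((b # bs) ! i))"
      using c x(1,3) by (simp add: phi_add phi_mult sum.lessThan_Suc_shift del: sum.lessThan_Suc)
    ultimately show ?case using c x(1) by (intro bexI[of _ "z \<otimes> b \<oplus> x"]) simp_all
  qed
qed

text \<open>A list of \<open>d\<^sup>2\<close> elements of the domain itself that is independent over its centre, and that spans up to
central multiples, is a basis of the localization over its centre: denominators are central and can
be cleared.\<close>

theorem PI_deg_eqI:
  assumes PI: "PI_ring R" and bs: "set bs \<subseteq> carrier R" "length bs = d\<^sup>2"
    and ind: "\<And>zs. length zs = length bs \<Longrightarrow> set zs \<subseteq> Z \<Longrightarrow>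
      (\<Sum>i<length bs. \<phi> (zs ! i) * \<phi> (bs ! i)) = 0 \<Longrightarrow> \<forall>z\<in>set zs. \<phi> z = 0"
    and span: "\<And>a. a \<in> carrier R \<Longrightarrow> \<exists>s\<in>Z. \<phi> s \<noteq> 0 \<and> (\<exists>zs. length zs = length bs \<and> set zs \<subseteq> Z \<and>
      \<phi> s * \<phi> a = (\<Sum>i<length bs. \<phi> (zs ! i) * \<phi> (bs ! i)))"
  shows "PI_deg R = d"
proof -
  interpret Q: ring Q by (rule Q_ring)
  note K = center_subfield
  let ?Us = "map (\<lambda>b. fr b \<one>) bs"
  have Us: "set ?Us \<subseteq> carrier Q"
    by (rule set_map_subsetI, rule fr_closed[OF subsetD[OF bs(1)] S_one])
  have KQ: "ring_center Q \<subseteq> carrier Q" unfolding ring_center_def by (rule Collect_restrict)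
  have zK: "\<zero>\<^bsub>Q\<^esub> \<in> ring_center Q" unfolding Q_zero by (rule center_frI[OF Z_zero S_one])
  have "Q.independent (ring_center Q) ?Us"
  proof (rule Q.trivial_combine_imp_independent[OF K Us])
    fix Ks assume Ks: "set Ks \<subseteq> ring_center Q" "Q.combine Ks ?Us = \<zero>\<^bsub>Q\<^esub>"
    obtain Ls where Ls: "set (take (length ?Us) Ks) \<subseteq> set Ls"
        "set Ls \<subseteq> set (take (length ?Us) Ks) \<union> {\<zero>\<^bsub>Q\<^esub>}" "length Ls = length ?Us" "Q.combine Ls ?Us = \<zero>\<^bsub>Q\<^esub>"
      by (rule Q.combine_normalize[OF subset_trans[OF Ks(1) KQ] Us Ks(2)])
    have "set (take (length ?Us) Ks) \<subseteq> ring_center Q" using Ks(1) set_take_subset by (rule subset_trans[rotated])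
    then have "set (take (length ?Us) Ks) \<union> {\<zero>\<^bsub>Q\<^esub>} \<subseteq> ring_center Q" using zK by simp
    from common_denominator[OF subset_trans[OF Ls(2) this]]
    obtain s zs where s: "s \<in> S" "set zs \<subseteq> Z" "Ls = map (\<lambda>z. fr z s) zs"
      by (elim bexE exE conjE)
    have len: "length zs = length bs" using Ls(3) unfolding s(3) length_map .
    obtain x where x: "x \<in> carrier R" "Q.combine Ls ?Us = fr x s"
      "\<phi> x = (\<Sum>i<length bs. \<phi> (zs ! i) * \<phi> (bs ! i))"
      using combine_fr[OF s(1) len s(2) bs(1)] unfolding s(3) by (elim bexE conjE)
    have x0: "\<phi> x = 0"
      by (rule iffD1[OF fr_eq_zero_iff[OF x(1) s(1)] trans[OF sym[OF x(2)] Ls(4)]])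
    have z0: "\<forall>z\<in>set zs. \<phi> z = 0" by (rule ind[OF len s(2) trans[OF sym[OF x(3)] x0]])
    have "fr z s \<in> {\<zero>\<^bsub>Q\<^esub>}" if "z \<in> set zs" for z
      unfolding singleton_iff
      by (rule iffD2[OF fr_eq_zero_iff[OF ZD[OF subsetD[OF s(2) that]] s(1)] bspec[OF z0 that]])
    then have "set Ls \<subseteq> {\<zero>\<^bsub>Q\<^esub>}" unfolding s(3) by (rule set_map_subsetI)
    then show "set (take (length ?Us) Ks) \<subseteq> {\<zero>\<^bsub>Q\<^esub>}" by (rule subset_trans[OF Ls(1)])
  qed
  then have dim: "Q.dimension (length ?Us) (ring_center Q) (Q.Span (ring_center Q) ?Us)"
    by (rule Q.dimension_independent)
  have "Q.Span (ring_center Q) ?Us = carrier Q"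
  proof (intro equalityI subsetI)
    fix X assume "X \<in> Q.Span (ring_center Q) ?Us"
    then show "X \<in> carrier Q" by (rule subsetD[OF Q.Span_in_carrier[OF KQ Us]])
  next
    fix X assume "X \<in> carrier Q"
    then obtain a s where a: "a \<in> carrier R" "s \<in> S" "X = fr a s" unfolding Q_carrier by (elim bexE)
    obtain t zs where t: "t \<in> Z" "\<phi> t \<noteq> 0" "length zs = length bs" "set zs \<subseteq> Z"
      "\<phi> t * \<phi> a = (\<Sum>i<length bs. \<phi> (zs ! i) * \<phi> (bs ! i))" using span[OF a(1)] by (elim bexE exE conjE)
    have tS: "t \<in> S" by (rule SI[OF t(1,2)])
    have st: "s \<otimes> t \<in> S" by (rule S_mult[OF a(2) tS])
    obtain x where x: "x \<in> carrier R" "Q.combine (map (\<lambda>z. fr z (s \<otimes> t)) zs) ?Us = fr x (s \<otimes> t)"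
      "\<phi> x = (\<Sum>i<length bs. \<phi> (zs ! i) * \<phi> (bs ! i))"
      using combine_fr[OF st t(3,4) bs(1)] by (elim bexE conjE)
    have "fr x (s \<otimes> t) = X" unfolding a(3)
    proof (rule fr_eqI[OF x(1) st a(1,2)])
      have "\<phi> x = \<phi> t * \<phi> a" using x(3) t(5) by simp
      then show "\<phi> s * \<phi> x = \<phi> (s \<otimes> t) * \<phi> a"
        by (simp add: phi_mult[OF SD(1)[OF a(2)] SD(1)[OF tS]] mult.assoc)
    qed
    moreover have "set (map (\<lambda>z. fr z (s \<otimes> t)) zs) \<subseteq> ring_center Q"
      by (rule set_map_subsetI, rule center_frI[OF subsetD[OF t(4)] st])
    ultimately have "X = Q.combine (map (\<lambda>z. fr z (s \<otimes> t)) zs) ?Us \<and>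
        set (map (\<lambda>z. fr z (s \<otimes> t)) zs) \<subseteq> ring_center Q"
      using x(2) by (simp only: simp_thms)
    then show "X \<in> Q.Span (ring_center Q) ?Us"
      unfolding Q.Span_eq_combine_set[OF K Us] by (intro CollectI exI)
  qed
  then have D: "Q.dimension (d\<^sup>2) (ring_center Q) (carrier Q)" using dim bs(2) by simp
  have "(THE d. Q.dimension (d\<^sup>2) (ring_center Q) (carrier Q)) = d"
  proof (rule the_equality)
    show "Q.dimension (d\<^sup>2) (ring_center Q) (carrier Q)" by (rule D)
    fix e assume "Q.dimension (e\<^sup>2) (ring_center Q) (carrier Q)"
    then have "e\<^sup>2 = d\<^sup>2" by (rule Q.dimension_is_inj[OF K _ D])
    then show "e = d" by (simp add: power2_eq_iff_nonneg)
  qed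
  then show ?thesis unfolding PI_deg_def Let_def using prime PI by simp
qed

end

section \<open>Removing an entry of a matrix by a pivot\<close>

text \<open>An algebra over a field, with the scalar action as an operation on a ring type, and a nonzero scalar
\<open>q\<close> for the relations below.\<close>

locale scaled_ring =
  fixes sc :: "'k::field \<Rightarrow> 'a::ring_1 \<Rightarrow> 'a" and q :: 'k
  assumes sc_add_right: "sc c (x + y) = sc c x + sc c y"
    and sc_add_left: "sc (c + d) x = sc c x + sc d x"
    and sc_mult_left: "sc c x * y = sc c (x * y)"
    and sc_mult_right: "x * sc c y = sc c (x * y)"
    and sc_sc: "sc c (sc d x) = sc (c * d) x"
    and sc_one [simp]: "sc 1 x = x"
    and q_nz: "q \<noteq> 0"
begin

abbreviation "r \<equiv> inverse q"

lemma sc_zero [simp]: "sc 0 x = 0" "sc c 0 = 0"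
  using sc_add_left[of 0 0 x] sc_add_right[of c 0 0] by simp_all

lemma sc_minus [simp]: "sc (- c) x = - sc c x" "sc c (- x) = - sc c x"
proof -
  have "sc c x + sc (- c) x = 0" using sc_add_left[of c "- c" x] by simp
  then show "sc (- c) x = - sc c x" by (rule minus_unique[symmetric])
  have "sc c x + sc c (- x) = 0" using sc_add_right[of c x "- x"] by simp
  then show "sc c (- x) = - sc c x" by (rule minus_unique[symmetric])
qed

lemma sc_diff: "sc (c - d) x = sc c x - sc d x" "sc c (x - y) = sc c x - sc c y"
  using sc_add_left[of c "- d" x] sc_add_right[of c x "- y"] by simp_all

lemma scalar_simps: "q * r = 1" "r * q = 1" "q * (r * c) = c" "r * (q * c) = c"
  using q_nz by (simp_all add: field_simps)

lemmas nf = distrib_left distrib_right left_diff_distrib right_diff_distrib mult.assoc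
  sc_mult_left sc_mult_right sc_sc sc_add_right sc_diff scalar_simps

lemma comm_assoc:
  fixes x y w :: 'a
  assumes "y * x = x * y"
  shows "y * (x * w) = x * (y * w)"
  by (simp only: mult.assoc[symmetric] assms)

lemma qcomm_assoc: "y * x = sc c (x * y) \<Longrightarrow> y * (x * w) = sc c (x * (y * w))"
  by (simp only: mult.assoc[symmetric] sc_mult_left[symmetric])

text \<open>Versions of commutation rules with a further factor on the right, so that the rewriting of a
right-nested product can apply them at every position.\<close>

lemma dcomm_assoc:
  assumes h: "y * x = x * y - (sc q (e * f) - sc r (e * f))"
  shows "y * (x * w) = x * (y * w) - (sc q (e * (f * w)) - sc r (e * (f * w)))"
proof -
  have "y * (x * w) = (y * x) * w" by (simp only: mult.assoc)
  also have "\<dots> = (x * y - (sc q (e * f) - sc r (e * f))) * w" by (simp only: h)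
  also have "\<dots> = x * (y * w) - (sc q (e * (f * w)) - sc r (e * (f * w)))"
    by (simp only: left_diff_distrib sc_mult_left mult.assoc)
  finally show ?thesis .
qed

lemma inverse_comm:
  assumes "p * P = 1" "P * p = 1" "p * z = sc c (z * p)"
  shows "z * P = sc c (P * z)"
proof -
  have "P * (p * z) * P = sc c (P * (z * p) * P)"
    by (simp add: assms(3) sc_mult_left sc_mult_right)
  moreover have "P * (p * z) * P = (P * p) * (z * P)" "P * (z * p) * P = (P * z) * (p * P)"
    by (simp_all add: mult.assoc)
  ultimately show ?thesis using assms by simp
qed

lemma qcomm_flip: "y * x = sc q (x * y) \<Longrightarrow> x * y = sc r (y * x)"
  by (simp add: sc_sc scalar_simps)

lemma inverse_comm1:
  fixes p P z :: 'a
  assumes "p * P = 1" "P * p = 1" "p * z = z * p"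
  shows "z * P = P * z"
  using inverse_comm[of p P z 1] assms by simp

text \<open>The next lemmas are the relations between entries after a pivot step, one for each relative
position of the two entries and the pivot. With \<open>P\<close> the inverse of the pivot \<open>p\<close>, the letters stand
for

\<open>p  y  z\<close>

\<open>u  a  b\<close>

\<open>v  c  d\<close>

so that \<open>a\<close> is replaced by \<open>a + u * P * y\<close>, \<open>b\<close> by \<open>b + u * P * z\<close> and so on; \<open>g\<close> and \<open>w\<close> are
entries outside of this block. Each follows by rewriting both sides to a normal form with the relations
before the step.\<close>

lemma pivot_row_both:
  assumes P: "u * P = sc q (P * u)" "y * P = sc q (P * y)" "z * P = sc q (P * z)"
    "a * P = P * a" "b * P = P * b"
    and rows: "a * b = sc q (b * a)" "u * a = sc q (a * u)" "u * b = sc q (b * u)" "y * z = sc q (z * y)"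
    and cols: "y * a = sc q (a * y)" "z * b = sc q (b * z)"
    and anti: "y * u = u * y" "z * u = u * z" "z * a = a * z"
    and diag: "y * b = b * y + sc (q - r) (z * a)"
  shows "(a + u * P * y) * (b + u * P * z) = sc q ((b + u * P * z) * (a + u * P * y))"
proof -
  note Q = P(1-3) rows(1,4) rows(2,3)[THEN qcomm_flip] cols[THEN qcomm_flip]
  note C = P(4,5) anti(1,2) anti(3)[symmetric]
  have D: "b * y = y * b - (sc q (z * a) - sc r (z * a))"
    using diag anti by (simp add: sc_diff)
  note N = nf Q C D Q[THEN qcomm_assoc] C[THEN comm_assoc] D[THEN dcomm_assoc]
  show ?thesis by (simp only: N) (simp add: algebra_simps)
qed

lemma pivot_diag_boundary:
  assumes P: "u * P = sc q (P * u)" "v * P = sc q (P * v)" "z * P = sc q (P * z)"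
    and rel: "u * v = sc q (v * u)" "u * b = sc q (b * u)" "v * d = sc q (d * v)"
      "b * v = v * b" "z * u = u * z" "z * v = v * z"
    and diag: "u * d = d * u + sc (q - r) (b * v)"
  shows "u * (d + v * P * z) = (d + v * P * z) * u + sc (q - r) ((b + u * P * z) * v)"
proof -
  note Q = P rel(1) rel(2,3)[THEN qcomm_flip]
  note C = rel(4-6)
  have D: "d * u = u * d - (sc q (v * b) - sc r (v * b))"
    using diag rel by (simp add: sc_diff)
  note N = nf Q C D Q[THEN qcomm_assoc] C[THEN comm_assoc] D[THEN dcomm_assoc]
  show ?thesis by (simp only: N) (simp add: algebra_simps)
qed

lemma pivot_block:
  assumes P: "u * P = sc q (P * u)" "v * P = sc q (P * v)" "y * P = sc q (P * y)" "z * P = sc q (P * z)"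
    "a * P = P * a" "b * P = P * b" "c * P = P * c" "d * P = P * d"
    and rows: "a * b = sc q (b * a)" "c * d = sc q (d * c)" "u * a = sc q (a * u)" "u * b = sc q (b * u)"
      "v * c = sc q (c * v)" "v * d = sc q (d * v)" "y * z = sc q (z * y)"
    and cols: "a * c = sc q (c * a)" "b * d = sc q (d * b)" "u * v = sc q (v * u)" "y * a = sc q (a * y)"
      "y * c = sc q (c * y)" "z * b = sc q (b * z)" "z * d = sc q (d * z)"
    and anti: "b * c = c * b" "a * v = v * a" "b * v = v * b" "y * u = u * y" "y * v = v * y"
      "z * u = u * z" "z * v = v * z" "z * a = a * z" "z * c = c * z"
    and diag: "a * d = d * a + sc (q - r) (b * c)" "u * c = c * u + sc (q - r) (a * v)"
      "u * d = d * u + sc (q - r) (b * v)" "y * b = b * y + sc (q - r) (z * a)"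
      "y * d = d * y + sc (q - r) (z * c)"
  shows "(b + u * P * z) * (c + v * P * y) = (c + v * P * y) * (b + u * P * z)"
    and "(a + u * P * y) * (d + v * P * z) = (d + v * P * z) * (a + u * P * y) +
      sc (q - r) ((b + u * P * z) * (c + v * P * y))"
proof -
  note Q = P(1-4) rows(1,2) rows(3-6)[THEN qcomm_flip] rows(7) cols(1-3) cols(4-7)[THEN qcomm_flip]
  note C = P(5-8) anti(1-7) anti(8,9)[symmetric]
  have D: "d * a = a * d - (sc q (b * c) - sc r (b * c))"
    "c * u = u * c - (sc q (v * a) - sc r (v * a))"
    "d * u = u * d - (sc q (v * b) - sc r (v * b))"
    "b * y = y * b - (sc q (z * a) - sc r (z * a))"
    "d * y = y * d - (sc q (z * c) - sc r (z * c))"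
    using diag anti by (simp_all add: sc_diff)
  have D1: "a * d = d * a - (sc q (- (c * b)) - sc r (- (c * b)))"
    using diag(1) anti(1) by (simp add: sc_diff)
  have D1': "a * (d * w) = d * (a * w) + (sc q (c * (b * w)) - sc r (c * (b * w)))" for w
    using dcomm_assoc[of a d "- c" b w] D1 by simp
  have D1'': "a * d = d * a + (sc q (c * b) - sc r (c * b))"
    using diag(1) anti(1) by (simp add: sc_diff)
  note N = nf Q C D(2-5) D1'' D1' Q[THEN qcomm_assoc] C[THEN comm_assoc] D(2-5)[THEN dcomm_assoc]
  show "(b + u * P * z) * (c + v * P * y) = (c + v * P * y) * (b + u * P * z)"
    by (simp only: N) (simp add: algebra_simps)
  show "(a + u * P * y) * (d + v * P * z) = (d + v * P * z) * (a + u * P * y) +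
      sc (q - r) ((b + u * P * z) * (c + v * P * y))"
    by (simp only: N) (simp add: algebra_simps)
qed

lemma pivot_row_boundary:
  assumes "u * P = sc q (P * u)" "u * b = sc q (b * u)" "u * z = z * u"
  shows "u * (b + u * P * z) = sc q ((b + u * P * z) * u)"
proof -
  note Q = assms(1) assms(2)[THEN qcomm_flip]
  note C = assms(3)[symmetric]
  show ?thesis by (simp only: nf Q C Q[THEN qcomm_assoc] C[THEN comm_assoc] sc_one)
qed

lemma pivot_row_outside:
  assumes "g * b = sc q (b * g)" "g * u = sc q (u * g)" "g * P = P * g" "g * z = z * g"
  shows "g * (b + u * P * z) = sc q ((b + u * P * z) * g)"
proof -
  note Q = assms(1,2) note C = assms(3,4)
  show ?thesis by (simp only: nf Q C Q[THEN qcomm_assoc] C[THEN comm_assoc])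
qed

lemma pivot_anti_boundary:
  assumes "v * P = sc q (P * v)" "b * v = v * b" "u * v = sc q (v * u)" "z * v = v * z" 
    "u * P = sc q (P * u)"
  shows "(b + u * P * z) * v = v * (b + u * P * z)"
proof -
  note Q = assms(1,3,5) note C = assms(2,4)
  show ?thesis by (simp only: nf Q C Q[THEN qcomm_assoc] C[THEN comm_assoc])
qed

lemma pivot_outside:
  fixes g b u P z :: 'a
  assumes "g * b = b * g" "g * u = u * g" "g * P = P * g" "g * z = z * g"
  shows "g * (b + u * P * z) = (b + u * P * z) * g"
  by (simp only: nf assms assms[THEN comm_assoc])

lemma pivot_row_left:
  assumes "g * b = b * g" "g * u = u * g" "g * P = sc r (P * g)" "g * z = sc q (z * g)"
  shows "g * (b + u * P * z) = (b + u * P * z) * g"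
  by (simp only: nf assms assms(1,2)[THEN comm_assoc] assms(3,4)[THEN qcomm_assoc] sc_one)

lemma pivot_itself:
  assumes "p * P = 1" "P * p = 1" "p * a = a * p" "p * u = sc q (u * p)" "p * y = sc q (y * p)"
    "y * u = u * y"
  shows "p * (a + u * P * y) = (a + u * P * y) * p + sc (q - r) (y * u)"
proof -
  have pP: "p * (P * w) = w" "P * (p * w) = w" for w
    by (simp_all only: mult.assoc[symmetric] assms(1,2) mult_1_left)
  have "y * p = sc r (p * y)" using assms(5) by (rule qcomm_flip)
  then show ?thesis
    by (simp only: nf assms(3,4,6) assms(3)[THEN comm_assoc] assms(4)[THEN qcomm_assoc] pP) simp
qed

lemma pivot_diag_outside:
  assumes "g * d = d * g + sc e (b * w)" "g * v = v * g + sc e (u * w)" "g * P = P * g" "g * z = z * g"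
    "P * w = w * P" "z * w = w * z"
  shows "g * (d + v * P * z) = (d + v * P * z) * g + sc e ((b + u * P * z) * w)"
proof -
  have "g * (v * x) = v * (g * x) + sc e (u * (w * x))" for x
  proof -
    have "g * (v * x) = (g * v) * x" by (simp only: mult.assoc)
    also have "\<dots> = v * (g * x) + sc e (u * (w * x))"
      by (simp only: assms(2) distrib_right sc_mult_left mult.assoc)
    finally show ?thesis .
  qed
  then show ?thesis
    by (simp only: nf assms(1,3,4,5,6) assms(3-6)[THEN comm_assoc]) (simp only: add_ac)
qed

text \<open>The relations of quantum matrices, where the correction term in the relation between \<open>x i j\<close> and an entry
below and to the right of it is present exactly if \<open>eps i j\<close>. With \<open>eps\<close> constantly true these are
quantum matrices, with \<open>eps\<close> constantly false the entries generate a quantum affine space; the other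
choices interpolate between the two.\<close>

definition qrel :: "nat set \<Rightarrow> nat set \<Rightarrow> (nat \<Rightarrow> nat \<Rightarrow> bool) \<Rightarrow> (nat \<Rightarrow> nat \<Rightarrow> 'a) \<Rightarrow> bool" where
  "qrel I J eps x \<longleftrightarrow>
    (\<forall>i\<in>I. \<forall>j\<in>J. \<forall>t\<in>J. j < t \<longrightarrow> x i j * x i t = sc q (x i t * x i j)) \<and>
    (\<forall>i\<in>I. \<forall>s\<in>I. \<forall>j\<in>J. i < s \<longrightarrow> x i j * x s j = sc q (x s j * x i j)) \<and>
    (\<forall>i\<in>I. \<forall>s\<in>I. \<forall>j\<in>J. \<forall>t\<in>J. i < s \<and> t < j \<longrightarrow> x i j * x s t = x s t * x i j) \<and>
    (\<forall>i\<in>I. \<forall>s\<in>I. \<forall>j\<in>J. \<forall>t\<in>J. i < s \<and> j < t \<longrightarrow>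
      x i j * x s t = x s t * x i j + sc (if eps i j then q - r else 0) (x i t * x s j))"

definition pivoted :: "nat \<Rightarrow> nat \<Rightarrow> 'a \<Rightarrow> (nat \<Rightarrow> nat \<Rightarrow> 'a) \<Rightarrow> nat \<Rightarrow> nat \<Rightarrow> 'a" where
  "pivoted k h P x i j = (if k < i \<and> h < j then x i j + x i h * P * x k j else x i j)"

lemma qrelD:
  assumes "qrel I J eps x" "i \<in> I" "j \<in> J"
  shows "t \<in> J \<Longrightarrow> j < t \<Longrightarrow> x i j * x i t = sc q (x i t * x i j)"
    and "s \<in> I \<Longrightarrow> i < s \<Longrightarrow> x i j * x s j = sc q (x s j * x i j)"
    and "s \<in> I \<Longrightarrow> t \<in> J \<Longrightarrow> i < s \<Longrightarrow> t < j \<Longrightarrow> x i j * x s t = x s t * x i j"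
    and "s \<in> I \<Longrightarrow> t \<in> J \<Longrightarrow> i < s \<Longrightarrow> j < t \<Longrightarrow> x i j * x s t = x s t * x i j +
      sc (if eps i j then q - r else 0) (x i t * x s j)"
    and "s \<in> I \<Longrightarrow> t \<in> J \<Longrightarrow> i < s \<Longrightarrow> j < t \<Longrightarrow> eps i j \<Longrightarrow> x i j * x s t = x s t * x i j +
      sc (q - r) (x i t * x s j)"
    and "s \<in> I \<Longrightarrow> t \<in> J \<Longrightarrow> i < s \<Longrightarrow> j < t \<Longrightarrow> \<not> eps i j \<Longrightarrow> x i j * x s t = x s t * x i j"
proof -
  note Q = assms(1)[unfolded qrel_def]
  note Q1 = conjunct1[OF Q] and Q2 = conjunct1[OF conjunct2[OF Q]]
    and Q3 = conjunct1[OF conjunct2[OF conjunct2[OF Q]]]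
    and Q4 = conjunct2[OF conjunct2[OF conjunct2[OF Q]]]
  show "t \<in> J \<Longrightarrow> j < t \<Longrightarrow> x i j * x i t = sc q (x i t * x i j)"
    using Q1 assms(2,3) by simp
  show "s \<in> I \<Longrightarrow> i < s \<Longrightarrow> x i j * x s j = sc q (x s j * x i j)"
    using Q2 assms(2,3) by simp
  show "s \<in> I \<Longrightarrow> t \<in> J \<Longrightarrow> i < s \<Longrightarrow> t < j \<Longrightarrow> x i j * x s t = x s t * x i j"
    by (rule Q3[rule_format]) (simp_all add: assms(2,3))
  show D: "s \<in> I \<Longrightarrow> t \<in> J \<Longrightarrow> i < s \<Longrightarrow> j < t \<Longrightarrow> x i j * x s t = x s t * x i j +
      sc (if eps i j then q - r else 0) (x i t * x s j)"
    using Q4 assms(2,3) by simp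
  show "s \<in> I \<Longrightarrow> t \<in> J \<Longrightarrow> i < s \<Longrightarrow> j < t \<Longrightarrow> eps i j \<Longrightarrow> x i j * x s t = x s t * x i j +
      sc (q - r) (x i t * x s j)"
    using D by (simp only: if_True)
  show "s \<in> I \<Longrightarrow> t \<in> J \<Longrightarrow> i < s \<Longrightarrow> j < t \<Longrightarrow> \<not> eps i j \<Longrightarrow> x i j * x s t = x s t * x i j"
    using D by (simp only: if_False sc_zero add_0_right)
qed

text \<open>The relations are symmetric in rows and columns, which halves the number of cases of a pivot
step.\<close>

lemma qrel_transpose:
  assumes "qrel I J eps x"
  shows "qrel J I (\<lambda>j i. eps i j) (\<lambda>j i. x i j)"
  unfolding qrel_def
proof (intro conjI ballI impI)
  fix i s j t assume H: "i \<in> J" "s \<in> J" "j \<in> I" "t \<in> I" "i < s \<and> j < t"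
  have "x j i * x t s = x t s * x j i + sc (if eps j i then q - r else 0) (x j s * x t i)"
    using qrelD(4)[OF assms, of j i t s] H by blast
  moreover have "x j s * x t i = x t i * x j s" using qrelD(3)[OF assms, of j s t i] H by blast
  ultimately show "x j i * x t s = x t s * x j i + sc (if eps j i then q - r else 0) (x t i * x j s)"
    by simp
next
  fix i s j t assume H: "i \<in> J" "s \<in> J" "j \<in> I" "t \<in> I" "i < s \<and> t < j"
  show "x j i * x t s = x t s * x j i" using qrelD(3)[OF assms, of t s j i] H by simp
qed (use qrelD(1,2)[OF assms] in simp_all)

end

text \<open>The situation in which position \<open>(k, h)\<close> is about to be treated: the correction terms are already
present at the positions below and to the right of it and still absent at the positions above and
to the left, including the pivot itself. So the pivot commutes with the entries outside its row
and its column.\<close>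

locale pivot_step = scaled_ring sc q for sc :: "'k::field \<Rightarrow> 'a::ring_1 \<Rightarrow> 'a" and q +
  fixes I J :: "nat set" and eps :: "nat \<Rightarrow> nat \<Rightarrow> bool" and x :: "nat \<Rightarrow> nat \<Rightarrow> 'a"
    and k h :: nat and P :: 'a
  assumes rel: "qrel I J eps x" and kI: "k \<in> I" and hJ: "h \<in> J"
    and inv1: "x k h * P = 1" and inv2: "P * x k h = 1"
    and on: "\<And>i j. k \<le> i \<Longrightarrow> h \<le> j \<Longrightarrow> (i, j) \<noteq> (k, h) \<Longrightarrow> eps i j"
    and off: "\<And>i j. i \<le> k \<Longrightarrow> j \<le> h \<Longrightarrow> \<not> eps i j"
begin

abbreviation "x' \<equiv> pivoted k h P x"

lemma in_row: "i \<in> I \<Longrightarrow> k < i \<Longrightarrow> x i h * P = sc q (P * x i h)"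
  by (rule inverse_comm[OF inv1 inv2]) (rule qrelD(2)[OF rel kI hJ])

lemma in_col: "j \<in> J \<Longrightarrow> h < j \<Longrightarrow> x k j * P = sc q (P * x k j)"
  by (rule inverse_comm[OF inv1 inv2]) (rule qrelD(1)[OF rel kI hJ])

lemma left_row: "t \<in> J \<Longrightarrow> t < h \<Longrightarrow> x k t * P = sc r (P * x k t)"
  by (rule inverse_comm[OF inv1 inv2]) (rule qcomm_flip, rule qrelD(1)[OF rel kI _ hJ])

lemma pivot_commutes:
  assumes "i \<in> I" "j \<in> J" "i \<noteq> k" "j \<noteq> h"
  shows "x i j * P = P * x i j"
proof (rule inverse_comm1[OF inv1 inv2])
  consider "i < k" "j < h" | "i < k" "h < j" | "k < i" "j < h" | "k < i" "h < j"
    using assms by linarith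
  then show "x k h * x i j = x i j * x k h"
  proof cases
    case 1 then show ?thesis using qrelD(6)[OF rel assms(1,2) kI hJ] off by simp
  next
    case 2 then show ?thesis using qrelD(3)[OF rel assms(1,2) kI hJ] by simp
  next
    case 3 then show ?thesis using qrelD(3)[OF rel kI hJ assms(1,2)] by simp
  next
    case 4 then show ?thesis using qrelD(6)[OF rel kI hJ assms(1,2)] off by simp
  qed
qed

lemma block:
  assumes i: "i \<in> I" "s \<in> I" "k < i" "i < s" and j: "j \<in> J" "t \<in> J" "h < j" "j < t"
  shows "x' i t * x' s j = x' s j * x' i t"
    and "x' i j * x' s t = x' s t * x' i j + sc (q - r) (x' i t * x' s j)"
proof -
  have o: "k < s" "h < t" "eps i j" "eps i h" "eps k j" using i j on by auto
  note B = pivot_block[of "x i h" P "x s h" "x k j" "x k t" "x i j" "x i t" "x s j" "x s t",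
    OF in_row[OF i(1,3)] in_row[OF i(2) o(1)] in_col[OF j(1,3)] in_col[OF j(2) o(2)]
      pivot_commutes pivot_commutes pivot_commutes pivot_commutes
      qrelD(1)[OF rel i(1) j(1,2,4)] qrelD(1)[OF rel i(2) j(1,2,4)]
      qrelD(1)[OF rel i(1) hJ j(1,3)] qrelD(1)[OF rel i(1) hJ j(2) o(2)]
      qrelD(1)[OF rel i(2) hJ j(1,3)] qrelD(1)[OF rel i(2) hJ j(2) o(2)]
      qrelD(1)[OF rel kI j(1,2,4)]
      qrelD(2)[OF rel i(1) j(1) i(2,4)] qrelD(2)[OF rel i(1) j(2) i(2,4)]
      qrelD(2)[OF rel i(1) hJ i(2,4)] qrelD(2)[OF rel kI j(1) i(1,3)]
      qrelD(2)[OF rel kI j(1) i(2) o(1)] qrelD(2)[OF rel kI j(2) i(1,3)]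
      qrelD(2)[OF rel kI j(2) i(2) o(1)]
      qrelD(3)[OF rel i(1) j(2) i(2) j(1) i(4) j(4)]
      qrelD(3)[OF rel i(1) j(1) i(2) hJ i(4) j(3)]
      qrelD(3)[OF rel i(1) j(2) i(2) hJ i(4) o(2)]
      qrelD(3)[OF rel kI j(1) i(1) hJ i(3) j(3)]
      qrelD(3)[OF rel kI j(1) i(2) hJ o(1) j(3)]
      qrelD(3)[OF rel kI j(2) i(1) hJ i(3) o(2)]
      qrelD(3)[OF rel kI j(2) i(2) hJ o(1) o(2)]
      qrelD(3)[OF rel kI j(2) i(1) j(1) i(3) j(4)]
      qrelD(3)[OF rel kI j(2) i(2) j(1) o(1) j(4)]
      qrelD(5)[OF rel i(1) j(1) i(2) j(2) i(4) j(4) o(3)]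
      qrelD(5)[OF rel i(1) hJ i(2) j(1) i(4) j(3) o(4)]
      qrelD(5)[OF rel i(1) hJ i(2) j(2) i(4) o(2) o(4)]
      qrelD(5)[OF rel kI j(1) i(1) j(2) i(3) j(4) o(5)]
      qrelD(5)[OF rel kI j(1) i(2) j(2) o(1) j(4) o(5)]]
  have e: "x' i j = x i j + x i h * P * x k j" "x' i t = x i t + x i h * P * x k t"
    "x' s j = x s j + x s h * P * x k j" "x' s t = x s t + x s h * P * x k t"
    using i j o by (simp_all add: pivoted_def)
  have ne: "i \<noteq> k" "s \<noteq> k" "j \<noteq> h" "t \<noteq> h" using i j by auto
  note B' = B[OF i(1) j(1) ne(1,3) i(1) j(2) ne(1,4) i(2) j(1) ne(2,3) i(2) j(2) ne(2,4)]
  show "x' i t * x' s j = x' s j * x' i t" unfolding e by (rule B'(1))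
  show "x' i j * x' s t = x' s t * x' i j + sc (q - r) (x' i t * x' s j)"
    unfolding e by (rule B'(2))
qed

lemma row_rel:
  assumes i: "i \<in> I" and j: "j \<in> J" "t \<in> J" "j < t"
  shows "x' i j * x' i t = sc q (x' i t * x' i j)"
proof -
  note R = qrelD(1)[OF rel i j]
  consider "i \<le> k \<or> t \<le> h" | "k < i" "h < t" "j < h" | "k < i" "h < t" "j = h" | "k < i" "h < j"
    by linarith
  then show ?thesis
  proof cases
    case 1 then show ?thesis using R j by (auto simp: pivoted_def)
  next
    case 2
    have "x i j * (x i t + x i h * P * x k t) = sc q ((x i t + x i h * P * x k t) * x i j)"
      by (rule pivot_row_outside[OF R qrelD(1)[OF rel i j(1) hJ 2(3)] pivot_commutes[OF i j(1)]
        qrelD(3)[OF rel kI j(2) i j(1) 2(1) j(3), symmetric]]) (use 2 in auto)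
    then show ?thesis using 2 by (simp add: pivoted_def)
  next
    case 3
    have "x i h * (x i t + x i h * P * x k t) = sc q ((x i t + x i h * P * x k t) * x i h)"
      by (rule pivot_row_boundary[OF in_row[OF i 3(1)] qrelD(1)[OF rel i hJ j(2) 3(2)]
        qrelD(3)[OF rel kI j(2) i hJ 3(1,2), symmetric]])
    then show ?thesis using 3 by (simp add: pivoted_def)
  next
    case 4
    have o: "h < t" "eps k j" using 4 j on by auto
    have ne: "i \<noteq> k" "j \<noteq> h" "t \<noteq> h" using 4 j by auto
    have "(x i j + x i h * P * x k j) * (x i t + x i h * P * x k t) =
      sc q ((x i t + x i h * P * x k t) * (x i j + x i h * P * x k j))"
      by (rule pivot_row_both[OF in_row[OF i 4(1)] in_col[OF j(1) 4(2)] in_col[OF j(2) o(1)]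
        pivot_commutes[OF i j(1) ne(1,2)] pivot_commutes[OF i j(2) ne(1,3)] R
        qrelD(1)[OF rel i hJ j(1) 4(2)] qrelD(1)[OF rel i hJ j(2) o(1)] qrelD(1)[OF rel kI j]
        qrelD(2)[OF rel kI j(1) i 4(1)] qrelD(2)[OF rel kI j(2) i 4(1)]
        qrelD(3)[OF rel kI j(1) i hJ 4] qrelD(3)[OF rel kI j(2) i hJ 4(1) o(1)]
        qrelD(3)[OF rel kI j(2) i j(1) 4(1) j(3)]
        qrelD(5)[OF rel kI j(1) i j(2) 4(1) j(3) o(2)]])
    then show ?thesis using 4 o by (simp add: pivoted_def)
  qed
qed

lemma anti_rel:
  assumes i: "i \<in> I" "s \<in> I" "i < s" and j: "j \<in> J" "t \<in> J" "t < j" and ki: "k < i \<or> t \<le> h"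
  shows "x' i j * x' s t = x' s t * x' i j"
proof -
  note R = qrelD(3)[OF rel i(1) j(1) i(2) j(2) i(3) j(3)]
  consider "i \<le> k" "t \<le> h" | "j \<le> h" | "k < i" "h < t" | "k < i" "h < j" "t < h" | "k < i" "h < j" "t = h"
    using ki by linarith
  then show ?thesis
  proof cases
    case 1 then show ?thesis using R by (simp add: pivoted_def)
  next
    case 2 then show ?thesis using R j(3) by (simp add: pivoted_def)
  next
    case 3 show ?thesis by (rule block(1)[OF i(1,2) 3(1) i(3) j(2,1) 3(2) j(3)])
  next
    case 4
    have "x s t * (x i j + x i h * P * x k j) = (x i j + x i h * P * x k j) * x s t"
      by (rule pivot_outside[OF R[symmetric] qrelD(3)[OF rel i(1) hJ i(2) j(2) i(3) 4(3), symmetric]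
        pivot_commutes[OF i(2) j(2)] qrelD(3)[OF rel kI j(1) i(2) j(2) _ j(3), symmetric]]) (use 4 i in auto)
    then show ?thesis using 4 by (simp add: pivoted_def)
  next
    case 5
    have ks: "k < s" using 5 i by simp
    have "(x i j + x i h * P * x k j) * x s h = x s h * (x i j + x i h * P * x k j)"
      by (rule pivot_anti_boundary[OF in_row[OF i(2) ks] R[unfolded 5(3)]
        qrelD(2)[OF rel i(1) hJ i(2,3)] qrelD(3)[OF rel kI j(1) i(2) hJ ks 5(2)]
        in_row[OF i(1) 5(1)]])
    then show ?thesis using 5 by (simp add: pivoted_def)
  qed
qed

lemma diag_rel:
  assumes i: "i \<in> I" "s \<in> I" "i < s" and j: "j \<in> J" "t \<in> J" "j < t"
    and c: "k < i \<or> j < h \<and> i \<le> k \<or> (i, j) = (k, h) \<or> s \<le> k \<or> t \<le> h"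
  shows "x' i j * x' s t = x' s t * x' i j +
    sc (if eps i j \<or> (i, j) = (k, h) then q - r else 0) (x' i t * x' s j)"
proof -
  note R = qrelD(4)[OF rel i(1) j(1) i(2) j(2) i(3) j(3)]
  have c': "\<lbrakk>\<not> (s \<le> k \<or> t \<le> h); \<not> k < i\<rbrakk> \<Longrightarrow> j < h \<or> i = k \<and> j = h"
    using c by auto
  consider "s \<le> k \<or> t \<le> h" | "k < s" "h < t" "(i, j) = (k, h)" | "k < s" "h < t" "k < i" "h < j"
    | "k < i" "h < t" "j = h" | "k < i" "h < t" "j < h" | "k < s" "h < t" "i = k" "j < h"
    | "k < s" "h < t" "i < k" "j < h"
  proof (cases "s \<le> k \<or> t \<le> h")
    case False
    then have st: "k < s" "h < t" by auto
    show ?thesis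
    proof (cases "k < i")
      case True
      show ?thesis by (cases j h rule: linorder_cases) (rule that(5,4,3); use True st in simp)+
    next
      case nk: False
      show ?thesis
      proof (cases "j < h")
        case True
        show ?thesis by (cases "i = k") (rule that(6,7); use True nk st in simp)+
      next
        case False
        then show ?thesis using c'[OF \<open>\<not> (s \<le> k \<or> t \<le> h)\<close> nk] that(2) st by simp
      qed
    qed
  qed (rule that(1))
  then show ?thesis
  proof cases
    case 1
    have e: "x' i j = x i j" "x' s t = x s t" "x' i t = x i t" "x' s j = x s j"
      using 1 i(3) j(3) by (simp_all add: pivoted_def) linarith+
    have "(i, j) \<noteq> (k, h)" using 1 i j by auto
    then show ?thesis using R by (simp only: e simp_thms)
  next
    case 2
    have [simp]: "i = k" "j = h" using 2 by auto
    have "x k h * (x s t + x s h * P * x k t) = (x s t + x s h * P * x k t) * x k h + sc (q - r) (x k t * x s h)"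
      by (rule pivot_itself[OF inv1 inv2 qrelD(6)[OF rel kI hJ i(2) j(2) 2(1,2)]
        qrelD(2)[OF rel kI hJ i(2) 2(1)] qrelD(1)[OF rel kI hJ j(2) 2(2)]
        qrelD(3)[OF rel kI j(2) i(2) hJ 2(1,2)]]) (use off in auto)
    then show ?thesis using 2 by (simp add: pivoted_def)
  next
    case 3
    have "eps i j" using on 3 by simp
    then show ?thesis using block(2)[OF i(1,2) 3(3) i(3) j(1,2) 3(4) j(3)] by simp
  next
    case 4
    have ks: "k < s" using 4 i by simp
    have e: "eps i h" using on 4 by simp
    have "x i h * (x s t + x s h * P * x k t) = (x s t + x s h * P * x k t) * x i h +
       sc (q - r) ((x i t + x i h * P * x k t) * x s h)"
      by (rule pivot_diag_boundary[OF in_row[OF i(1) 4(1)] in_row[OF i(2) ks] in_col[OF j(2) 4(2)]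
        qrelD(2)[OF rel i(1) hJ i(2,3)] qrelD(1)[OF rel i(1) hJ j(2) 4(2)]
        qrelD(1)[OF rel i(2) hJ j(2) 4(2)] qrelD(3)[OF rel i(1) j(2) i(2) hJ i(3) 4(2)]
        qrelD(3)[OF rel kI j(2) i(1) hJ 4(1,2)] qrelD(3)[OF rel kI j(2) i(2) hJ ks 4(2)]
        qrelD(5)[OF rel i(1) hJ i(2) j(2) i(3) 4(2) e]])
    then show ?thesis using 4 ks e by (simp add: pivoted_def)
  next
    case 5
    have ks: "k < s" using 5 i by simp
    let ?e = "if eps i j then q - r else 0"
    have "x i j * (x s t + x s h * P * x k t) = (x s t + x s h * P * x k t) * x i j +
      sc ?e ((x i t + x i h * P * x k t) * x s j)"
      by (rule pivot_diag_outside[OF R qrelD(4)[OF rel i(1) j(1) i(2) hJ i(3) 5(3)]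
        pivot_commutes[OF i(1) j(1)] qrelD(3)[OF rel kI j(2) i(1) j(1) 5(1) j(3), symmetric]
        pivot_commutes[OF i(2) j(1), symmetric] qrelD(3)[OF rel kI j(2) i(2) j(1) ks j(3)]])
        (use 5 ks in auto)
    then show ?thesis using 5 ks by (simp add: pivoted_def)
  next
    case 6
    have [simp]: "i = k" using 6 by simp
    have nk: "\<not> eps k j" using off 6 by simp
    have "x k j * (x s t + x s h * P * x k t) = (x s t + x s h * P * x k t) * x k j"
      by (rule pivot_row_left[OF qrelD(6)[OF rel kI j(1) i(2) j(2) 6(1) j(3) nk]
        qrelD(6)[OF rel kI j(1) i(2) hJ 6(1,4) nk] left_row[OF j(1) 6(4)] qrelD(1)[OF rel kI j]])
    then show ?thesis using 6 nk by (simp add: pivoted_def)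
  next
    case 7
    have nk: "\<not> eps i j" using off 7 by simp
    have "x i j * (x s t + x s h * P * x k t) = (x s t + x s h * P * x k t) * x i j"
      by (rule pivot_outside[OF qrelD(6)[OF rel i(1) j(1) i(2) j(2) i(3) j(3) nk]
        qrelD(6)[OF rel i(1) j(1) i(2) hJ i(3) 7(4) nk] pivot_commutes[OF i(1) j(1)]
        qrelD(6)[OF rel i(1) j(1) kI j(2) 7(3) j(3) nk]]) (use 7 in auto)
    then show ?thesis using 7 nk by (simp add: pivoted_def)
  qed
qed

end

context scaled_ring
begin

text \<open>The transposed matrix, pivoted, is the transpose of the pivoted matrix, although the factors
\<open>x i h\<close> and \<open>x k j\<close> change places: they commute with each other, and moving the inverse of the
pivot past them produces the same power of \<open>q\<close> twice.\<close>

lemma pivoted_transpose: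
  assumes "pivot_step sc q I J eps x k h P" "i \<in> I" "j \<in> J"
  shows "pivoted h k P (\<lambda>j i. x i j) j i = pivoted k h P x i j"
proof (cases "k < i \<and> h < j")
  case True
  interpret pivot_step sc q I J eps x k h P by fact
  have "x k j * P * x i h = x i h * P * x k j"
    using in_row[of i] in_col[of j] True assms(2,3) qrelD(3)[OF rel kI assms(3,2) hJ]
    by (simp add: mult.assoc sc_mult_left)
  then show ?thesis using True by (simp add: pivoted_def)
qed (auto simp: pivoted_def)

text \<open>A pivot step switches on the correction term at the pivot and preserves all other relations. This is
the step of the deleting-derivations algorithm, taken in the direction in which the derivation is put
back.\<close>

theorem qrel_pivoted:
  assumes S: "pivot_step sc q I J eps x k h P"
  shows "qrel I J (\<lambda>i j. eps i j \<or> (i, j) = (k, h)) (pivoted k h P x)"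
proof -
  interpret A: pivot_step sc q I J eps x k h P by fact
  interpret B: pivot_step sc q J I "\<lambda>j i. eps i j" "\<lambda>j i. x i j" h k P
    using qrel_transpose[OF A.rel] A.kI A.hJ A.inv1 A.inv2 A.on A.off
    by unfold_locales auto
  note T = pivoted_transpose[OF S]
  let ?x = "pivoted k h P x"
  show ?thesis unfolding qrel_def
  proof (intro conjI ballI impI)
    fix i j t assume "i \<in> I" "j \<in> J" "t \<in> J" "j < t"
    then show "?x i j * ?x i t = sc q (?x i t * ?x i j)" by (rule A.row_rel)
  next
    fix i s j assume H: "i \<in> I" "s \<in> I" "j \<in> J" "i < s"
    show "?x i j * ?x s j = sc q (?x s j * ?x i j)"
      using B.row_rel[OF H(3,1,2,4)] T H by simp
  next
    fix i s j t assume H: "i \<in> I" "s \<in> I" "j \<in> J" "t \<in> J" "i < s \<and> t < j"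
    show "?x i j * ?x s t = ?x s t * ?x i j"
    proof (cases "k < i \<or> t \<le> h")
      case True then show ?thesis using A.anti_rel H by blast
    next
      case False
      then show ?thesis using B.anti_rel[of t j s i] T H by simp
    qed
  next
    fix i s j t assume H: "i \<in> I" "s \<in> I" "j \<in> J" "t \<in> J" "i < s \<and> j < t"
    have H': "i < s" "j < t" using H by auto
    show "?x i j * ?x s t = ?x s t * ?x i j +
        sc (if eps i j \<or> (i, j) = (k, h) then q - r else 0) (?x i t * ?x s j)"
    proof (cases "k < i \<or> j < h \<and> i \<le> k \<or> (i, j) = (k, h) \<or> s \<le> k \<or> t \<le> h")
      case True then show ?thesis by (rule A.diag_rel[OF H(1,2) H'(1) H(3,4) H'(2)])
    next
      case False
      have D: "?x i j * ?x s t = ?x s t * ?x i j +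
          sc (if eps i j \<or> (j, i) = (h, k) then q - r else 0) (?x s j * ?x i t)"
      proof -
        have "h < j \<or> i < k \<and> j \<le> h" using False by (cases "j = h"; cases "i = k") auto
        then have "h < j \<or> i < k \<and> j \<le> h \<or> (j, i) = (h, k) \<or> t \<le> h \<or> s \<le> k" by blast
        from B.diag_rel[OF H(3,4) H'(2) H(1,2) H'(1) this] show ?thesis using T H by simp
      qed
      have "?x s j * ?x i t = ?x i t * ?x s j"
      proof (cases "k < i \<or> j \<le> h")
        case True then show ?thesis using A.anti_rel[of i s t j] H by simp
      next
        case False
        then show ?thesis using B.anti_rel[of j t s i] T H by simp
      qed
      then show ?thesis using D by (simp add: conj_commute)
    qed
  qed
qed

end

section \<open>Quantum tori\<close>

definition pm_scale :: "'k::field \<Rightarrow> ('v \<Rightarrow>\<^sub>0 'k) \<Rightarrow> ('v \<Rightarrow>\<^sub>0 'k)" where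
  "pm_scale c p = Poly_Mapping.map ((*) c) p"

lemma lookup_pm_scale [simp]: "Poly_Mapping.lookup (pm_scale c p) k = c * Poly_Mapping.lookup p k"
  unfolding pm_scale_def by transfer (simp add: when_def)

lemma pm_scale_simps:
  "pm_scale c (x + y) = pm_scale c x + pm_scale c y" "pm_scale (c + d) x = pm_scale c x + pm_scale d x"
  "pm_scale c (pm_scale d x) = pm_scale (c * d) x" "pm_scale 1 x = x" "pm_scale c (- x) = - pm_scale c x"
  "pm_scale c 0 = 0" "pm_scale c (x - y) = pm_scale c x - pm_scale c y"
  by (rule poly_mapping_eqI; simp add: lookup_add lookup_minus algebra_simps)+

text \<open>Quantum tori are realized by linear operators on finitely supported functions. Multiplication is then
composition, so that the laws of a ring hold without computation with twisted convolutions.\<close>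

typedef (overloaded) ('v, 'k) lin_op =
  "{f :: ('v \<Rightarrow>\<^sub>0 'k::field) \<Rightarrow> ('v \<Rightarrow>\<^sub>0 'k).
    (\<forall>x y. f (x + y) = f x + f y) \<and> (\<forall>c x. f (pm_scale c x) = pm_scale c (f x))}"
  morphisms app Lin_Op
  by (rule exI[of _ "\<lambda>x. x"]) simp

setup_lifting type_definition_lin_op

instantiation lin_op :: (type, field) ring_1
begin

lift_definition zero_lin_op :: "('a, 'b) lin_op" is "\<lambda>x. 0" by (simp add: pm_scale_simps)
lift_definition one_lin_op :: "('a, 'b) lin_op" is "\<lambda>x. x" by simp
lift_definition plus_lin_op :: "('a, 'b) lin_op \<Rightarrow> ('a, 'b) lin_op \<Rightarrow> ('a, 'b) lin_op"
  is "\<lambda>f g x. f x + g x" by (simp add: pm_scale_simps)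
lift_definition minus_lin_op :: "('a, 'b) lin_op \<Rightarrow> ('a, 'b) lin_op \<Rightarrow> ('a, 'b) lin_op"
  is "\<lambda>f g x. f x - g x" by (simp add: pm_scale_simps)
lift_definition uminus_lin_op :: "('a, 'b) lin_op \<Rightarrow> ('a, 'b) lin_op"
  is "\<lambda>f x. - f x" by (simp add: pm_scale_simps)
lift_definition times_lin_op :: "('a, 'b) lin_op \<Rightarrow> ('a, 'b) lin_op \<Rightarrow> ('a, 'b) lin_op"
  is "\<lambda>f g x. f (g x)" by simp

instance
proof
  show "(0::('a, 'b) lin_op) \<noteq> 1"
  proof transfer
    have "Poly_Mapping.single undefined (1::'b) \<noteq> (0 :: 'a \<Rightarrow>\<^sub>0 'b)"
      by (metis lookup_single_eq lookup_zero zero_neq_one)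
    then show "(\<lambda>x. 0) \<noteq> (\<lambda>x::'a \<Rightarrow>\<^sub>0 'b. x)" by metis
  qed
qed (transfer; simp add: fun_eq_iff algebra_simps)+

end

lift_definition op_scale :: "'k::field \<Rightarrow> ('v, 'k) lin_op \<Rightarrow> ('v, 'k) lin_op"
  is "\<lambda>c f x. pm_scale c (f x)" by (simp add: pm_scale_simps mult.commute)

lemma scaled_ring_op_scale: "q \<noteq> 0 \<Longrightarrow> scaled_ring (op_scale :: 'k::field \<Rightarrow> ('v, 'k) lin_op \<Rightarrow> _) q"
  by unfold_locales (transfer; simp add: fun_eq_iff pm_scale_simps)+

text \<open>Translation by \<open>u\<close>, weighted by \<open>c\<close>: the basis vector at \<open>v\<close> goes to \<open>c v\<close> times the basis vector
at \<open>v + u\<close>.\<close>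

lift_definition shift_map :: "('v::ab_group_add \<Rightarrow> 'k::field) \<Rightarrow> 'v \<Rightarrow> ('v \<Rightarrow>\<^sub>0 'k) \<Rightarrow> ('v \<Rightarrow>\<^sub>0 'k)"
  is "\<lambda>c u p w. c (w - u) * p (w - u)"
proof -
  fix c :: "'v \<Rightarrow> 'k" and u :: 'v and p :: "'v \<Rightarrow> 'k"
  assume "finite {x. p x \<noteq> 0}"
  then have "finite ((\<lambda>v. v + u) ` {x. p x \<noteq> 0})" by (rule finite_imageI)
  moreover have "{w. c (w - u) * p (w - u) \<noteq> 0} \<subseteq> (\<lambda>v. v + u) ` {x. p x \<noteq> 0}"
  proof
    fix w assume "w \<in> {w. c (w - u) * p (w - u) \<noteq> 0}"
    then show "w \<in> (\<lambda>v. v + u) ` {x. p x \<noteq> 0}" by (intro image_eqI[of _ _ "w - u"]) auto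
  qed
  ultimately show "finite {w. c (w - u) * p (w - u) \<noteq> 0}" by (rule rev_finite_subset)
qed

lift_definition shift_op :: "('v::ab_group_add \<Rightarrow> 'k::field) \<Rightarrow> 'v \<Rightarrow> ('v, 'k) lin_op"
  is shift_map
proof (intro conjI allI)
  fix c :: "'v \<Rightarrow> 'k" and u :: 'v and x y :: "'v \<Rightarrow>\<^sub>0 'k" and d :: 'k
  show "shift_map c u (x + y) = shift_map c u x + shift_map c u y"
    by (rule poly_mapping_eqI) (simp add: shift_map.rep_eq lookup_add distrib_left)
  show "shift_map c u (pm_scale d x) = pm_scale d (shift_map c u x)"
    by (rule poly_mapping_eqI) (simp add: shift_map.rep_eq)
qed

text \<open>The coefficient of the monomial with exponent \<open>u\<close>: a monomial maps the basis vector at \<open>0\<close> to the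
one at its exponent.\<close>

definition coef :: "('v::zero, 'k::field) lin_op \<Rightarrow> 'v \<Rightarrow> 'k" where
  "coef t u = Poly_Mapping.lookup (app t (Poly_Mapping.single 0 1)) u"

lemma coef_simps [simp]:
  "coef 0 u = 0" "coef (x + y) u = coef x u + coef y u" "coef (x - y) u = coef x u - coef y u"
  "coef (- x) u = - coef x u" "coef (op_scale c x) u = c * coef x u"
  by (simp_all add: coef_def zero_lin_op.rep_eq plus_lin_op.rep_eq minus_lin_op.rep_eq
      uminus_lin_op.rep_eq op_scale.rep_eq lookup_add lookup_minus)

lemma coef_sum: "coef (sum f A) u = (\<Sum>a\<in>A. coef (f a) u)"
  by (induction A rule: infinite_finite_induct) simp_all

text \<open>The exponents form a linearly ordered group, so that elements have leading terms. A bicharacter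
\<open>chi\<close> is exactly what makes the operators \<open>M u\<close> below multiply like monomials.\<close>

locale quantum_torus =
  fixes chi :: "'v::linordered_ab_group_add \<Rightarrow> 'v \<Rightarrow> 'k::field"
  assumes chi_add_left: "chi (u + v) w = chi u w * chi v w"
    and chi_add_right: "chi w (u + v) = chi w u * chi w v"
    and chi_nz: "chi u v \<noteq> 0"
begin

(* A torus with arbitrary chi has no distinguished scalar; the laws of the action are those for every
   value of the parameter. *)
sublocale scaled_ring "op_scale :: 'k \<Rightarrow> ('v, 'k) lin_op \<Rightarrow> _" 1
  by (rule scaled_ring_op_scale) simp

abbreviation sc :: "'k \<Rightarrow> ('v, 'k) lin_op \<Rightarrow> ('v, 'k) lin_op" where "sc \<equiv> op_scale"

definition M :: "'v \<Rightarrow> ('v, 'k) lin_op" where "M u = shift_op (chi u) u"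

lemma chi_0 [simp]: "chi 0 v = 1" "chi v 0 = 1"
  using chi_add_left[of 0 0 v] chi_add_right[of v 0 0] chi_nz[of 0 v] chi_nz[of v 0] by simp_all

lemma app_M: "Poly_Mapping.lookup (app (M u) p) w = chi u (w - u) * Poly_Mapping.lookup p (w - u)"
  by (simp add: M_def shift_op.rep_eq shift_map.rep_eq)

lemma lin_op_eqI: "(\<And>p w. Poly_Mapping.lookup (app x p) w = Poly_Mapping.lookup (app y p) w) \<Longrightarrow> x = y"
  by (metis app_inject ext poly_mapping_eqI)

lemma M_mult: "M u * M v = sc (chi u v) (M (u + v))"
proof (rule lin_op_eqI)
  fix p w
  have "chi u (w - u) = chi u (w - (u + v)) * chi u v"
    using chi_add_right[of u "w - (u + v)" v] by (simp add: algebra_simps)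
  then show "Poly_Mapping.lookup (app (M u * M v) p) w = Poly_Mapping.lookup (app (sc (chi u v) (M (u + v))) p) w"
    by (simp add: times_lin_op.rep_eq op_scale.rep_eq app_M chi_add_left diff_diff_eq mult_ac)
qed

lemma M_0 [simp]: "M 0 = 1"
  by (rule lin_op_eqI) (simp add: app_M one_lin_op.rep_eq)

lemma coef_M: "coef (M u) w = (if w = u then 1 else 0)"
  by (auto simp: coef_def app_M lookup_one when_def)

definition torus :: "'v set \<Rightarrow> ('v, 'k) lin_op set" where
  "torus U = {\<Sum>u\<in>A. sc (c u) (M u) | A c. finite A \<and> A \<subseteq> U}"

definition supp :: "('v, 'k) lin_op \<Rightarrow> 'v set" where "supp t = {u. coef t u \<noteq> 0}"

lemma coef_expansion: "finite A \<Longrightarrow> coef (\<Sum>u\<in>A. sc (c u) (M u)) w = (if w \<in> A then c w else 0)"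
proof -
  assume "finite A"
  have "coef (\<Sum>u\<in>A. sc (c u) (M u)) w = (\<Sum>u\<in>A. if u = w then c u else 0)"
    unfolding coef_sum by (rule sum.cong) (simp_all add: coef_M)
  then show ?thesis using \<open>finite A\<close> by simp
qed

lemma torus_expansion:
  assumes "t \<in> torus U"
  shows "finite (supp t)" "supp t \<subseteq> U" "t = (\<Sum>u\<in>supp t. sc (coef t u) (M u))"
proof -
  obtain A c where A: "finite A" "A \<subseteq> U" "t = (\<Sum>u\<in>A. sc (c u) (M u))"
    using assms unfolding torus_def by blast
  have cf: "coef t w = (if w \<in> A then c w else 0)" for w unfolding A(3) by (rule coef_expansion[OF A(1)])
  have s: "supp t = {u \<in> A. c u \<noteq> 0}" unfolding supp_def cf by auto
  show "finite (supp t)" unfolding s using A(1) by simp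
  show "supp t \<subseteq> U" unfolding s using A(2) by auto
  have "(\<Sum>u\<in>supp t. sc (coef t u) (M u)) = (\<Sum>u\<in>A. sc (c u) (M u))"
    unfolding s by (rule sum.mono_neutral_cong_left[OF A(1)]) (auto simp: cf)
  then show "t = (\<Sum>u\<in>supp t. sc (coef t u) (M u))" using A(3) by simp
qed

lemma torus_sumI: "finite A \<Longrightarrow> A \<subseteq> U \<Longrightarrow> (\<Sum>u\<in>A. sc (c u) (M u)) \<in> torus U"
  unfolding torus_def by blast

lemma torus_M: "u \<in> U \<Longrightarrow> sc c (M u) \<in> torus U" "u \<in> U \<Longrightarrow> M u \<in> torus U"
  using torus_sumI[of "{u}" U "\<lambda>_. c"] torus_sumI[of "{u}" U "\<lambda>_. 1"] by simp_all

lemma torus_0 [simp]: "0 \<in> torus U"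
  using torus_sumI[of "{}" U] by simp

lemma torus_add: "x \<in> torus U \<Longrightarrow> y \<in> torus U \<Longrightarrow> x + y \<in> torus U"
proof -
  assume x: "x \<in> torus U" and y: "y \<in> torus U"
  let ?A = "supp x \<union> supp y"
  note X = torus_expansion[OF x] and Y = torus_expansion[OF y]
  have fin: "finite ?A" using X(1) Y(1) by simp
  have "x = (\<Sum>u\<in>?A. sc (coef x u) (M u))"
    by (subst X(3), rule sum.mono_neutral_left[OF fin]) (auto simp: supp_def)
  moreover have "y = (\<Sum>u\<in>?A. sc (coef y u) (M u))"
    by (subst Y(3), rule sum.mono_neutral_left[OF fin]) (auto simp: supp_def)
  ultimately have "x + y = (\<Sum>u\<in>?A. sc (coef x u + coef y u) (M u))"
    by (simp only: sc_add_left sum.distrib)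
  then show "x + y \<in> torus U" using torus_sumI[OF fin] X(2) Y(2) by simp
qed

lemma torus_sum: "(\<And>a. a \<in> A \<Longrightarrow> f a \<in> torus U) \<Longrightarrow> sum f A \<in> torus U"
  by (induction A rule: infinite_finite_induct) (simp_all add: torus_add)

lemma torus_sc: assumes x: "x \<in> torus U" shows "sc c x \<in> torus U"
proof -
  note X = torus_expansion[OF x]
  have "sc c (\<Sum>u\<in>B. sc (coef x u) (M u)) = (\<Sum>u\<in>B. sc (c * coef x u) (M u))" for B
    by (induction B rule: infinite_finite_induct) (simp_all add: sc_add_right sc_sc)
  then have "sc c x = (\<Sum>u\<in>supp x. sc (c * coef x u) (M u))" using X(3) by metis
  then show ?thesis using torus_sumI[OF X(1,2)] by simp
qed

lemma torus_minus: "x \<in> torus U \<Longrightarrow> y \<in> torus U \<Longrightarrow> x - y \<in> torus U"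
  using torus_add[of x U "- y"] torus_sc[of y U "-1"] by simp

lemma torus_mono: "U \<subseteq> V \<Longrightarrow> torus U \<subseteq> torus V"
  unfolding torus_def by blast

lemma torus_subsetI: "t \<in> torus UNIV \<Longrightarrow> supp t \<subseteq> U \<Longrightarrow> t \<in> torus U"
  using torus_expansion[of t UNIV] torus_sumI[of "supp t" U "coef t"] by simp

lemma torus_mult_expansion:
  assumes "x \<in> torus U" "y \<in> torus V"
  shows "x * y = (\<Sum>u\<in>supp x. \<Sum>v\<in>supp y. sc (coef x u * coef y v * chi u v) (M (u + v)))"
proof -
  have "x * y = (\<Sum>u\<in>supp x. sc (coef x u) (M u)) * (\<Sum>v\<in>supp y. sc (coef y v) (M v))"
    using torus_expansion(3)[OF assms(1)] torus_expansion(3)[OF assms(2)] by simp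
  also have "\<dots> = (\<Sum>u\<in>supp x. \<Sum>v\<in>supp y. sc (coef x u) (M u) * sc (coef y v) (M v))"
    by (rule sum_product)
  also have "\<dots> = (\<Sum>u\<in>supp x. \<Sum>v\<in>supp y. sc (coef x u * coef y v * chi u v) (M (u + v)))"
    by (simp only: sc_mult_left sc_mult_right M_mult sc_sc) (simp only: mult_ac)
  finally show ?thesis .
qed

lemma torus_mult:
  assumes "x \<in> torus U" "y \<in> torus V" "\<And>u v. u \<in> U \<Longrightarrow> v \<in> V \<Longrightarrow> u + v \<in> W"
  shows "x * y \<in> torus W"
  unfolding torus_mult_expansion[OF assms(1,2)]
  by (intro torus_sum torus_M assms(3)) (use torus_expansion(2)[OF assms(1)] torus_expansion(2)[OF assms(2)] in blast)+

lemma coef_mult: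
  assumes "x \<in> torus U" "y \<in> torus V"
  shows "coef (x * y) w = (\<Sum>u\<in>supp x. \<Sum>v\<in>supp y. if u + v = w then coef x u * coef y v * chi u v else 0)"
  unfolding torus_mult_expansion[OF assms] coef_sum
  by (intro sum.cong refl) (simp add: coef_M)

definition leads :: "('v, 'k) lin_op \<Rightarrow> 'v \<Rightarrow> bool" where
  "leads t u \<longleftrightarrow> t \<in> torus UNIV \<and> u \<in> supp t \<and> (\<forall>w\<in>supp t. w \<le> u)"

lemma leads_nonzero: "leads t u \<Longrightarrow> t \<noteq> 0"
  by (auto simp: leads_def supp_def)

lemma leads_exists:
  assumes "t \<in> torus U" "t \<noteq> 0"
  shows "\<exists>u. leads t u"
proof -
  have t: "t \<in> torus UNIV" using assms(1) torus_mono[of U UNIV] by blast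
  have ne: "supp t \<noteq> {}" using torus_expansion(3)[OF t] assms(2) by auto
  have fin: "finite (supp t)" by (rule torus_expansion(1)[OF t])
  have "leads t (Max (supp t))" unfolding leads_def using t Max_in[OF fin ne] Max_ge[OF fin] by simp
  then show ?thesis by blast
qed

lemma leads_M: "leads (M u) u"
  unfolding leads_def using torus_M(2)[of u UNIV] by (simp add: supp_def coef_M)

text \<open>In an ordered group a sum of two exponents attains the maximum only in one way, and its coefficient
is a product of nonzero scalars.\<close>

lemma leads_mult:
  assumes "leads x u" "leads y v"
  shows "leads (x * y) (u + v)"
proof -
  have x: "x \<in> torus UNIV" "u \<in> supp x" "\<And>w. w \<in> supp x \<Longrightarrow> w \<le> u"
    and y: "y \<in> torus UNIV" "v \<in> supp y" "\<And>w. w \<in> supp y \<Longrightarrow> w \<le> v"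
    using assms by (simp_all add: leads_def)
  have fx: "finite (supp x)" "finite (supp y)" using torus_expansion(1) x(1) y(1) by blast+
  have "coef (x * y) (u + v) = (\<Sum>u'\<in>supp x. \<Sum>v'\<in>supp y.
      if u' = u then (if v' = v then coef x u * coef y v * chi u v else 0) else 0)"
    unfolding coef_mult[OF x(1) y(1)]
  proof (intro sum.cong refl)
    fix u' v' assume "u' \<in> supp x" "v' \<in> supp y"
    then have le: "u' \<le> u" "v' \<le> v" using x(3) y(3) by simp_all
    have "u' + v' = u + v \<longleftrightarrow> u' = u \<and> v' = v"
    proof
      assume e: "u' + v' = u + v"
      have "u' = u"
      proof (rule ccontr)
        assume "u' \<noteq> u"
        then have "u' + v' < u + v" using le by (intro add_less_le_mono) simp_all
        then show False using e by simp
      qed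
      then show "u' = u \<and> v' = v" using e by simp
    qed simp
    then show "(if u' + v' = u + v then coef x u' * coef y v' * chi u' v' else 0) =
        (if u' = u then if v' = v then coef x u * coef y v * chi u v else 0 else 0)" by simp
  qed
  also have "\<dots> = coef x u * coef y v * chi u v"
  proof -
    have "(\<Sum>v'\<in>supp y. if u' = u then (if v' = v then coef x u * coef y v * chi u v else 0) else 0) =
      (if u' = u then coef x u * coef y v * chi u v else 0)" for u'
      using fx y(2) by simp
    then show ?thesis using fx x(2) by simp
  qed
  finally have c: "coef (x * y) (u + v) \<noteq> 0" using x(2) y(2) chi_nz by (simp add: supp_def)
  have b: "w \<le> u + v" if "w \<in> supp (x * y)" for w
  proof -
    have "\<exists>u'\<in>supp x. \<exists>v'\<in>supp y. u' + v' = w"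
    proof (rule ccontr)
      assume "\<not> (\<exists>u'\<in>supp x. \<exists>v'\<in>supp y. u' + v' = w)"
      then have "coef (x * y) w = 0"
        unfolding coef_mult[OF x(1) y(1)] by (intro sum.neutral ballI) simp
      then show False using that by (simp add: supp_def)
    qed
    then obtain u' v' where "u' \<in> supp x" "v' \<in> supp y" "u' + v' = w" by (elim bexE)
    then show ?thesis using add_mono[OF x(3) y(3), of u' v'] by simp
  qed
  have "x * y \<in> torus UNIV" by (rule torus_mult[OF x(1) y(1)]) simp
  then show ?thesis unfolding leads_def using b c by (simp add: supp_def)
qed

lemma torus_domain:
  assumes "x \<in> torus U" "y \<in> torus V" "x * y = 0"
  shows "x = 0 \<or> y = 0"
proof (rule ccontr)
  assume "\<not> (x = 0 \<or> y = 0)"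
  then obtain u v where "leads x u" "leads y v"
    using leads_exists[OF assms(1)] leads_exists[OF assms(2)] by auto
  then show False using leads_nonzero[OF leads_mult] assms(3) by simp
qed

lemma leads_sc: "c \<noteq> 0 \<Longrightarrow> leads t u \<Longrightarrow> leads (sc c t) u"
  unfolding leads_def using torus_sc by (simp add: supp_def)

lemma leads_add:
  assumes "leads x u" "y \<in> torus UNIV" "\<And>w. w \<in> supp y \<Longrightarrow> w < u"
  shows "leads (x + y) u"
proof -
  have "coef y u = 0" using assms(3)[of u] by (auto simp: supp_def)
  moreover have "w \<le> u" if "coef x w + coef y w \<noteq> 0" for w
  proof (cases "coef x w = 0")
    case True
    then have "w \<in> supp y" using that by (simp add: supp_def)
    then show ?thesis using assms(3) by (simp add: less_imp_le)
  qed (use assms(1) in \<open>simp add: leads_def supp_def\<close>)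
  ultimately show ?thesis using assms(1,2) torus_add[of x UNIV y] unfolding leads_def by (simp add: supp_def)
qed

end

section \<open>Subalgebras of a quantum torus and their rank over the centre\<close>

context quantum_torus
begin

lemma supp_M: "supp (M v) = {v}"
  by (auto simp: supp_def coef_M)

lemma coef_mult_M:
  assumes "t \<in> torus UNIV"
  shows "coef (t * M v) (w + v) = coef t w * chi w v" "coef (M v * t) (w + v) = coef t w * chi v w"
proof -
  have Mv: "M v \<in> torus UNIV" by (rule torus_M(2)) simp
  have fin: "finite (supp t)" by (rule torus_expansion(1)[OF assms])
  have z: "w \<notin> supp t \<Longrightarrow> coef t w = 0" by (simp add: supp_def)
  have "coef (t * M v) (w + v) = (\<Sum>u\<in>supp t. if u = w then coef t w * chi w v else 0)"
    unfolding coef_mult[OF assms Mv] supp_M by (rule sum.cong) (simp_all add: coef_M)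
  also have "\<dots> = coef t w * chi w v" using fin z by simp
  finally show "coef (t * M v) (w + v) = coef t w * chi w v" .
  have "coef (M v * t) (w + v) =
      (\<Sum>u\<in>{v}. \<Sum>v'\<in>supp t. if u + v' = w + v then coef (M v) u * coef t v' * chi u v' else 0)"
    using coef_mult[OF Mv assms, of "w + v"] unfolding supp_M .
  also have "\<dots> = (\<Sum>v'\<in>supp t. if v + v' = w + v then coef (M v) v * coef t v' * chi v v' else 0)"
    by simp
  also have "\<dots> = (\<Sum>u\<in>supp t. if u = w then coef t w * chi v w else 0)"
    by (rule sum.cong) (simp_all add: coef_M add.commute[of w v])
  also have "\<dots> = coef t w * chi v w" using fin z by simp
  finally show "coef (M v * t) (w + v) = coef t w * chi v w" .
qed

lemma commutes_with_M:
  assumes "t \<in> torus UNIV" "t * M v = M v * t" "w \<in> supp t"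
  shows "chi w v = chi v w"
proof -
  have "coef t w * chi w v = coef t w * chi v w"
    unfolding coef_mult_M[OF assms(1), symmetric] assms(2) by (rule refl)
  then show ?thesis using assms(3) by (simp add: supp_def)
qed

lemma torus_commute:
  assumes "x \<in> torus U" "y \<in> torus V" "\<And>u v. u \<in> U \<Longrightarrow> v \<in> V \<Longrightarrow> chi u v = chi v u"
  shows "x * y = y * x"
proof -
  have "x * y = (\<Sum>u\<in>supp x. \<Sum>v\<in>supp y. sc (coef y v * coef x u * chi v u) (M (v + u)))"
    unfolding torus_mult_expansion[OF assms(1,2)]
  proof (intro sum.cong refl)
    fix u v assume "u \<in> supp x" "v \<in> supp y"
    then have "chi u v = chi v u"
      using assms(3) torus_expansion(2)[OF assms(1)] torus_expansion(2)[OF assms(2)] by blast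
    then show "sc (coef x u * coef y v * chi u v) (M (u + v)) = sc (coef y v * coef x u * chi v u) (M (v + u))"
      by (simp add: add.commute mult.commute)
  qed
  also have "\<dots> = y * x"
    unfolding torus_mult_expansion[OF assms(2,1)] by (rule sum.swap)
  finally show ?thesis .
qed

lemma M_inverse:
  "M u * sc (inverse (chi u (- u))) (M (- u)) = 1" "sc (inverse (chi u (- u))) (M (- u)) * M u = 1"
proof -
  have "chi u (- u) = chi (- u) u"
  proof -
    have "chi u (- u) * chi u u = chi (- u) u * chi u u"
      using chi_add_right[of u "- u" u] chi_add_left[of "- u" u u] by simp
    then show ?thesis using chi_nz[of u u] by simp
  qed
  then show "M u * sc (inverse (chi u (- u))) (M (- u)) = 1" "sc (inverse (chi u (- u))) (M (- u)) * M u = 1"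
    using chi_nz[of u "- u"] by (simp_all add: sc_mult_right sc_mult_left M_mult sc_sc)
qed

text \<open>Exponents whose monomials commute with all monomials with exponents in \<open>U\<close>; they span the centre of
\<open>torus U\<close>.\<close>

definition rad :: "'v set \<Rightarrow> 'v set" where
  "rad U = {u \<in> U. \<forall>v\<in>U. chi u v = chi v u}"

lemma rad_central: "z \<in> torus (rad U) \<Longrightarrow> t \<in> torus U \<Longrightarrow> z * t = t * z"
  by (rule torus_commute[of z "rad U" t U]) (simp_all add: rad_def)

lemma rad_torus: "z \<in> torus (rad U) \<Longrightarrow> z \<in> torus U"
  using torus_mono[of "rad U" U] by (auto simp: rad_def)

definition nmul :: "nat \<Rightarrow> 'v \<Rightarrow> 'v" where "nmul n u = (\<Sum>i<n. u)"

lemma nmul_simps: "nmul 0 u = 0" "nmul (Suc n) u = u + nmul n u"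
  by (simp_all add: nmul_def add.commute)

lemma chi_nmul: "chi (nmul n u) v = chi u v ^ n" "chi v (nmul n u) = chi v u ^ n"
  by (induction n) (simp_all add: nmul_simps chi_add_left chi_add_right)

lemma M_power: "\<exists>c. c \<noteq> 0 \<and> M u ^ n = sc c (M (nmul n u))"
proof (induction n)
  case 0
  show ?case by (rule exI[of _ 1]) (simp add: nmul_simps)
next
  case (Suc n)
  then obtain c where c: "c \<noteq> 0" "M u ^ n = sc c (M (nmul n u))" by blast
  have "M u ^ Suc n = sc (c * chi u (nmul n u)) (M (nmul (Suc n) u))"
    by (simp add: c(2) sc_mult_right M_mult sc_sc nmul_simps)
  then show ?case using c(1) chi_nz by (intro exI[of _ "c * chi u (nmul n u)"]) simp
qed

end

text \<open>A subalgebra \<open>A\<close> of a quantum torus on a group \<open>U\<close> of exponents, in which all commutation factors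
are \<open>l\<close>-th roots of unity.\<close>

locale torus_subalgebra = quantum_torus chi for chi :: "'v::linordered_ab_group_add \<Rightarrow> 'v \<Rightarrow> 'k::field" +
  fixes U :: "'v set" and A :: "('v, 'k) lin_op set" and l :: nat
  assumes U_0: "0 \<in> U" and U_add: "u \<in> U \<Longrightarrow> v \<in> U \<Longrightarrow> u + v \<in> U" and U_neg: "u \<in> U \<Longrightarrow> - u \<in> U"
    and A_torus: "a \<in> A \<Longrightarrow> a \<in> torus U"
    and A_scalar: "sc c 1 \<in> A"
    and A_add: "a \<in> A \<Longrightarrow> b \<in> A \<Longrightarrow> a + b \<in> A"
    and A_mult: "a \<in> A \<Longrightarrow> b \<in> A \<Longrightarrow> a * b \<in> A"
    and l_pos: "l > 0" and chi_l: "u \<in> U \<Longrightarrow> v \<in> U \<Longrightarrow> chi u v ^ l = 1"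
begin

lemma A_sc: "a \<in> A \<Longrightarrow> sc c a \<in> A"
  using A_mult[OF A_scalar[of c]] by (simp add: sc_mult_left)

lemma U_torus_mult: "x \<in> torus U \<Longrightarrow> y \<in> torus U \<Longrightarrow> x * y \<in> torus U"
  by (rule torus_mult) (use U_add in blast)+

lemma rad_closed: "0 \<in> rad U" "u \<in> rad U \<Longrightarrow> v \<in> rad U \<Longrightarrow> u + v \<in> rad U" "u \<in> rad U \<Longrightarrow> - u \<in> rad U"
proof -
  show "0 \<in> rad U" by (simp add: rad_def U_0)
  show "u \<in> rad U \<Longrightarrow> v \<in> rad U \<Longrightarrow> u + v \<in> rad U"
    by (simp add: rad_def U_add chi_add_left chi_add_right)
  assume u: "u \<in> rad U"
  have "chi (- u) v = chi v (- u)" if v: "v \<in> U" for v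
  proof -
    have e: "chi u v = chi v u" using u v by (simp add: rad_def)
    have "chi (- u) v * chi u v = chi v (- u) * chi v u"
      using chi_add_left[of "- u" u v] chi_add_right[of v "- u" u] by simp
    then show ?thesis using e chi_nz[of v u] by simp
  qed
  then show "- u \<in> rad U" using u U_neg by (simp add: rad_def)
qed

lemma rad_torus_mult: "x \<in> torus (rad U) \<Longrightarrow> y \<in> torus (rad U) \<Longrightarrow> x * y \<in> torus (rad U)"
  by (rule torus_mult) (use rad_closed(2) in blast)+

text \<open>The elements of the torus that are fractions of elements of \<open>A\<close> with denominators in \<open>A\<close> that are
central in the torus. They form an algebra; the aim is to show that it is the whole torus.\<close>

definition D :: "('v, 'k) lin_op set" where
  "D = {t \<in> torus U. \<exists>z\<in>A. z \<in> torus (rad U) \<and> z \<noteq> 0 \<and> z * t \<in> A}"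

lemma D_I: "t \<in> torus U \<Longrightarrow> z \<in> A \<Longrightarrow> z \<in> torus (rad U) \<Longrightarrow> z \<noteq> 0 \<Longrightarrow> z * t \<in> A \<Longrightarrow> t \<in> D"
  unfolding D_def by blast

lemma D_E:
  assumes "t \<in> D"
  obtains z where "t \<in> torus U" "z \<in> A" "z \<in> torus (rad U)" "z \<noteq> 0" "z * t \<in> A"
  using assms unfolding D_def by blast

lemma one_central: "1 \<in> torus (rad U)"
  using torus_M(2)[OF rad_closed(1)] by simp

lemma A_D: "a \<in> A \<Longrightarrow> a \<in> D"
  by (rule D_I[of a 1]) (use A_torus A_scalar[of 1] one_central in simp_all)

lemma D_add:
  assumes "s \<in> D" "t \<in> D"
  shows "s + t \<in> D"
proof -
  obtain z where z: "s \<in> torus U" "z \<in> A" "z \<in> torus (rad U)" "z \<noteq> 0" "z * s \<in> A" using assms(1) by (rule D_E)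
  obtain w where w: "t \<in> torus U" "w \<in> A" "w \<in> torus (rad U)" "w \<noteq> 0" "w * t \<in> A" using assms(2) by (rule D_E)
  show ?thesis
  proof (rule D_I)
    show "s + t \<in> torus U" by (rule torus_add[OF z(1) w(1)])
    show "z * w \<in> A" by (rule A_mult[OF z(2) w(2)])
    show "z * w \<in> torus (rad U)" by (rule rad_torus_mult[OF z(3) w(3)])
    show "z * w \<noteq> 0" using torus_domain[OF z(3) w(3)] z(4) w(4) by blast
    have "z * w * (s + t) = w * (z * s) + z * (w * t)"
      by (simp only: rad_central[OF z(3) rad_torus[OF w(3)]] distrib_left mult.assoc)
        (simp only: mult.assoc[symmetric] rad_central[OF z(3) rad_torus[OF w(3)]])
    then show "z * w * (s + t) \<in> A" using A_add[OF A_mult[OF w(2) z(5)] A_mult[OF z(2) w(5)]] by simp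
  qed
qed

lemma D_mult:
  assumes "s \<in> D" "t \<in> D"
  shows "s * t \<in> D"
proof -
  obtain z where z: "s \<in> torus U" "z \<in> A" "z \<in> torus (rad U)" "z \<noteq> 0" "z * s \<in> A" using assms(1) by (rule D_E)
  obtain w where w: "t \<in> torus U" "w \<in> A" "w \<in> torus (rad U)" "w \<noteq> 0" "w * t \<in> A" using assms(2) by (rule D_E)
  show ?thesis
  proof (rule D_I)
    show "s * t \<in> torus U" by (rule U_torus_mult[OF z(1) w(1)])
    show "z * w \<in> A" by (rule A_mult[OF z(2) w(2)])
    show "z * w \<in> torus (rad U)" by (rule rad_torus_mult[OF z(3) w(3)])
    show "z * w \<noteq> 0" using torus_domain[OF z(3) w(3)] z(4) w(4) by blast
    have "z * w * (s * t) = z * (w * s) * t" by (simp only: mult.assoc)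
    also have "\<dots> = (z * s) * (w * t)" by (simp only: rad_central[OF w(3) z(1)] mult.assoc)
    finally show "z * w * (s * t) \<in> A" using A_mult[OF z(5) w(5)] by simp
  qed
qed

lemma D_sc: "t \<in> D \<Longrightarrow> sc c t \<in> D"
  using D_mult[OF A_D[OF A_scalar[of c]]] by (simp add: sc_mult_left)

lemma D_minus: "s \<in> D \<Longrightarrow> t \<in> D \<Longrightarrow> s - t \<in> D"
  using D_add[of s "- t"] D_sc[of t "- 1"] by simp

lemma D_sum: "(\<And>a. a \<in> B \<Longrightarrow> f a \<in> D) \<Longrightarrow> sum f B \<in> D"
  by (induction B rule: infinite_finite_induct) (use A_D[OF A_scalar[of 0]] D_add in simp_all)

lemma D_power: "t \<in> D \<Longrightarrow> t ^ n \<in> D"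
  by (induction n) (use A_D[OF A_scalar[of 1]] D_mult in simp_all)

lemma D_M_add: "M u \<in> D \<Longrightarrow> M v \<in> D \<Longrightarrow> M (u + v) \<in> D"
proof -
  assume "M u \<in> D" "M v \<in> D"
  then have "sc (inverse (chi u v)) (M u * M v) \<in> D" by (intro D_sc D_mult)
  then show ?thesis using chi_nz[of u v] by (simp add: M_mult sc_sc)
qed

text \<open>The reason why \<open>A\<close> reaches inverses of monomials. The exponent \<open>w = l * u\<close> is in the radical, so if a
central \<open>z\<close> multiplies \<open>M w\<close> into \<open>A\<close>, then \<open>z * M w\<close> is a central element of \<open>A\<close> too, and it
multiplies \<open>M (- w)\<close> into \<open>A\<close>. Now \<open>- u = (l - 1) * u - w\<close>.\<close>

lemma D_M_neg:
  assumes u: "u \<in> U" and Mu: "M u \<in> D"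
  shows "M (- u) \<in> D"
proof -
  have Mn: "M (nmul n u) \<in> D" for n
  proof -
    obtain c where "c \<noteq> 0" "M u ^ n = sc c (M (nmul n u))" using M_power by blast
    then have "sc (inverse c) (M u ^ n) = M (nmul n u)" by (simp add: sc_sc)
    then show ?thesis using D_sc[OF D_power[OF Mu]] by metis
  qed
  \<comment> \<open>\<open>l * u\<close> is in the radical because \<open>chi (l * u) v = chi u v ^ l = 1\<close>\<close>
  define w where "w = nmul l u"
  have nU: "nmul n u \<in> U" for n by (induction n) (simp_all add: nmul_simps U_0 u U_add)
  have wr: "w \<in> rad U" unfolding rad_def w_def using nU chi_l[OF u] chi_l[OF _ u] by (simp add: chi_nmul)
  have "M w \<in> D" unfolding w_def by (rule Mn)
  then obtain z where z: "M w \<in> torus U" "z \<in> A" "z \<in> torus (rad U)" "z \<noteq> 0" "z * M w \<in> A" by (rule D_E)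
  have Mw: "M w \<in> torus (rad U)" by (rule torus_M(2)[OF wr])
  have "M (- w) \<in> D"
  proof (rule D_I)
    show "M (- w) \<in> torus U" by (rule rad_torus[OF torus_M(2)[OF rad_closed(3)[OF wr]]])
    show "z * M w \<in> A" by (rule z(5))
    show "z * M w \<in> torus (rad U)" by (rule rad_torus_mult[OF z(3) Mw])
    show "z * M w \<noteq> 0" using torus_domain[OF z(3) Mw] z(4) leads_nonzero[OF leads_M[of w]] by blast
    have "z * M w * M (- w) = sc (chi w (- w)) z" by (simp add: mult.assoc M_mult sc_mult_right)
    then show "z * M w * M (- w) \<in> A" using A_sc[OF z(2)] by simp
  qed
  then have "M (nmul (l - 1) u + - w) \<in> D" by (rule D_M_add[OF Mn])
  moreover have "nmul (l - 1) u + - w = - u"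
    using nmul_simps(2)[of "l - 1" u] l_pos by (simp add: w_def)
  ultimately show ?thesis by simp
qed

lemma torus_D: "(\<And>u. u \<in> U \<Longrightarrow> M u \<in> D) \<Longrightarrow> t \<in> torus U \<Longrightarrow> t \<in> D"
proof -
  assume H: "\<And>u. u \<in> U \<Longrightarrow> M u \<in> D" and t: "t \<in> torus U"
  have "(\<Sum>u\<in>supp t. sc (coef t u) (M u)) \<in> D"
    by (rule D_sum, rule D_sc, rule H, rule subsetD[OF torus_expansion(2)[OF t]])
  then show "t \<in> D" using torus_expansion(3)[OF t] by simp
qed

text \<open>Commuting with \<open>A\<close> implies commuting with all monomials, as these are central fractions of elements
of \<open>A\<close> and central elements can be cancelled. An element commuting with monomials has only
exponents whose monomials do so, because multiplication by a monomial permutes the monomials up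
to scalars.\<close>

lemma centralizer_in_rad:
  assumes gen: "\<And>u. u \<in> U \<Longrightarrow> M u \<in> D" and t: "t \<in> torus U" and comm: "\<And>a. a \<in> A \<Longrightarrow> t * a = a * t"
  shows "t \<in> torus (rad U)"
proof (rule torus_subsetI)
  show tU: "t \<in> torus UNIV" using torus_mono[of U UNIV] t by blast
  have cM: "t * M v = M v * t" if v: "v \<in> U" for v
  proof -
    obtain z where z: "M v \<in> torus U" "z \<in> A" "z \<in> torus (rad U)" "z \<noteq> 0" "z * M v \<in> A"
      using gen[OF v] by (rule D_E)
    have "z * (t * M v) = t * (z * M v)"
      by (simp only: mult.assoc[symmetric] rad_central[OF z(3) t])
    also have "\<dots> = z * (M v * t)" by (simp only: comm[OF z(5)] mult.assoc)
    finally have "z * (t * M v - M v * t) = 0" by (simp add: right_diff_distrib)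
    moreover have "t * M v - M v * t \<in> torus U"
      by (rule torus_minus[OF U_torus_mult[OF t z(1)] U_torus_mult[OF z(1) t]])
    ultimately show ?thesis using torus_domain[OF z(3)] z(4) by fastforce
  qed
  show "supp t \<subseteq> rad U"
  proof
    fix w assume w: "w \<in> supp t"
    have "w \<in> U" using torus_expansion(2)[OF t] w by blast
    moreover have "chi w v = chi v w" if "v \<in> U" for v by (rule commutes_with_M[OF tU cM[OF that] w])
    ultimately show "w \<in> rad U" by (simp add: rad_def)
  qed
qed

text \<open>Multiplying a central element by \<open>M v\<close> moves its exponents into the coset of \<open>v\<close> modulo the radical,
so for representatives of distinct cosets nothing cancels.\<close>

lemma rank_independent:
  assumes V: "finite V" "V \<subseteq> U" "\<And>v v'. v \<in> V \<Longrightarrow> v' \<in> V \<Longrightarrow> v' - v \<in> rad U \<Longrightarrow> v = v'"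
    and z: "\<And>v. v \<in> V \<Longrightarrow> z v \<in> torus (rad U)" and sum0: "(\<Sum>v\<in>V. z v * M v) = 0" and v: "v \<in> V"
  shows "z v = 0"
proof (rule ccontr)
  assume nz: "z v \<noteq> 0"
  have tU: "z v' \<in> torus UNIV" if "v' \<in> V" for v' using torus_mono[of "rad U" UNIV] z[OF that] by blast
  obtain w where w: "w \<in> supp (z v)" using leads_exists[OF z[OF v] nz] by (auto simp: leads_def)
  have wr: "w \<in> rad U" using torus_expansion(2)[OF z[OF v]] w by blast
  have "coef (z v' * M v') (w + v) = 0" if v': "v' \<in> V" "v' \<noteq> v" for v'
  proof (rule ccontr)
    have e: "coef (z v' * M v') (w + v) = coef (z v') (w + v - v') * chi (w + v - v') v'"
      using coef_mult_M(1)[OF tU[OF v'(1)], of v' "w + v - v'"] by simp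
    assume "coef (z v' * M v') (w + v) \<noteq> 0"
    then have "w + v - v' \<in> supp (z v')" unfolding e by (simp add: supp_def)
    then have "w + v - v' \<in> rad U" using torus_expansion(2)[OF z[OF v'(1)]] by blast
    then have "(w + v - v') + - w \<in> rad U" by (rule rad_closed(2)[OF _ rad_closed(3)[OF wr]])
    moreover have "(w + v - v') + - w = v - v'" by simp
    ultimately show False using V(3)[OF v'(1) v] v'(2) by simp
  qed
  then have "(\<Sum>v'\<in>V - {v}. coef (z v' * M v') (w + v)) = 0" by (intro sum.neutral) simp
  then have "coef (\<Sum>v\<in>V. z v * M v) (w + v) = coef (z v * M v) (w + v)"
    unfolding coef_sum by (simp add: sum.remove[OF V(1) v])
  also have "\<dots> = coef (z v) w * chi w v" by (rule coef_mult_M(1)[OF tU[OF v]])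
  finally show False using sum0 w chi_nz[of w v] by (simp add: supp_def)
qed

text \<open>A monomial is a central one times the monomial of the representative of its coset.\<close>

lemma rank_span:
  assumes V: "finite V" "V \<subseteq> U" "\<And>u. u \<in> U \<Longrightarrow> \<exists>v\<in>V. u - v \<in> rad U" and t: "t \<in> torus U"
  shows "\<exists>z. (\<forall>v\<in>V. z v \<in> torus (rad U)) \<and> t = (\<Sum>v\<in>V. z v * M v)"
proof -
  let ?P = "\<lambda>t. \<exists>z. (\<forall>v\<in>V. z v \<in> torus (rad U)) \<and> t = (\<Sum>v\<in>V. z v * M v)"
  have mono: "?P (sc c (M u))" if u: "u \<in> U" for c u
  proof -
    obtain v where v: "v \<in> V" "u - v \<in> rad U" using V(3)[OF u] by blast
    define z where "z v' = (if v' = v then sc (c * inverse (chi (u - v) v)) (M (u - v)) else 0)" for v'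
    have "(\<Sum>v'\<in>V. z v' * M v') = (\<Sum>v'\<in>V. if v' = v then sc c (M u) else 0)"
      by (rule sum.cong) (use chi_nz[of "u - v" v] in \<open>simp_all add: z_def sc_mult_left M_mult sc_sc mult.assoc\<close>)
    also have "\<dots> = sc c (M u)" using V(1) v(1) by simp
    finally have "sc c (M u) = (\<Sum>v'\<in>V. z v' * M v')" by (rule sym)
    moreover have "\<forall>v'\<in>V. z v' \<in> torus (rad U)" using torus_M(1)[OF v(2)] by (simp add: z_def)
    ultimately show ?thesis by (intro exI[of _ z] conjI)
  qed
  have add: "?P (x + y)" if P: "?P x" "?P y" for x y
  proof -
    obtain z1 where z1: "\<forall>v\<in>V. z1 v \<in> torus (rad U)" "x = (\<Sum>v\<in>V. z1 v * M v)" using P(1) by (elim exE conjE)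
    obtain z2 where z2: "\<forall>v\<in>V. z2 v \<in> torus (rad U)" "y = (\<Sum>v\<in>V. z2 v * M v)" using P(2) by (elim exE conjE)
    have "x + y = (\<Sum>v\<in>V. (z1 v + z2 v) * M v)" unfolding z1(2) z2(2) by (simp only: distrib_right sum.distrib)
    moreover have "\<forall>v\<in>V. z1 v + z2 v \<in> torus (rad U)" using z1(1) z2(1) torus_add by simp
    ultimately show ?thesis by (intro exI[of _ "\<lambda>v. z1 v + z2 v"] conjI)
  qed
  have zero: "?P 0" by (rule exI[of _ "\<lambda>_. 0"]) simp
  have "?P (\<Sum>u\<in>B. sc (coef t u) (M u))" if "finite B" "B \<subseteq> U" for B
    using that
  proof (induction B rule: finite_induct)
    case empty
    show ?case using zero by simp
  next
    case (insert u B)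
    have "?P (sc (coef t u) (M u) + (\<Sum>u\<in>B. sc (coef t u) (M u)))"
      by (rule add[OF mono insert.IH]) (use insert.prems in simp_all)
    then show ?case using insert.hyps by simp
  qed
  from this[OF torus_expansion(1,2)[OF t]] show ?thesis using torus_expansion(3)[OF t] by simp
qed

end

section \<open>Polynomial identities\<close>

definition standard_sum :: "nat \<Rightarrow> (nat \<Rightarrow> 'a::ring_1) \<Rightarrow> 'a" where
  "standard_sum n x = (\<Sum>\<sigma> | \<sigma> permutes {..<n}. of_int (sign \<sigma>) * prod_list (map (\<lambda>i. x (\<sigma> i)) [0..<n]))"

lemma prod_list_map_update_add:
  fixes x :: "'i \<Rightarrow> 'a::ring_1"
  assumes "distinct is" "k \<in> set is"
  shows "prod_list (map (x(k := y + z)) is) = prod_list (map (x(k := y)) is) + prod_list (map (x(k := z)) is)"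
  using assms
proof (induction "is")
  case (Cons i js)
  show ?case
  proof (cases "i = k")
    case True
    then have k: "k \<notin> set js" using Cons.prems by simp
    have eq: "map (x(k := w)) js = map x js" for w using k by (intro map_cong) auto
    show ?thesis unfolding True by (simp only: list.map prod_list.Cons fun_upd_same eq distrib_right)
  next
    case False
    then show ?thesis using Cons by (simp add: distrib_left)
  qed
qed simp

lemma standard_sum_update_add:
  assumes k: "k < n"
  shows "standard_sum n (x(k := y + z)) = standard_sum n (x(k := y)) + standard_sum n (x(k := z))"
proof -
  have "prod_list (map (\<lambda>i. (x(k := y + z)) (\<sigma> i)) [0..<n]) =
      prod_list (map (\<lambda>i. (x(k := y)) (\<sigma> i)) [0..<n]) + prod_list (map (\<lambda>i. (x(k := z)) (\<sigma> i)) [0..<n])"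
    if p: "\<sigma> permutes {..<n}" for \<sigma>
  proof -
    have d: "distinct (map \<sigma> [0..<n])"
      using permutes_inj_on[OF p, of "set [0..<n]"] by (simp add: distinct_map)
    have "\<sigma> ` {..<n} = {..<n}" by (rule permutes_image[OF p])
    then have "set (map \<sigma> [0..<n]) = {..<n}" by (simp add: lessThan_atLeast0)
    then have m: "k \<in> set (map \<sigma> [0..<n])" using k by simp
    have e: "map (\<lambda>i. (x(k := w)) (\<sigma> i)) [0..<n] = map (x(k := w)) (map \<sigma> [0..<n])" for w
      by (simp only: map_map comp_def)
    show ?thesis unfolding e by (rule prod_list_map_update_add[OF d m])
  qed
  then show ?thesis unfolding standard_sum_def sum.distrib[symmetric]
    by (intro sum.cong refl) (simp only: mem_Collect_eq distrib_left)
qed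

context quantum_torus
begin

fun pair_chi :: "'v list \<Rightarrow> 'k" where
  "pair_chi [] = 1"
| "pair_chi (u # us) = chi u (sum_list us) * pair_chi us"

lemma prod_list_M: "prod_list (map (\<lambda>i. sc (c i) (M (u i))) is) =
    sc (prod_list (map c is) * pair_chi (map u is)) (M (sum_list (map u is)))"
  by (induction "is") (simp_all add: sc_mult_left sc_mult_right sc_sc M_mult mult_ac)

lemma pair_chi_cong:
  assumes cls: "\<And>u u' v v'. u \<in> U \<Longrightarrow> u' \<in> U \<Longrightarrow> v \<in> U \<Longrightarrow> v' \<in> U \<Longrightarrow>
      cls u = cls u' \<Longrightarrow> cls v = cls v' \<Longrightarrow> chi u v = chi u' v'"
    and "set us \<subseteq> U" "set vs \<subseteq> U" "map cls us = map cls vs"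
  shows "pair_chi us = pair_chi vs"
proof -
  have row: "chi u (sum_list us) = chi v (sum_list vs)"
    if "map cls us = map cls vs" "set us \<subseteq> U" "set vs \<subseteq> U" "u \<in> U" "v \<in> U" "cls u = cls v" for u v us vs
    using that
  proof (induction us arbitrary: vs)
    case (Cons a us)
    then obtain b vs' where vs: "vs = b # vs'" by (cases vs) auto
    have "chi u a = chi v b" by (rule cls) (use Cons.prems vs in simp_all)
    moreover have "chi u (sum_list us) = chi v (sum_list vs')"
      by (rule Cons.IH) (use Cons.prems vs in simp_all)
    ultimately show ?case by (simp add: vs chi_add_right)
  qed simp
  show ?thesis using assms(2-4)
  proof (induction us arbitrary: vs)
    case (Cons a us)
    then obtain b vs' where vs: "vs = b # vs'" by (cases vs) auto
    have "chi a (sum_list us) = chi b (sum_list vs')"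
      by (rule row) (use Cons.prems vs in simp_all)
    moreover have "pair_chi us = pair_chi vs'"
      by (rule Cons.IH) (use Cons.prems vs in simp_all)
    ultimately show ?case by (simp add: vs)
  qed simp
qed

text \<open>Among sufficiently many monomials two have the same commutation behaviour, so exchanging them does
not change a product. Left composition with this transposition pairs the even permutations with the odd
ones, and the terms cancel. Pairing them, instead of showing that the sum equals its negative,
covers characteristic two.\<close>

lemma standard_sum_monomials:
  assumes cls: "\<And>u u' v v'. u \<in> U \<Longrightarrow> u' \<in> U \<Longrightarrow> v \<in> U \<Longrightarrow> v' \<in> U \<Longrightarrow>
      cls u = cls u' \<Longrightarrow> cls v = cls v' \<Longrightarrow> chi u v = chi u' v'"
    and fin: "finite (cls ` U)" and n: "card (cls ` U) < n"
    and u: "\<And>i. i < n \<Longrightarrow> u i \<in> U"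
  shows "standard_sum n (\<lambda>i. sc (c i) (M (u i))) = 0"
proof -
  let ?E = "{\<sigma>. \<sigma> permutes {..<n} \<and> evenperm \<sigma>}" and ?O = "{\<sigma>. \<sigma> permutes {..<n} \<and> \<not> evenperm \<sigma>}"
  define g where "g \<sigma> = prod_list (map (\<lambda>i. sc (c (\<sigma> i)) (M (u (\<sigma> i)))) [0..<n])" for \<sigma> :: "nat \<Rightarrow> nat"
  have "\<not> inj_on (\<lambda>i. cls (u i)) {..<n}"
  proof (rule pigeonhole)
    have "(\<lambda>i. cls (u i)) ` {..<n} \<subseteq> cls ` U" using u by auto
    then have "card ((\<lambda>i. cls (u i)) ` {..<n}) \<le> card (cls ` U)" by (rule card_mono[OF fin])
    then show "card ((\<lambda>i. cls (u i)) ` {..<n}) < card {..<n}" using n by simp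
  qed
  then obtain a b where ab: "a < n" "b < n" "a \<noteq> b" "cls (u a) = cls (u b)"
    unfolding inj_on_def by auto
  let ?t = "transpose a b"
  have tp: "?t permutes {..<n}" using ab by (intro permutes_swap_id) simp_all
  have cls_t: "cls (u (?t i)) = cls (u i)" for i
    using ab(4) by (cases "i = a"; cases "i = b") (simp_all add: transpose_def)
  have G: "g (?t \<circ> \<sigma>) = g \<sigma>" if p: "\<sigma> permutes {..<n}" for \<sigma>
  proof -
    have q: "?t \<circ> \<sigma> permutes {..<n}" by (rule permutes_compose[OF p tp])
    have form: "g \<rho> = sc ((\<Prod>i<n. c i) * pair_chi (map (\<lambda>i. u (\<rho> i)) [0..<n])) (M (\<Sum>i<n. u i))"
      if r: "\<rho> permutes {..<n}" for \<rho>
    proof -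
      have "prod_list (map (\<lambda>i. c (\<rho> i)) [0..<n]) = (\<Prod>i<n. c (\<rho> i))"
        by (simp add: prod.list_conv_set_nth lessThan_atLeast0)
      also have "\<dots> = (\<Prod>i<n. c i)" using prod.permute[OF r, of c] by (simp add: comp_def)
      finally have 1: "prod_list (map (\<lambda>i. c (\<rho> i)) [0..<n]) = (\<Prod>i<n. c i)" .
      have "sum_list (map (\<lambda>i. u (\<rho> i)) [0..<n]) = (\<Sum>i<n. u (\<rho> i))"
        by (simp add: sum.list_conv_set_nth lessThan_atLeast0)
      also have "\<dots> = (\<Sum>i<n. u i)" using sum.permute[OF r, of u] by (simp add: comp_def)
      finally have 2: "sum_list (map (\<lambda>i. u (\<rho> i)) [0..<n]) = (\<Sum>i<n. u i)" .
      show ?thesis unfolding g_def prod_list_M[of "\<lambda>i. c (\<rho> i)" "\<lambda>i. u (\<rho> i)"] 1 2 by (rule refl)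
    qed
    have rng: "u (\<rho> i) \<in> U" if "\<rho> permutes {..<n}" "i < n" for \<rho> i
      using permutes_in_image[OF that(1), of i] that(2) u by simp
    have "pair_chi (map (\<lambda>i. u ((?t \<circ> \<sigma>) i)) [0..<n]) = pair_chi (map (\<lambda>i. u (\<sigma> i)) [0..<n])"
    proof (rule pair_chi_cong[OF cls])
      show "set (map (\<lambda>i. u ((?t \<circ> \<sigma>) i)) [0..<n]) \<subseteq> U" by (rule set_map_subsetI, rule rng[OF q]) simp
      show "set (map (\<lambda>i. u (\<sigma> i)) [0..<n]) \<subseteq> U" by (rule set_map_subsetI, rule rng[OF p]) simp
      show "map cls (map (\<lambda>i. u ((?t \<circ> \<sigma>) i)) [0..<n]) = map cls (map (\<lambda>i. u (\<sigma> i)) [0..<n])"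
        by (simp add: cls_t)
    qed
    then show ?thesis unfolding form[OF p] form[OF q] by simp
  qed
  have pm: "permutation \<sigma>" if "\<sigma> permutes {..<n}" for \<sigma>
    using that permutation_permutes finite_lessThan by blast
  have ev: "evenperm (?t \<circ> \<sigma>) \<longleftrightarrow> \<not> evenperm \<sigma>" if "\<sigma> permutes {..<n}" for \<sigma>
    using evenperm_comp[OF pm[OF tp] pm[OF that]] ab(3) by (simp add: evenperm_swap)
  have tt: "?t \<circ> (?t \<circ> \<sigma>) = \<sigma>" for \<sigma> :: "nat \<Rightarrow> nat" by (simp add: comp_assoc[symmetric])
  have "sum g ?O = sum g ?E"
  proof (rule sum.reindex_bij_witness[where i = "\<lambda>\<sigma>. ?t \<circ> \<sigma>" and j = "\<lambda>\<sigma>. ?t \<circ> \<sigma>"])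
    fix \<sigma> assume "\<sigma> \<in> ?O"
    then have s: "\<sigma> permutes {..<n}" "\<not> evenperm \<sigma>" by simp_all
    show "?t \<circ> (?t \<circ> \<sigma>) = \<sigma>" by (rule tt)
    show "?t \<circ> \<sigma> \<in> ?E" using permutes_compose[OF s(1) tp] ev[OF s(1)] s(2) by simp
    show "g (?t \<circ> \<sigma>) = g \<sigma>" by (rule G[OF s(1)])
  next
    fix \<sigma> assume "\<sigma> \<in> ?E"
    then have s: "\<sigma> permutes {..<n}" "evenperm \<sigma>" by simp_all
    show "?t \<circ> (?t \<circ> \<sigma>) = \<sigma>" by (rule tt)
    show "?t \<circ> \<sigma> \<in> ?O" using permutes_compose[OF s(1) tp] ev[OF s(1)] s(2) by simp
  qed
  moreover have "standard_sum n (\<lambda>i. sc (c i) (M (u i))) = sum g ?E + sum (\<lambda>\<sigma>. - g \<sigma>) ?O"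
  proof -
    have fin: "finite {\<sigma>. \<sigma> permutes {..<n}}" by (rule finite_permutations) simp
    have un: "{\<sigma>. \<sigma> permutes {..<n}} = ?E \<union> ?O" by blast
    have "standard_sum n (\<lambda>i. sc (c i) (M (u i))) = (\<Sum>\<sigma>\<in>?E \<union> ?O. of_int (sign \<sigma>) * g \<sigma>)"
      unfolding standard_sum_def g_def un by (rule refl)
    also have "\<dots> = (\<Sum>\<sigma>\<in>?E. of_int (sign \<sigma>) * g \<sigma>) + (\<Sum>\<sigma>\<in>?O. of_int (sign \<sigma>) * g \<sigma>)"
      by (rule sum.union_disjoint[OF finite_subset[OF _ fin] finite_subset[OF _ fin]]) blast+
    also have "(\<Sum>\<sigma>\<in>?E. of_int (sign \<sigma>) * g \<sigma>) = sum g ?E"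
      by (rule sum.cong) (simp_all add: sign_def)
    also have "(\<Sum>\<sigma>\<in>?O. of_int (sign \<sigma>) * g \<sigma>) = sum (\<lambda>\<sigma>. - g \<sigma>) ?O"
      by (rule sum.cong) (simp_all add: sign_def)
    finally show ?thesis .
  qed
  ultimately show ?thesis by (simp add: sum_negf)
qed

text \<open>The standard sum is additive in each argument, which reduces the claim to monomials. The arguments
are expanded one after the other; in the induction, those from index \<open>k\<close> on are monomials
already.\<close>

theorem standard_identity:
  assumes cls: "\<And>u u' v v'. u \<in> U \<Longrightarrow> u' \<in> U \<Longrightarrow> v \<in> U \<Longrightarrow> v' \<in> U \<Longrightarrow>
      cls u = cls u' \<Longrightarrow> cls v = cls v' \<Longrightarrow> chi u v = chi u' v'"
    and fin: "finite (cls ` U)" and n: "card (cls ` U) < n"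
    and x: "\<And>i. x i \<in> torus U"
  shows "standard_sum n x = 0"
proof -
  have "standard_sum n y = 0"
    if "k \<le> n" "\<And>i. y i \<in> torus U" "\<And>i. k \<le> i \<Longrightarrow> i < n \<Longrightarrow> \<exists>c u. u \<in> U \<and> y i = sc c (M u)" for k y
    using that
  proof (induction k arbitrary: y)
    case 0
    then have "\<forall>i. \<exists>p. i < n \<longrightarrow> snd p \<in> U \<and> y i = sc (fst p) (M (snd p))" by fastforce
    then obtain f where f: "\<And>i. i < n \<Longrightarrow> snd (f i) \<in> U \<and> y i = sc (fst (f i)) (M (snd (f i)))"
      using choice[of "\<lambda>i p. i < n \<longrightarrow> snd p \<in> U \<and> y i = sc (fst p) (M (snd p))"] by blast
    have "standard_sum n y = standard_sum n (\<lambda>i. sc (fst (f i)) (M (snd (f i))))"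
      unfolding standard_sum_def
    proof (intro sum.cong refl)
      fix \<sigma> assume "\<sigma> \<in> {\<sigma>. \<sigma> permutes {..<n}}"
      then have "\<sigma> i < n" if "i < n" for i using permutes_in_image[of \<sigma> "{..<n}" i] that by simp
      then have "map (\<lambda>i. y (\<sigma> i)) [0..<n] = map (\<lambda>i. sc (fst (f (\<sigma> i))) (M (snd (f (\<sigma> i))))) [0..<n]"
        using f by (intro map_cong refl) simp
      then show "of_int (sign \<sigma>) * prod_list (map (\<lambda>i. y (\<sigma> i)) [0..<n]) =
        of_int (sign \<sigma>) * prod_list (map (\<lambda>i. sc (fst (f (\<sigma> i))) (M (snd (f (\<sigma> i))))) [0..<n])" by (simp only:)
    qed
    also have "\<dots> = 0" by (rule standard_sum_monomials[OF cls fin n]) (use f in simp_all)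
    finally show ?case .
  next
    case (Suc k)
    have k: "k < n" using Suc.prems by simp
    have yk: "y k \<in> torus U" using Suc.prems by simp
    have mono: "standard_sum n (y(k := sc c (M u))) = 0" if u: "u \<in> U" for c u
    proof (rule Suc.IH)
      show "k \<le> n" using k by simp
      show "(y(k := sc c (M u))) i \<in> torus U" for i using Suc.prems(2) torus_M(1)[OF u] by simp
      fix i assume i: "k \<le> i" "i < n"
      show "\<exists>c' u'. u' \<in> U \<and> (y(k := sc c (M u))) i = sc c' (M u')"
      proof (cases "i = k")
        case True
        then show ?thesis using u by (intro exI[of _ c] exI[of _ u]) simp
      next
        case False
        then show ?thesis using Suc.prems(3)[of i] i by simp
      qed
    qed
    have zero: "standard_sum n (y(k := 0)) = 0"
      using standard_sum_update_add[OF k, of y 0 0] by simp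
    have "standard_sum n (y(k := (\<Sum>u\<in>B. sc (coef (y k) u) (M u)))) = 0" if "finite B" "B \<subseteq> U" for B
      using that
    proof (induction B rule: finite_induct)
      case empty
      show ?case using zero by (simp only: sum.empty)
    next
      case (insert u B)
      have uB: "u \<in> U" "B \<subseteq> U" using insert.prems by simp_all
      show ?case
        unfolding sum.insert[OF insert.hyps] standard_sum_update_add[OF k] mono[OF uB(1)] insert.IH[OF uB(2)]
        by (rule add_0_left)
    qed
    from this[OF torus_expansion(1,2)[OF yk]] have "standard_sum n (y(k := y k)) = 0"
      using torus_expansion(3)[OF yk] by simp
    then show ?case by simp
  qed
  from this[of n x] show ?thesis using x by simp
qed

end

context embedded_domain
begin

lemma phi_eval_word: "range s \<subseteq> carrier R \<Longrightarrow>
    eval_word R s w \<in> carrier R \<and> \<phi> (eval_word R s w) = prod_list (map (\<lambda>i. \<phi> (s i)) (letters w))"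
proof -
  assume s: "range s \<subseteq> carrier R"
  have "foldr (\<lambda>x y. s x \<otimes> y) xs \<one> \<in> carrier R \<and>
    \<phi> (foldr (\<lambda>x y. s x \<otimes> y) xs \<one>) = prod_list (map (\<lambda>i. \<phi> (s i)) xs)" for xs
  proof (induction xs)
    case Nil
    show ?case by (simp add: phi_one)
  next
    case (Cons x xs)
    have "s x \<in> carrier R" using s by blast
    then show ?case using Cons by (simp add: phi_mult)
  qed
  then show ?thesis unfolding eval_word_def by blast
qed

lemma phi_finsum: "finite B \<Longrightarrow> (\<And>b. b \<in> B \<Longrightarrow> f b \<in> carrier R) \<Longrightarrow>
    \<phi> (\<Oplus>b\<in>B. f b) = (\<Sum>b\<in>B. \<phi> (f b))"
proof (induction B rule: finite_induct)
  case (insert b B)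
  have c: "f b \<in> carrier R" "f \<in> B \<rightarrow> carrier R" using insert.prems by auto
  show ?case using insert.hyps insert.IH insert.prems c by (simp add: finsum_insert phi_add)
qed (simp add: phi_zero)

lemma phi_sign_mult:
  assumes "x \<in> carrier R" "k = 1 \<or> k = - 1"
  shows "add_pow R (k::int) x \<in> carrier R \<and> \<phi> (add_pow R k x) = of_int k * \<phi> x"
proof -
  have "add_pow R (1::int) x = x" using assms(1) by (rule add.int_pow_1)
  moreover have "add_pow R (- 1::int) x = \<ominus> x" using add.int_pow_neg[OF assms(1), of 1] add.int_pow_1[OF assms(1)] by simp
  ultimately show ?thesis using assms phi_neg by auto
qed

text \<open>The standard sum is the value of a polynomial in the free ring whose words are the permutations
of the variables; the word of the identity has coefficient \<open>1\<close>, and all words have the same length, so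
that the polynomial is monic.\<close>

theorem PI_ringI:
  assumes S: "\<And>x. (\<And>i. x i \<in> \<phi> ` carrier R) \<Longrightarrow> standard_sum n x = 0"
  shows "PI_ring R"
proof -
  let ?P = "{\<sigma>. \<sigma> permutes {..<n}}"
  define wd where "wd \<sigma> = Free_Mon (map \<sigma> [0..<n])" for \<sigma> :: "nat \<Rightarrow> nat"
  define f :: "nat free_mon \<Rightarrow>\<^sub>0 int" where "f = (\<Sum>\<sigma>\<in>?P. Poly_Mapping.single (wd \<sigma>) (sign \<sigma>))"
  have fin: "finite ?P" by (rule finite_permutations) simp
  have inj: "\<sigma> = \<rho>" if "\<sigma> \<in> ?P" "\<rho> \<in> ?P" "wd \<sigma> = wd \<rho>" for \<sigma> \<rho>
  proof
    fix i
    show "\<sigma> i = \<rho> i"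
    proof (cases "i < n")
      case True
      have "map \<sigma> [0..<n] = map \<rho> [0..<n]" using that(3) by (simp add: wd_def)
      then have "map \<sigma> [0..<n] ! i = map \<rho> [0..<n] ! i" by (simp only:)
      then show ?thesis using True by simp
    next
      case False
      then show ?thesis
        using that(1,2) permutes_not_in[of \<sigma> "{..<n}" i] permutes_not_in[of \<rho> "{..<n}" i] by simp
    qed
  qed
  have lk: "Poly_Mapping.lookup f (wd \<sigma>) = sign \<sigma>" if s: "\<sigma> \<in> ?P" for \<sigma>
  proof -
    have "Poly_Mapping.lookup f (wd \<sigma>) = (\<Sum>\<rho>\<in>?P. if \<rho> = \<sigma> then sign \<rho> else 0)"
      unfolding f_def lookup_sum
    proof (rule sum.cong[OF refl])
      fix \<rho> assume r: "\<rho> \<in> ?P"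
      show "Poly_Mapping.lookup (Poly_Mapping.single (wd \<rho>) (sign \<rho>)) (wd \<sigma>) = (if \<rho> = \<sigma> then sign \<rho> else 0)"
        using inj[OF r s] by (auto simp: lookup_single when_def)
    qed
    also have "\<dots> = sign \<sigma>" using sum.delta[OF fin, of \<sigma> sign] s by simp
    finally show ?thesis .
  qed
  have keys: "Poly_Mapping.keys f = wd ` ?P"
  proof (intro equalityI subsetI)
    fix w assume "w \<in> Poly_Mapping.keys f"
    then have "w \<in> (\<Union>\<sigma>\<in>?P. Poly_Mapping.keys (Poly_Mapping.single (wd \<sigma>) (sign \<sigma>)))"
      unfolding f_def using keys_sum[of "\<lambda>\<sigma>. Poly_Mapping.single (wd \<sigma>) (sign \<sigma>)" ?P] by (rule subsetD[rotated])
    then show "w \<in> wd ` ?P" by (auto split: if_splits)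
  next
    fix w assume "w \<in> wd ` ?P"
    then obtain \<sigma> where "\<sigma> \<in> ?P" "w = wd \<sigma>" by blast
    then show "w \<in> Poly_Mapping.keys f" using lk by (simp add: in_keys_iff)
  qed
  have monic: "monic_free f"
    unfolding monic_free_def
  proof (intro bexI conjI ballI)
    have i: "id \<in> ?P" by (simp add: permutes_id)
    show "Poly_Mapping.lookup f (wd id) = 1" using lk[OF i] by simp
    show "wd id \<in> Poly_Mapping.keys f" unfolding keys using i by (rule imageI)
    fix v assume "v \<in> Poly_Mapping.keys f"
    then show "length (letters v) \<le> length (letters (wd id))" unfolding keys by (auto simp: wd_def)
  qed
  have "eval_free R s f = \<zero>" if s: "range s \<subseteq> carrier R" for s
  proof -
    note W = phi_eval_word[OF s]
    have sg: "Poly_Mapping.lookup f w = 1 \<or> Poly_Mapping.lookup f w = - 1" if wk: "w \<in> Poly_Mapping.keys f" for w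
    proof -
      obtain \<sigma> where "\<sigma> \<in> ?P" "w = wd \<sigma>" using wk unfolding keys by blast
      then show ?thesis using lk[of \<sigma>] by (cases \<sigma> rule: sign_cases) simp_all
    qed
    have tm: "add_pow R (Poly_Mapping.lookup f w) (eval_word R s w) \<in> carrier R \<and>
       \<phi> (add_pow R (Poly_Mapping.lookup f w) (eval_word R s w)) = of_int (Poly_Mapping.lookup f w) * prod_list (map (\<lambda>i. \<phi> (s i)) (letters w))"
      if "w \<in> Poly_Mapping.keys f" for w
      using phi_sign_mult[OF conjunct1[OF W] sg[OF that]] W by simp
    have "\<phi> (eval_free R s f) = (\<Sum>w\<in>Poly_Mapping.keys f. \<phi> (add_pow R (Poly_Mapping.lookup f w) (eval_word R s w)))"
      unfolding eval_free_def by (rule phi_finsum) (use tm in simp_all)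
    also have "\<dots> = (\<Sum>w\<in>wd ` ?P. of_int (Poly_Mapping.lookup f w) * prod_list (map (\<lambda>i. \<phi> (s i)) (letters w)))"
      unfolding keys[symmetric] by (rule sum.cong) (use tm in simp_all)
    also have "\<dots> = (\<Sum>\<sigma>\<in>?P. of_int (sign \<sigma>) * prod_list (map (\<lambda>i. \<phi> (s (\<sigma> i))) [0..<n]))"
    proof (subst sum.reindex)
      show "inj_on wd ?P" by (rule inj_onI) (rule inj)
      show "sum ((\<lambda>w. of_int (Poly_Mapping.lookup f w) * prod_list (map (\<lambda>i. \<phi> (s i)) (letters w))) \<circ> wd) ?P =
        (\<Sum>\<sigma>\<in>?P. of_int (sign \<sigma>) * prod_list (map (\<lambda>i. \<phi> (s (\<sigma> i))) [0..<n]))"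
        by (rule sum.cong[OF refl]) (simp only: comp_def lk, simp add: wd_def comp_def)
    qed
    also have "\<dots> = standard_sum n (\<lambda>i. \<phi> (s i))" unfolding standard_sum_def by (rule refl)
    also have "\<dots> = 0" by (rule S) (use s in blast)
    finally have "\<phi> (eval_free R s f) = 0" .
    moreover have "eval_free R s f \<in> carrier R" unfolding eval_free_def
      by (rule finsum_closed) (use tm in blast)
    ultimately show ?thesis using phi_eq_0_iff by simp
  qed
  then show ?thesis unfolding PI_ring_def using ring_axioms monic by blast
qed

end

section \<open>Generators, relations and standard monomials\<close>

lemma letters_add [simp]: "letters (v + w) = letters v @ letters w"
  by (simp add: plus_free_mon_def)

lemma letters_zero [simp]: "letters 0 = []"
  by (simp add: zero_free_mon_def)

lemma keys_minus_iff [simp]: "Poly_Mapping.keys (- p) = Poly_Mapping.keys (p :: 'a \<Rightarrow>\<^sub>0 'b::ab_group_add)"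
  by (auto simp: in_keys_iff)

definition words_over :: "'x set \<Rightarrow> ('x free_mon \<Rightarrow>\<^sub>0 'k::comm_ring_1) set" where
  "words_over G = {p. \<forall>w\<in>Poly_Mapping.keys p. set (letters w) \<subseteq> G}"

lemma over_add: "p \<in> words_over G \<Longrightarrow> p' \<in> words_over G \<Longrightarrow> p + p' \<in> words_over G"
  using keys_add[of p p'] unfolding words_over_def by blast

lemma over_uminus: "p \<in> words_over G \<Longrightarrow> - p \<in> words_over G"
  unfolding words_over_def by simp

lemma over_minus: "p \<in> words_over G \<Longrightarrow> p' \<in> words_over G \<Longrightarrow> p - p' \<in> words_over G"
  using over_add[of p G "- p'"] over_uminus[of p' G] by simp

lemma over_mult: assumes "p \<in> words_over G" "p' \<in> words_over G" shows "p * p' \<in> words_over G"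
  unfolding words_over_def
proof (intro CollectI ballI)
  fix w assume "w \<in> Poly_Mapping.keys (p * p')"
  then obtain a b where "w = a + b" "a \<in> Poly_Mapping.keys p" "b \<in> Poly_Mapping.keys p'"
    using keys_mult[of p p'] by blast
  then show "set (letters w) \<subseteq> G" using assms unfolding words_over_def by simp
qed

lemma over_single: "set (letters w) \<subseteq> G \<Longrightarrow> Poly_Mapping.single w c \<in> words_over G"
  unfolding words_over_def by simp

lemma over_0: "0 \<in> words_over G" and over_1: "1 \<in> words_over G"
  unfolding words_over_def by simp_all

lemma over_mono: "G \<subseteq> H \<Longrightarrow> p \<in> words_over G \<Longrightarrow> p \<in> words_over H"
  unfolding words_over_def by blast

lemma free_algebra_simps [simp]:
  "carrier (free_algebra G) = words_over G" "mult (free_algebra G) = (*)" "one (free_algebra G) = 1"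
  "zero (free_algebra G) = 0" "add (free_algebra G) = (+)"
  unfolding free_algebra_def words_over_def by simp_all

lemma free_algebra_ring: "ring (free_algebra G :: ('x free_mon \<Rightarrow>\<^sub>0 'k::comm_ring_1) ring)"
proof (rule ringI)
  show "abelian_group (free_algebra G :: ('x free_mon \<Rightarrow>\<^sub>0 'k) ring)"
  proof (rule abelian_groupI)
    fix x :: "'x free_mon \<Rightarrow>\<^sub>0 'k" assume "x \<in> carrier (free_algebra G)"
    then show "\<exists>y\<in>carrier (free_algebra G). y \<oplus>\<^bsub>free_algebra G\<^esub> x = \<zero>\<^bsub>free_algebra G\<^esub>"
      by (intro bexI[of _ "- x"]) (simp_all add: over_uminus)
  qed (simp_all add: over_add over_0 add.assoc add.commute)
  show "Group.monoid (free_algebra G :: ('x free_mon \<Rightarrow>\<^sub>0 'k) ring)"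
    by (rule monoidI) (simp_all add: over_mult over_1 mult.assoc)
qed (simp_all add: distrib_left distrib_right)

lemma free_algebra_minus:
  assumes "x \<in> words_over G" "y \<in> words_over G"
  shows "x \<ominus>\<^bsub>free_algebra G\<^esub> y = x - y"
proof -
  interpret F: ring "free_algebra G" by (rule free_algebra_ring)
  have "\<ominus>\<^bsub>free_algebra G\<^esub> y = - y"
    by (rule F.minus_equality) (simp_all add: assms over_uminus)
  then show ?thesis unfolding a_minus_def by simp
qed

lemma pm_expansion: "p = (\<Sum>w\<in>Poly_Mapping.keys p. Poly_Mapping.single w (Poly_Mapping.lookup p w))"
proof (rule poly_mapping_eqI)
  fix v
  have "(\<Sum>w\<in>Poly_Mapping.keys p. Poly_Mapping.lookup (Poly_Mapping.single w (Poly_Mapping.lookup p w)) v) =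
    (\<Sum>w\<in>Poly_Mapping.keys p. if w = v then Poly_Mapping.lookup p v else 0)"
    by (rule sum.cong) (simp_all add: lookup_single when_def)
  also have "\<dots> = Poly_Mapping.lookup p v" by (simp add: in_keys_iff)
  finally show "Poly_Mapping.lookup p v =
      Poly_Mapping.lookup (\<Sum>w\<in>Poly_Mapping.keys p. Poly_Mapping.single w (Poly_Mapping.lookup p w)) v"
    unfolding lookup_sum by (rule sym)
qed

context scaled_ring
begin

text \<open>Evaluation of an element of the free algebra at values of the variables. Being defined on all letters,
it is a homomorphism on a full type; the alphabet enters only through \<open>words_over\<close>.\<close>

definition ev :: "('x \<Rightarrow> 'a) \<Rightarrow> ('x free_mon \<Rightarrow>\<^sub>0 'k) \<Rightarrow> 'a" where
  "ev X p = (\<Sum>w\<in>Poly_Mapping.keys p. sc (Poly_Mapping.lookup p w) (prod_list (map X (letters w))))"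

lemma ev_superset:
  assumes "finite A" "Poly_Mapping.keys p \<subseteq> A"
  shows "ev X p = (\<Sum>w\<in>A. sc (Poly_Mapping.lookup p w) (prod_list (map X (letters w))))"
  unfolding ev_def by (rule sum.mono_neutral_left[OF assms]) (simp add: in_keys_iff)

lemma ev_add: "ev X (p + p') = ev X p + ev X p'"
proof -
  let ?A = "Poly_Mapping.keys p \<union> Poly_Mapping.keys p'"
  have f: "finite ?A" by simp
  show ?thesis
    unfolding ev_superset[OF f keys_add] ev_superset[OF f Un_upper1] ev_superset[OF f Un_upper2]
    by (simp only: lookup_add sc_add_left sum.distrib)
qed

lemma ev_0 [simp]: "ev X 0 = 0" unfolding ev_def by simp

lemma ev_minus: "ev X (p - p') = ev X p - ev X p'"
  using ev_add[of X "p - p'" p'] by simp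

lemma ev_single: "ev X (Poly_Mapping.single w c) = sc c (prod_list (map X (letters w)))"
  by (cases "c = 0") (simp_all add: ev_def)

lemma ev_sum: "ev X (sum f A) = (\<Sum>a\<in>A. ev X (f a))"
  by (induction A rule: infinite_finite_induct) (simp_all add: ev_add)

lemma ev_1 [simp]: "ev X 1 = 1"
  using ev_single[of X 0 1] by simp

lemma ev_mult: "ev X (p * p') = ev X p * ev X p'"
proof -
  let ?s = "\<lambda>p w. Poly_Mapping.single w (Poly_Mapping.lookup p w)"
  have "p * p' = (\<Sum>w\<in>Poly_Mapping.keys p. ?s p w) * (\<Sum>v\<in>Poly_Mapping.keys p'. ?s p' v)"
    using pm_expansion[of p] pm_expansion[of p'] by simp
  also have "\<dots> = (\<Sum>w\<in>Poly_Mapping.keys p. \<Sum>v\<in>Poly_Mapping.keys p'. ?s p w * ?s p' v)"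
    by (rule sum_product)
  finally have "ev X (p * p') = (\<Sum>w\<in>Poly_Mapping.keys p. \<Sum>v\<in>Poly_Mapping.keys p'. ev X (?s p w * ?s p' v))"
    by (simp only: ev_sum)
  also have "\<dots> = (\<Sum>w\<in>Poly_Mapping.keys p. \<Sum>v\<in>Poly_Mapping.keys p'.
      sc (Poly_Mapping.lookup p w) (prod_list (map X (letters w))) *
      sc (Poly_Mapping.lookup p' v) (prod_list (map X (letters v))))"
    by (intro sum.cong refl) (simp add: mult_single ev_single sc_mult_left sc_mult_right sc_sc mult.commute)
  also have "\<dots> = ev X p * ev X p'"
    unfolding ev_def by (rule sum_product[symmetric])
  finally show ?thesis .
qed

lemma ev_genideal:
  fixes X :: "'x \<Rightarrow> 'a"
  assumes S: "S \<subseteq> words_over G" "\<And>s. s \<in> S \<Longrightarrow> ev X s = 0" and p: "p \<in> Idl\<^bsub>free_algebra G\<^esub> S"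
  shows "ev X p = 0"
proof -
  interpret F: ring "free_algebra G :: ('x free_mon \<Rightarrow>\<^sub>0 'k) ring" by (rule free_algebra_ring)
  let ?I = "{p \<in> words_over G. ev X p = 0}"
  have "ideal ?I (free_algebra G)"
  proof (rule idealI[OF free_algebra_ring])
    show "subgroup ?I (add_monoid (free_algebra G))"
    proof (rule F.add.subgroupI)
      show "?I \<subseteq> carrier (free_algebra G)" by auto
      show "?I \<noteq> {}" using over_0[of G] ev_0 by blast
      fix a assume "a \<in> ?I"
      then have a: "a \<in> words_over G" "ev X a = 0" by simp_all
      have "\<ominus>\<^bsub>free_algebra G\<^esub> a = - a" by (rule F.minus_equality) (simp_all add: a over_uminus)
      moreover have "ev X (- a) = 0" using ev_minus[of X 0 a] a by simp
      ultimately show "\<ominus>\<^bsub>free_algebra G\<^esub> a \<in> ?I" using over_uminus[OF a(1)] by simp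
      fix b assume "b \<in> ?I"
      then show "a \<oplus>\<^bsub>free_algebra G\<^esub> b \<in> ?I" using a by (simp add: over_add ev_add)
    qed
    fix a x :: "'x free_mon \<Rightarrow>\<^sub>0 'k" assume "a \<in> ?I" "x \<in> carrier (free_algebra G)"
    then have a: "a \<in> words_over G" "ev X a = 0" and x: "x \<in> words_over G" by simp_all
    show "x \<otimes>\<^bsub>free_algebra G\<^esub> a \<in> ?I" using over_mult[OF x a(1)] a(2) by (simp add: ev_mult)
    show "a \<otimes>\<^bsub>free_algebra G\<^esub> x \<in> ?I" using over_mult[OF a(1) x] a(2) by (simp add: ev_mult)
  qed
  moreover have "S \<subseteq> ?I" using S by auto
  ultimately have "Idl\<^bsub>free_algebra G\<^esub> S \<subseteq> ?I" by (rule F.genideal_minimal)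
  then show ?thesis using p by auto
qed

end

lemma free_var_pair: "free_var x * free_var y = Poly_Mapping.single (Free_Mon [x, y]) 1"
  by (simp add: free_var_def mult_single plus_free_mon_def)

lemma free_const_pair: "free_const c * free_var x * free_var y = Poly_Mapping.single (Free_Mon [x, y]) c"
  by (simp add: free_var_def free_const_def mult_single plus_free_mon_def)

text \<open>The combinations of sorted words in the letters of \<open>Y\<close>, that is, of standard monomials.\<close>

definition sorted_span :: "(nat \<times> nat) set \<Rightarrow> ((nat \<times> nat) free_mon \<Rightarrow>\<^sub>0 'k::comm_ring_1) set" where
  "sorted_span Y = {p. \<forall>w\<in>Poly_Mapping.keys p. set (letters w) \<subseteq> Y \<and> sorted (letters w)}"

lemma sorted_span_add: "p \<in> sorted_span Y \<Longrightarrow> p' \<in> sorted_span Y \<Longrightarrow> p + p' \<in> sorted_span Y"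
  using keys_add[of p p'] unfolding sorted_span_def by blast

lemma sorted_span_0: "0 \<in> sorted_span Y"
  unfolding sorted_span_def by simp

lemma sorted_span_const: "p \<in> sorted_span Y \<Longrightarrow> free_const c * p \<in> sorted_span Y"
proof -
  assume p: "p \<in> sorted_span Y"
  have "Poly_Mapping.keys (free_const c * p) \<subseteq> Poly_Mapping.keys p"
  proof
    fix w assume "w \<in> Poly_Mapping.keys (free_const c * p)"
    then obtain a b where ab: "w = a + b" "a \<in> Poly_Mapping.keys (free_const c)" "b \<in> Poly_Mapping.keys p"
      using keys_mult[of "free_const c" p] by blast
    have "a = 0" using ab(2) unfolding free_const_def by (simp split: if_splits)
    then show "w \<in> Poly_Mapping.keys p" using ab by simp
  qed
  then show ?thesis using p unfolding sorted_span_def by blast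
qed

lemma sorted_span_over: "p \<in> sorted_span Y \<Longrightarrow> p \<in> words_over Y"
  unfolding sorted_span_def words_over_def by blast

lemma not_sorted_descent:
  fixes xs :: "'a::linorder list"
  assumes "\<not> sorted xs"
  obtains as x y bs where "xs = as @ [y, x] @ bs" "x < y"
proof -
  obtain i where i: "Suc i < length xs" "\<not> xs ! i \<le> xs ! Suc i"
    using assms unfolding sorted_iff_nth_Suc by blast
  have "xs = take i xs @ xs ! i # xs ! Suc i # drop (Suc (Suc i)) xs"
    using i(1) by (simp add: Cons_nth_drop_Suc id_take_nth_drop[symmetric])
  then show ?thesis using that[of "take i xs" "xs ! i" "xs ! Suc i" "drop (Suc (Suc i)) xs"] i(2) by simp
qed

lemma lexn_at:
  "length as + Suc (length bs) = k \<Longrightarrow> length cs = length bs \<Longrightarrow> (a, b) \<in> r \<Longrightarrow>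
    (as @ a # bs, as @ b # cs) \<in> lexn r k"
  unfolding lexn_conv mem_Collect_eq case_prod_conv
  by (intro conjI exI[of _ as] exI[of _ a] exI[of _ b] exI[of _ bs] exI[of _ cs] refl) simp_all

locale quantum_matrices =
  fixes q :: "'k::field" and m n :: nat and lam :: "nat \<Rightarrow> nat"
  assumes q_nonzero: "q \<noteq> 0" and partition: "is_partition m lam" and lam_le: "\<And>i. i \<in> {1..m} \<Longrightarrow> lam i \<le> n"
begin

abbreviation "G \<equiv> {1..m} \<times> {1..n}"
abbreviation "F \<equiv> (qmat_free m n :: ((nat \<times> nat) free_mon \<Rightarrow>\<^sub>0 'k) ring)"
abbreviation "I \<equiv> qmat_ideal q m n"
abbreviation "\<pi> \<equiv> qmat_proj q m n"

definition Y :: "(nat \<times> nat) set" where "Y = {(i, j). i \<in> {1..m} \<and> j \<in> {1..lam i}}"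

lemma Y_G: "Y \<subseteq> G" unfolding Y_def using lam_le by fastforce

text \<open>The property of Young diagrams that makes straightening and the pivot construction stay inside the
diagram: a diagram contains the rectangle above and to the left of each of its boxes.\<close>

lemma Y_corner: "(s, t) \<in> Y \<Longrightarrow> 1 \<le> i \<Longrightarrow> i \<le> s \<Longrightarrow> 1 \<le> j \<Longrightarrow> j \<le> t \<Longrightarrow> (i, j) \<in> Y"
proof -
  assume H: "(s, t) \<in> Y" "1 \<le> i" "i \<le> s" "1 \<le> j" "j \<le> t"
  then have "lam s \<le> lam i" "t \<le> lam s" "s \<le> m" using partition unfolding is_partition_def Y_def by simp_all
  then show "(i, j) \<in> Y" using H unfolding Y_def by simp
qed

lemma relations_over: "qmat_relations q m n \<subseteq> words_over G"
proof -
  have v: "free_var (i, j) \<in> words_over G" if "i \<in> {1..m}" "j \<in> {1..n}" for i j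
    unfolding free_var_def by (rule over_single) (use that in simp)
  have c: "free_const c \<in> words_over G" for c :: 'k
    unfolding free_const_def by (rule over_single) simp
  show ?thesis unfolding qmat_relations_def Let_def
  proof (intro Un_least subsetI; elim CollectE exE conjE)
  qed (hypsubst, (intro over_minus over_add over_mult c v; simp))+
qed

sublocale F: ring F unfolding qmat_free_def by (rule free_algebra_ring)

lemma F_carrier: "carrier F = words_over G" and F_simps: "mult F = (*)" "add F = (+)" "one F = 1" "zero F = 0"
  unfolding qmat_free_def by simp_all

lemma I_ideal: "ideal I F"
  unfolding qmat_ideal_def by (rule F.genideal_ideal) (unfold F_carrier, rule relations_over)

lemma I_relations: "qmat_relations q m n \<subseteq> I"
  unfolding qmat_ideal_def by (rule F.genideal_self) (unfold F_carrier, rule relations_over)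

lemma I_add: "p \<in> I \<Longrightarrow> p' \<in> I \<Longrightarrow> p + p' \<in> I"
  using additive_subgroup.a_closed[OF ideal.axioms(1)[OF I_ideal]] by (simp add: F_simps)

lemma I_mult: "p \<in> I \<Longrightarrow> p' \<in> words_over G \<Longrightarrow> p' * p \<in> I" "p \<in> I \<Longrightarrow> p' \<in> words_over G \<Longrightarrow> p * p' \<in> I"
  using ideal.I_l_closed[OF I_ideal] ideal.I_r_closed[OF I_ideal] by (simp_all add: F_simps F_carrier)

lemma const_over: "free_const c \<in> words_over G"
  unfolding free_const_def by (rule over_single) simp

lemma I_const: "p \<in> I \<Longrightarrow> free_const c * p \<in> I"
  by (rule I_mult(1)[OF _ const_over])

lemma const_mult_single: "free_const c * Poly_Mapping.single w d = Poly_Mapping.single w (c * d)"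
  by (simp add: free_const_def mult_single)

lemma I_0: "0 \<in> I"
  using additive_subgroup.zero_closed[OF ideal.axioms(1)[OF I_ideal]] by (simp add: F_simps)

lemma I_minus: "p \<in> I \<Longrightarrow> p' \<in> I \<Longrightarrow> p - p' \<in> I"
proof -
  assume p: "p \<in> I" "p' \<in> I"
  have "free_const (- 1) * p' = - p'"
    by (simp add: free_const_def single_uminus)
  then show ?thesis using I_add[OF p(1) I_const[OF p(2), of "- 1"]] by simp
qed

text \<open>The defining relations in the form in which they are used for straightening: a descent \<open>y, x\<close> is
replaced by \<open>x, y\<close> and possibly a pair whose first letter is smaller than \<open>y\<close>. The letters of the
correction term complete \<open>x\<close> and \<open>y\<close> to a rectangle, so they lie in the diagram.\<close>

lemma swap_relation:
  assumes xy: "x \<in> Y" "y \<in> Y" "x < y"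
  shows "\<exists>c d x' y'. x' \<in> Y \<and> y' \<in> Y \<and> x' < y \<and>
    Poly_Mapping.single (Free_Mon [y, x]) 1 -
      (Poly_Mapping.single (Free_Mon [x, y]) c + Poly_Mapping.single (Free_Mon [x', y']) d) \<in> I"
proof -
  obtain i j s t where e: "x = (i, j)" "y = (s, t)" by (cases x; cases y)
  have b: "i \<in> {1..m}" "s \<in> {1..m}" "j \<in> {1..n}" "t \<in> {1..n}" using xy Y_G e by auto
  have b': "{i, s} \<subseteq> {1..m}" "{j, t} \<subseteq> {1..n}" using b by auto
  consider "i < s" "t < j" | "i = s \<and> j < t \<or> i < s \<and> j = t" | "i < s" "j < t"
    using xy(3) unfolding e less_prod_simp by linarith
  then show ?thesis
  proof cases
    case 1
    have "free_var (i, j) * free_var (s, t) - free_var (s, t) * free_var (i, j) \<in> qmat_relations q m n"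
      unfolding qmat_relations_def Let_def
      by (rule UnI1, rule UnI1, rule CollectI, rule exI[of _ i], rule exI[of _ j], rule exI[of _ s],
        rule exI[of _ t]) (intro conjI refl b' 1)
    then have "Poly_Mapping.single (Free_Mon [x, y]) 1 - Poly_Mapping.single (Free_Mon [y, x]) 1 \<in> I"
      using I_relations unfolding free_var_pair e by blast
    from I_minus[OF I_0 this]
    have "Poly_Mapping.single (Free_Mon [y, x]) 1 -
      (Poly_Mapping.single (Free_Mon [x, y]) 1 + Poly_Mapping.single (Free_Mon [x, y]) 0) \<in> I" by simp
    then show ?thesis using xy by (intro exI[of _ 1] exI[of _ 0] exI[of _ x] exI[of _ y] conjI)
  next
    case 2
    have "free_var (i, j) * free_var (s, t) - free_const q * free_var (s, t) * free_var (i, j) \<in> qmat_relations q m n"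
      unfolding qmat_relations_def Let_def
      by (rule UnI1, rule UnI2, rule CollectI, rule exI[of _ i], rule exI[of _ j], rule exI[of _ s],
        rule exI[of _ t]) (intro conjI refl b' 2)
    then have "Poly_Mapping.single (Free_Mon [x, y]) 1 - Poly_Mapping.single (Free_Mon [y, x]) q \<in> I"
      using I_relations unfolding free_var_pair free_const_pair e by blast
    from I_minus[OF I_0 I_const[OF this, of "inverse q"]]
    have "Poly_Mapping.single (Free_Mon [y, x]) 1 -
      (Poly_Mapping.single (Free_Mon [x, y]) (inverse q) + Poly_Mapping.single (Free_Mon [x, y]) 0) \<in> I"
      using q_nonzero by (simp add: right_diff_distrib const_mult_single)
    then show ?thesis using xy by (intro exI[of _ "inverse q"] exI[of _ 0] exI[of _ x] exI[of _ y] conjI)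
  next
    case 3
    obtain l where l: "l = q - inverse q" by blast
    have "free_var (i, j) * free_var (s, t) - (free_var (s, t) * free_var (i, j) +
        free_const l * free_var (i, t) * free_var (s, j)) \<in> qmat_relations q m n"
      unfolding qmat_relations_def Let_def l
      by (rule UnI2, rule CollectI, rule exI[of _ i], rule exI[of _ j], rule exI[of _ s],
        rule exI[of _ t]) (intro conjI refl b' 3)
    then have "Poly_Mapping.single (Free_Mon [x, y]) 1 - (Poly_Mapping.single (Free_Mon [y, x]) 1 +
        Poly_Mapping.single (Free_Mon [(i, t), (s, j)]) l) \<in> I"
      using I_relations unfolding free_var_pair free_const_pair e by blast
    from I_minus[OF I_0 this]
    have "0 - (Poly_Mapping.single (Free_Mon [x, y]) 1 - (Poly_Mapping.single (Free_Mon [y, x]) 1 +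
        Poly_Mapping.single (Free_Mon [(i, t), (s, j)]) l)) \<in> I" .
    also have "0 - (Poly_Mapping.single (Free_Mon [x, y]) 1 - (Poly_Mapping.single (Free_Mon [y, x]) 1 +
        Poly_Mapping.single (Free_Mon [(i, t), (s, j)]) l)) = Poly_Mapping.single (Free_Mon [y, x]) 1 -
      (Poly_Mapping.single (Free_Mon [x, y]) 1 + Poly_Mapping.single (Free_Mon [(i, t), (s, j)]) (- l))"
      by (simp add: single_uminus algebra_simps)
    finally have "Poly_Mapping.single (Free_Mon [y, x]) 1 -
      (Poly_Mapping.single (Free_Mon [x, y]) 1 + Poly_Mapping.single (Free_Mon [(i, t), (s, j)]) (- l)) \<in> I" .
    moreover have "(i, t) \<in> Y" "(s, j) \<in> Y"
      using Y_corner[of s t i t] Y_corner[of s t s j] xy e b 3 by simp_all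
    moreover have "(i, t) < y" unfolding e using 3 by (simp add: less_prod_simp)
    ultimately show ?thesis by (intro exI[of _ 1] exI[of _ "- l"] exI[of _ "(i, t)"] exI[of _ "(s, j)"] conjI)
  qed
qed

text \<open>Swapping at a descent replaces a word by words of the same length that are lexicographically smaller,
and this order on words of given length is well-founded.\<close>

lemma straighten_word:
  assumes "length xs = k" "set xs \<subseteq> Y"
  shows "\<exists>p\<in>sorted_span Y. Poly_Mapping.single (Free_Mon xs) 1 - p \<in> I"
proof -
  have "wf (lexn {(x, y). x < (y :: nat \<times> nat)} k)" by (rule wf_lexn) (rule wf)
  then show ?thesis using assms
  proof (induction xs rule: wf_induct_rule)
    case (less xs)
    show ?case
    proof (cases "sorted xs")
      case True
      have "(Poly_Mapping.single (Free_Mon xs) 1 :: (nat \<times> nat) free_mon \<Rightarrow>\<^sub>0 'k) \<in> sorted_span Y"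
        unfolding sorted_span_def using True less.prems by simp
      then show ?thesis using I_0 by (intro bexI[of _ "Poly_Mapping.single (Free_Mon xs) 1"]) simp
    next
      case False
      then obtain as x y bs where xs: "xs = as @ [y, x] @ bs" "x < y" by (rule not_sorted_descent)
      have sub: "x \<in> Y" "y \<in> Y" "set as \<subseteq> Y" "set bs \<subseteq> Y" using less.prems xs by simp_all
      obtain c d x' y' where R: "x' \<in> Y" "y' \<in> Y" "x' < y"
        "Poly_Mapping.single (Free_Mon [y, x]) 1 -
          (Poly_Mapping.single (Free_Mon [x, y]) c + Poly_Mapping.single (Free_Mon [x', y']) d) \<in> I"
        using swap_relation[OF sub(1,2) xs(2)] by (elim exE conjE)
      have o: "Poly_Mapping.single (Free_Mon as) 1 \<in> words_over G" "Poly_Mapping.single (Free_Mon bs) 1 \<in> words_over G"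
        using sub Y_G by (auto intro!: over_single)
      have "Poly_Mapping.single (Free_Mon as) 1 * (Poly_Mapping.single (Free_Mon [y, x]) 1 -
          (Poly_Mapping.single (Free_Mon [x, y]) c + Poly_Mapping.single (Free_Mon [x', y']) d)) *
          Poly_Mapping.single (Free_Mon bs) 1 \<in> I"
        by (rule I_mult(2)[OF I_mult(1)[OF R(4) o(1)] o(2)])
      then have E: "Poly_Mapping.single (Free_Mon xs) 1 -
          (Poly_Mapping.single (Free_Mon (as @ [x, y] @ bs)) c + Poly_Mapping.single (Free_Mon (as @ [x', y'] @ bs)) d) \<in> I"
        by (simp add: xs(1) right_diff_distrib left_diff_distrib distrib_left distrib_right mult_single plus_free_mon_def)
      have len: "length as + Suc (length (x # bs)) = k" using less.prems(1) xs(1) by simp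
      have L: "(as @ [x, y] @ bs, xs) \<in> lexn {(x, y). x < y} k" "(as @ [x', y'] @ bs, xs) \<in> lexn {(x, y). x < y} k"
        using lexn_at[of as "y # bs" k "x # bs" x y "{(x, y). x < y}"]
          lexn_at[of as "y' # bs" k "x # bs" x' y "{(x, y). x < y}"] len xs R(3) by simp_all
      obtain p1 where p1: "p1 \<in> sorted_span Y" "Poly_Mapping.single (Free_Mon (as @ [x, y] @ bs)) 1 - p1 \<in> I"
        using less.IH[OF L(1)] less.prems xs sub by auto
      obtain p2 where p2: "p2 \<in> sorted_span Y" "Poly_Mapping.single (Free_Mon (as @ [x', y'] @ bs)) 1 - p2 \<in> I"
        using less.IH[OF L(2)] less.prems xs sub R by auto
      have "Poly_Mapping.single (Free_Mon xs) 1 - (free_const c * p1 + free_const d * p2) \<in> I"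
        using I_add[OF E I_add[OF I_const[OF p1(2), of c] I_const[OF p2(2), of d]]]
        by (simp add: right_diff_distrib const_mult_single algebra_simps)
      moreover have "free_const c * p1 + free_const d * p2 \<in> sorted_span Y"
        by (rule sorted_span_add[OF sorted_span_const[OF p1(1)] sorted_span_const[OF p2(1)]])
      ultimately show ?thesis by blast
    qed
  qed
qed

lemma straighten:
  assumes "p \<in> words_over Y"
  shows "\<exists>p'\<in>sorted_span Y. p - p' \<in> I"
proof -
  have "\<exists>p'\<in>sorted_span Y. (\<Sum>w\<in>A. Poly_Mapping.single w (Poly_Mapping.lookup p w)) - p' \<in> I"
    if "finite A" "A \<subseteq> Poly_Mapping.keys p" for A
    using that
  proof (induction A rule: finite_induct)
    case empty
    show ?case using sorted_span_0 I_0 by (intro bexI[of _ 0]) simp_all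
  next
    case (insert w A)
    obtain p1 where p1: "p1 \<in> sorted_span Y" "(\<Sum>w\<in>A. Poly_Mapping.single w (Poly_Mapping.lookup p w)) - p1 \<in> I"
      using insert.IH insert.prems by auto
    have "set (letters w) \<subseteq> Y" using assms insert.prems unfolding words_over_def by auto
    then obtain p2 where p2: "p2 \<in> sorted_span Y" "Poly_Mapping.single w 1 - p2 \<in> I"
      using straighten_word[of "letters w"] by auto
    let ?c = "Poly_Mapping.lookup p w"
    have "Poly_Mapping.single w ?c + (\<Sum>w\<in>A. Poly_Mapping.single w (Poly_Mapping.lookup p w)) - (free_const ?c * p2 + p1) \<in> I"
      using I_add[OF I_const[OF p2(2), of ?c] p1(2)] by (simp add: right_diff_distrib const_mult_single algebra_simps)
    then show ?case using sorted_span_add[OF sorted_span_const[OF p2(1), of ?c] p1(1)] insert.hyps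
      by (intro bexI[of _ "free_const ?c * p2 + p1"]) simp_all
  qed
  from this[of "Poly_Mapping.keys p"] show ?thesis using pm_expansion[of p] by simp
qed

abbreviation "Qm \<equiv> qmat q m n"
abbreviation "R \<equiv> partition_subalgebra q m n lam"

lemma proj_hom: "ring_hom_ring F Qm \<pi>"
proof -
  have "\<pi> = (+>\<^bsub>F\<^esub>) I" unfolding qmat_proj_def by (rule refl)
  then show ?thesis unfolding qmat_def using ideal.rcos_ring_hom_ring[OF I_ideal] by simp
qed

lemma proj_eq_iff: "p \<in> words_over G \<Longrightarrow> p' \<in> words_over G \<Longrightarrow> \<pi> p = \<pi> p' \<longleftrightarrow> p - p' \<in> I"
  using F.quotient_eq_iff_same_a_r_cos[OF I_ideal, of p p'] free_algebra_minus[of p G p']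
  unfolding qmat_proj_def F_carrier by (simp add: qmat_free_def)

lemma Qm_ring: "ring Qm"
  using ideal.quotient_is_ring[OF I_ideal] unfolding qmat_def by simp

text \<open>Representatives in the free algebra of the generators of the partition subalgebra.\<close>

definition gens :: "((nat \<times> nat) free_mon \<Rightarrow>\<^sub>0 'k) set" where
  "gens = range free_const \<union> free_var ` Y"

lemma gens_over: "gens \<subseteq> words_over Y"
  unfolding gens_def free_const_def free_var_def by (auto intro!: over_single)

lemma R_eq: "R = Qm\<lparr>carrier := generate_ring Qm (\<pi> ` gens)\<rparr>"
proof -
  have "range (\<lambda>c. \<pi> (free_const c)) \<union> {\<pi> (free_var (i, j)) | i j. i \<in> {1..m} \<and> j \<in> {1..lam i}} = \<pi> ` gens"
    unfolding gens_def image_Un image_image Y_def by auto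
  then show ?thesis unfolding partition_subalgebra_def by simp
qed

lemma proj_carrier: "p \<in> words_over G \<Longrightarrow> \<pi> p \<in> carrier Qm"
  using ring_hom_closed[OF ring_hom_ring.homh[OF proj_hom], of p] by (simp add: F_carrier)

lemma proj_simps: "p \<in> words_over G \<Longrightarrow> p' \<in> words_over G \<Longrightarrow> \<pi> p \<oplus>\<^bsub>Qm\<^esub> \<pi> p' = \<pi> (p + p')"
  "p \<in> words_over G \<Longrightarrow> p' \<in> words_over G \<Longrightarrow> \<pi> p \<otimes>\<^bsub>Qm\<^esub> \<pi> p' = \<pi> (p * p')"
  "\<one>\<^bsub>Qm\<^esub> = \<pi> 1"
proof -
  interpret h: ring_hom_ring F Qm \<pi> by (rule proj_hom)
  show "p \<in> words_over G \<Longrightarrow> p' \<in> words_over G \<Longrightarrow> \<pi> p \<oplus>\<^bsub>Qm\<^esub> \<pi> p' = \<pi> (p + p')"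
    using h.hom_add[of p p'] by (simp add: F_carrier F_simps)
  show "p \<in> words_over G \<Longrightarrow> p' \<in> words_over G \<Longrightarrow> \<pi> p \<otimes>\<^bsub>Qm\<^esub> \<pi> p' = \<pi> (p * p')"
    using h.hom_mult[of p p'] by (simp add: F_carrier F_simps)
  show "\<one>\<^bsub>Qm\<^esub> = \<pi> 1" using h.hom_one by (simp add: F_simps)
qed

lemma over_Y_G: "p \<in> words_over Y \<Longrightarrow> p \<in> words_over G"
  by (rule over_mono[OF Y_G])

lemma gens_carrier: "\<pi> ` gens \<subseteq> carrier Qm"
  using gens_over over_Y_G proj_carrier by blast

lemma R_ring: "ring R"
  unfolding R_eq by (rule ring.generate_ring_is_ring[OF Qm_ring gens_carrier])

lemma generated_proj:
  assumes "C \<in> generate_ring Qm (\<pi> ` gens)"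
  shows "\<exists>p\<in>words_over Y. C = \<pi> p"
  using assms
proof induction
  case one
  show ?case unfolding proj_simps(3) by (rule bexI[OF refl over_1])
next
  case (incl h)
  then show ?case using gens_over by blast
next
  case (a_inv h)
  then obtain p where p: "p \<in> words_over Y" "h = \<pi> p" by blast
  interpret h: ring_hom_ring F Qm \<pi> by (rule proj_hom)
  have "\<pi> (- p) \<oplus>\<^bsub>Qm\<^esub> \<pi> p = \<zero>\<^bsub>Qm\<^esub>"
    using proj_simps(1)[OF over_Y_G[OF over_uminus[OF p(1)]] over_Y_G[OF p(1)]] h.hom_zero by (simp add: F_simps)
  then have "\<ominus>\<^bsub>Qm\<^esub> h = \<pi> (- p)" unfolding p(2)
    by (rule h.S.minus_equality) (rule proj_carrier, rule over_Y_G, simp add: over_uminus p(1))+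
  then show ?case using over_uminus[OF p(1)] by blast
next
  case (eng_add h1 h2)
  then obtain p1 p2 where "p1 \<in> words_over Y" "h1 = \<pi> p1" "p2 \<in> words_over Y" "h2 = \<pi> p2" by blast
  then show ?case using proj_simps(1)[OF over_Y_G over_Y_G] over_add by (intro bexI[of _ "p1 + p2"]) simp_all
next
  case (eng_mult h1 h2)
  then obtain p1 p2 where "p1 \<in> words_over Y" "h1 = \<pi> p1" "p2 \<in> words_over Y" "h2 = \<pi> p2" by blast
  then show ?case using proj_simps(2)[OF over_Y_G over_Y_G] over_mult by (intro bexI[of _ "p1 * p2"]) simp_all
qed

lemma R_carrier_proj: "C \<in> carrier R \<Longrightarrow> \<exists>p\<in>sorted_span Y. C = \<pi> p"
proof -
  assume "C \<in> carrier R"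
  then obtain p where p: "p \<in> words_over Y" "C = \<pi> p" unfolding R_eq using generated_proj by auto
  obtain p' where p': "p' \<in> sorted_span Y" "p - p' \<in> I" using straighten[OF p(1)] by blast
  have "\<pi> p = \<pi> p'" using proj_eq_iff[OF over_Y_G[OF p(1)] over_Y_G[OF sorted_span_over[OF p'(1)]]] p'(2) by simp
  then show ?thesis using p(2) p'(1) by blast
qed

end

section \<open>Embedding quantum matrices into a quantum torus\<close>

lemma (in scaled_ring) qrel_cong:
  assumes "\<And>i j. i \<in> I \<Longrightarrow> j \<in> J \<Longrightarrow> eps i j = eps' i j" "qrel I J eps x"
  shows "qrel I J eps' x"
  unfolding qrel_def
proof (intro conjI ballI impI)
  fix i s j t assume "i \<in> I" "s \<in> I" "j \<in> J" "t \<in> J" "i < s \<and> j < t"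
  then show "x i j * x s t = x s t * x i j + sc (if eps' i j then q - r else 0) (x i t * x s j)"
    using qrelD(4)[OF assms(2), of i j s t] assms(1)[of i j] by simp
next
  fix i s j t assume "i \<in> I" "s \<in> I" "j \<in> J" "t \<in> J" "i < s \<and> t < j"
  then show "x i j * x s t = x s t * x i j" using qrelD(3)[OF assms(2), of i j s t] by simp
qed (use qrelD(1,2)[OF assms(2)] in simp_all)

context torus_subalgebra
begin

text \<open>Finitely many central denominators have a common multiple, their product.\<close>

lemma common_multiplier:
  assumes "finite B" "B \<subseteq> D"
  shows "\<exists>z\<in>A. z \<in> torus (rad U) \<and> z \<noteq> 0 \<and> (\<forall>t\<in>B. z * t \<in> A)"
  using assms
proof (induction B rule: finite_induct)
  case empty
  show ?case using A_scalar[of 1] one_central by (intro bexI[of _ 1]) simp_all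
next
  case (insert t B)
  then obtain z where z: "z \<in> A" "z \<in> torus (rad U)" "z \<noteq> 0" "\<forall>t\<in>B. z * t \<in> A" by auto
  have "t \<in> D" using insert.prems by simp
  then obtain w where w: "t \<in> torus U" "w \<in> A" "w \<in> torus (rad U)" "w \<noteq> 0" "w * t \<in> A" by (rule D_E)
  have e: "z * w = w * z" by (rule rad_central[OF z(2) rad_torus[OF w(3)]])
  have "z * w * t' \<in> A" if "t' \<in> insert t B" for t'
  proof (cases "t' = t")
    case True
    then show ?thesis using A_mult[OF z(1) w(5)] by (simp add: mult.assoc)
  next
    case False
    then have "z * t' \<in> A" using that z(4) by simp
    from A_mult[OF w(2) this] show ?thesis unfolding e by (simp add: mult.assoc)
  qed
  moreover have "z * w \<noteq> 0" using torus_domain[OF z(2) w(3)] z(3) w(4) by blast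
  ultimately show ?case using A_mult[OF z(1) w(2)] rad_torus_mult[OF z(2) w(3)]
    by (intro bexI[of _ "z * w"]) simp_all
qed

end

context quantum_matrices
begin

definition e :: "nat \<times> nat \<Rightarrow> (nat \<times> nat) \<Rightarrow>\<^sub>0 int" where "e x = Poly_Mapping.single x 1"

text \<open>The bilinear form that counts only pairs of boxes in one order. So the commutation factor of two
monomials is \<open>q\<close> to the difference \<open>beta u v - beta v u\<close>, without the need for a square root
of \<open>q\<close>.\<close>

definition beta :: "((nat \<times> nat) \<Rightarrow>\<^sub>0 int) \<Rightarrow> ((nat \<times> nat) \<Rightarrow>\<^sub>0 int) \<Rightarrow> int" where
  "beta u v = (\<Sum>x\<in>G. \<Sum>y\<in>G. of_bool (precedes x y) * Poly_Mapping.lookup u x * Poly_Mapping.lookup v y)"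

definition chi :: "((nat \<times> nat) \<Rightarrow>\<^sub>0 int) \<Rightarrow> ((nat \<times> nat) \<Rightarrow>\<^sub>0 int) \<Rightarrow> 'k" where
  "chi u v = q powi beta u v"

lemma beta_add: "beta (u + v) w = beta u w + beta v w" "beta w (u + v) = beta w u + beta w v"
  unfolding beta_def by (simp_all only: lookup_add distrib_left distrib_right sum.distrib)

sublocale T: quantum_torus chi
  by unfold_locales (simp_all add: chi_def beta_add power_int_add q_nonzero)

sublocale S: scaled_ring "op_scale :: 'k \<Rightarrow> ((nat \<times> nat) \<Rightarrow>\<^sub>0 int, 'k) lin_op \<Rightarrow> _" q
  by (rule scaled_ring_op_scale[OF q_nonzero])

lemma lookup_e: "Poly_Mapping.lookup (e x) y = (if y = x then 1 else 0)"
  unfolding e_def by (simp add: lookup_single when_def)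

lemma beta_e: "x \<in> G \<Longrightarrow> y \<in> G \<Longrightarrow> beta (e x) (e y) = of_bool (precedes x y)"
proof -
  assume xy: "x \<in> G" "y \<in> G"
  have "beta (e x) (e y) = (\<Sum>x'\<in>G. if x' = x then (\<Sum>y'\<in>G. if y' = y then of_bool (precedes x y) else 0) else 0)"
    unfolding beta_def lookup_e by (intro sum.cong refl) (simp add: if_distrib cong: if_cong)
  also have "\<dots> = of_bool (precedes x y)" using xy by (simp only: sum.delta finite_cartesian_product finite_atLeastAtMost if_True)
  finally show ?thesis .
qed

lemma M_e_precedes:
  assumes "x \<in> G" "y \<in> G" "precedes x y"
  shows "T.M (e x) * T.M (e y) = op_scale q (T.M (e y) * T.M (e x))"
proof -
  have "\<not> precedes y x" using assms(3) unfolding precedes_def by linarith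
  then have "chi (e y) (e x) = 1" "chi (e x) (e y) = q"
    using assms by (simp_all add: chi_def beta_e)
  then show ?thesis by (simp add: T.M_mult T.sc_sc add.commute)
qed

lemma M_e_commute:
  assumes "x \<in> G" "y \<in> G" "\<not> precedes x y" "\<not> precedes y x"
  shows "T.M (e x) * T.M (e y) = T.M (e y) * T.M (e x)"
  using assms by (simp add: T.M_mult chi_def beta_e add.commute)

text \<open>The positions from \<open>(k, h)\<close> on in the order of reading; at these the correction term has been
installed when the pivots down to \<open>(k, h)\<close> have been treated.\<close>

definition corrected :: "nat \<Rightarrow> nat \<Rightarrow> nat \<Rightarrow> nat \<Rightarrow> bool" where
  "corrected k h i j \<longleftrightarrow> k < i \<or> i = k \<and> h \<le> j"

text \<open>The exponents allowed in \<open>X (i, j)\<close> beside the leading one: they involve only boxes of the rectangle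
with corner \<open>(i, j)\<close>, so that entries at boxes of a Young diagram stay in its torus, and never the
box \<open>(i, j)\<close> itself, so that \<open>M (e (i, j))\<close> can be recovered from monomials of earlier boxes.\<close>

definition lower_exponents :: "nat \<Rightarrow> nat \<Rightarrow> ((nat \<times> nat) \<Rightarrow>\<^sub>0 int) set" where
  "lower_exponents i j = {u. Poly_Mapping.keys u \<subseteq> {1..i} \<times> {1..j} - {(i, j)} \<and> u < e (i, j)}"

text \<open>The invariant of the pivot construction. Row \<open>k\<close> and the rows above it are still monomials, hence the
next pivot is invertible.\<close>

definition pivot_stage :: "nat \<Rightarrow> nat \<Rightarrow> (nat \<Rightarrow> nat \<Rightarrow> ((nat \<times> nat) \<Rightarrow>\<^sub>0 int, 'k) lin_op) \<Rightarrow> bool" where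
  "pivot_stage k h x \<longleftrightarrow> S.qrel {1..m} {1..n} (corrected k h) x \<and>
    (\<forall>i\<in>{1..m}. \<forall>j\<in>{1..n}. x i j - T.M (e (i, j)) \<in> T.torus (lower_exponents i j)) \<and>
    (\<forall>i\<in>{1..m}. \<forall>j\<in>{1..n}. i \<le> k \<longrightarrow> x i j = T.M (e (i, j)))"

lemma pivot_stage_start: "pivot_stage m (Suc n) (\<lambda>i j. T.M (e (i, j)))"
proof -
  let ?x = "\<lambda>i j. T.M (e (i, j))"
  have "S.qrel {1..m} {1..n} (corrected m (Suc n)) ?x"
    unfolding S.qrel_def
  proof (intro conjI ballI impI)
    fix i j t assume "i \<in> {1..m}" "j \<in> {1..n}" "t \<in> {1..n}" "j < t"
    then show "?x i j * ?x i t = op_scale q (?x i t * ?x i j)"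
      by (intro M_e_precedes) (simp_all add: precedes_def)
  next
    fix i s j assume "i \<in> {1..m}" "s \<in> {1..m}" "j \<in> {1..n}" "i < s"
    then show "?x i j * ?x s j = op_scale q (?x s j * ?x i j)"
      by (intro M_e_precedes) (simp_all add: precedes_def)
  next
    fix i s j t assume "i \<in> {1..m}" "s \<in> {1..m}" "j \<in> {1..n}" "t \<in> {1..n}" "i < s \<and> t < j"
    then show "?x i j * ?x s t = ?x s t * ?x i j"
      by (intro M_e_commute) (simp_all add: precedes_def)
  next
    fix i s j t assume H: "i \<in> {1..m}" "s \<in> {1..m}" "j \<in> {1..n}" "t \<in> {1..n}" "i < s \<and> j < t"
    then have "?x i j * ?x s t = ?x s t * ?x i j"
      by (intro M_e_commute) (simp_all add: precedes_def)
    moreover have "\<not> corrected m (Suc n) i j" using H unfolding corrected_def by simp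
    ultimately show "?x i j * ?x s t = ?x s t * ?x i j +
        op_scale (if corrected m (Suc n) i j then q - inverse q else 0) (?x i t * ?x s j)" by simp
  qed
  then show ?thesis unfolding pivot_stage_def by simp
qed

text \<open>The exponents are compared at the first box in which they differ. That is the pivot \<open>(k, h)\<close>, where
the new exponent is \<open>-1\<close>.\<close>

lemma pivot_exponent_less:
  assumes "k < i" "h < j"
  shows "e (i, h) + (e (k, j) - e (k, h)) < e (i, j)"
  unfolding less_poly_mapping.rep_eq less_fun_def
proof (intro exI[of _ "(k, h)"] conjI allI impI)
  show "Poly_Mapping.lookup (e (i, h) + (e (k, j) - e (k, h))) (k, h) < Poly_Mapping.lookup (e (i, j)) (k, h)"
    using assms by (simp add: lookup_add lookup_minus lookup_e)
  fix z assume "z < (k, h)"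
  then have "z \<noteq> (i, h)" "z \<noteq> (k, j)" "z \<noteq> (k, h)" "z \<noteq> (i, j)"
    using assms by auto
  then show "Poly_Mapping.lookup (e (i, h) + (e (k, j) - e (k, h))) z = Poly_Mapping.lookup (e (i, j)) z"
    by (simp add: lookup_add lookup_minus lookup_e)
qed

text \<open>Pivoting at \<open>(k, h)\<close> adds to the entry at \<open>(i, j)\<close> terms with exponents at most
\<open>e (i, h) + e (k, j) - e (k, h)\<close>, hence below \<open>e (i, j)\<close>.\<close>

lemma pivot_stage_step:
  assumes g: "pivot_stage k (Suc h) x" and k: "k \<in> {1..m}" and h: "h \<in> {1..n}"
  shows "\<exists>x'. pivot_stage k h x'"
proof -
  \<comment> \<open>the inverse of the pivot\<close>
  define P where "P = op_scale (inverse (chi (e (k, h)) (- e (k, h)))) (T.M (- e (k, h)))"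
  have rel: "S.qrel {1..m} {1..n} (corrected k (Suc h)) x"
    and low: "\<And>i j. i \<in> {1..m} \<Longrightarrow> j \<in> {1..n} \<Longrightarrow> x i j - T.M (e (i, j)) \<in> T.torus (lower_exponents i j)"
    and top: "\<And>i j. i \<in> {1..m} \<Longrightarrow> j \<in> {1..n} \<Longrightarrow> i \<le> k \<Longrightarrow> x i j = T.M (e (i, j))"
    using g unfolding pivot_stage_def by blast+
  have xkh: "x k h = T.M (e (k, h))" by (rule top[OF k h le_refl])
  have step: "pivot_step op_scale q {1..m} {1..n} (corrected k (Suc h)) x k h P"
  proof
    show "S.qrel {1..m} {1..n} (corrected k (Suc h)) x" by (rule rel)
    show "k \<in> {1..m}" "h \<in> {1..n}" by (rule k, rule h)
    show "x k h * P = 1" "P * x k h = 1" unfolding xkh P_def by (rule T.M_inverse)+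
    fix i j
    show "k \<le> i \<Longrightarrow> h \<le> j \<Longrightarrow> (i, j) \<noteq> (k, h) \<Longrightarrow> corrected k (Suc h) i j"
      unfolding corrected_def prod.inject by linarith
    show "i \<le> k \<Longrightarrow> j \<le> h \<Longrightarrow> \<not> corrected k (Suc h) i j"
      unfolding corrected_def by linarith
  qed
  let ?x = "S.pivoted k h P x"
  have "S.qrel {1..m} {1..n} (corrected k h) ?x"
  proof (rule S.qrel_cong[OF _ S.qrel_pivoted[OF step]])
    fix i j show "(corrected k (Suc h) i j \<or> (i, j) = (k, h)) = corrected k h i j"
      unfolding corrected_def prod.inject by linarith
  qed
  moreover have "?x i j = T.M (e (i, j))" if "i \<in> {1..m}" "j \<in> {1..n}" "i \<le> k" for i j
    using top[OF that] that(3) by (simp add: S.pivoted_def)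
  moreover have "?x i j - T.M (e (i, j)) \<in> T.torus (lower_exponents i j)" if ij: "i \<in> {1..m}" "j \<in> {1..n}" for i j
  proof (cases "k < i \<and> h < j")
    case False
    then show ?thesis using low[OF ij] by (auto simp: S.pivoted_def)
  next
    case True
    \<comment> \<open>exponents of the factor \<open>x i h\<close>, and the exponent of \<open>P * x k j\<close>\<close>
    let ?W = "{u. Poly_Mapping.keys u \<subseteq> {1..i} \<times> {1..h} \<and> u \<le> e (i, h)}"
    let ?c = "e (k, j) - e (k, h)"
    have "lower_exponents i h \<subseteq> ?W" unfolding lower_exponents_def by (auto intro: less_imp_le)
    then have "x i h - T.M (e (i, h)) \<in> T.torus ?W" by (rule subsetD[OF T.torus_mono low[OF ij(1) h]])
    moreover have "T.M (e (i, h)) \<in> T.torus ?W"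
      by (rule T.torus_M(2)) (use ij h in \<open>simp add: e_def\<close>)
    ultimately have "x i h - T.M (e (i, h)) + T.M (e (i, h)) \<in> T.torus ?W" by (rule T.torus_add)
    then have xih: "x i h \<in> T.torus ?W" by simp
    have Pkj: "P * x k j \<in> T.torus {?c}"
      unfolding P_def top[OF k ij(2) le_refl]
      by (simp add: T.sc_mult_left T.M_mult T.sc_sc) (rule T.torus_M(1), simp)
    have "x i h * (P * x k j) \<in> T.torus (lower_exponents i j)"
    proof (rule T.torus_mult[OF xih Pkj])
      fix u v assume u: "u \<in> ?W" and "v \<in> {?c}"
      then have v: "v = ?c" by simp
      have "u + v \<le> e (i, h) + ?c" using u v by simp
      then have "u + v < e (i, j)" using pivot_exponent_less[of k i h j] True by simp
      moreover have "Poly_Mapping.keys (u + v) \<subseteq> {1..i} \<times> {1..j} - {(i, j)}"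
      proof
        fix z assume "z \<in> Poly_Mapping.keys (u + v)"
        then have "Poly_Mapping.lookup u z + Poly_Mapping.lookup ?c z \<noteq> 0" by (simp add: in_keys_iff lookup_add v)
        then have "z \<in> Poly_Mapping.keys u \<or> z = (k, j) \<or> z = (k, h)"
          by (auto simp: in_keys_iff lookup_minus lookup_e split: if_splits)
        then show "z \<in> {1..i} \<times> {1..j} - {(i, j)}" using u True k h ij by fastforce
      qed
      ultimately show "u + v \<in> lower_exponents i j" unfolding lower_exponents_def by simp
    qed
    then have "x i j - T.M (e (i, j)) + x i h * (P * x k j) \<in> T.torus (lower_exponents i j)"
      by (rule T.torus_add[OF low[OF ij]])
    moreover have "?x i j - T.M (e (i, j)) = x i j - T.M (e (i, j)) + x i h * (P * x k j)"
      using True by (simp add: S.pivoted_def mult.assoc)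
    ultimately show ?thesis by (simp only:)
  qed
  ultimately have "pivot_stage k h ?x" unfolding pivot_stage_def by simp
  then show ?thesis by blast
qed

lemma pivot_stage_row:
  assumes "\<exists>x. pivot_stage k (Suc n) x" "k \<in> {1..m}"
  shows "\<exists>x. pivot_stage (k - 1) (Suc n) x"
proof -
  have "\<exists>x. pivot_stage k (Suc (n - d)) x" if "d \<le> n" for d
    using that
  proof (induction d)
    case 0
    then show ?case using assms(1) by simp
  next
    case (Suc d)
    then obtain x where "pivot_stage k (Suc (n - d)) x" by auto
    moreover have "n - d \<in> {1..n}" using Suc.prems by auto
    ultimately have "\<exists>x. pivot_stage k (n - d) x" by (rule pivot_stage_step[OF _ assms(2)])
    moreover have "n - d = Suc (n - Suc d)" using Suc.prems by simp
    ultimately show ?case by simp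
  qed
  from this[of n] obtain x where x: "pivot_stage k 1 x" by auto
  have "S.qrel {1..m} {1..n} (corrected (k - 1) (Suc n)) x"
  proof (rule S.qrel_cong)
    show "S.qrel {1..m} {1..n} (corrected k 1) x" using x unfolding pivot_stage_def by blast
    fix i j assume "i \<in> {1..m}" "j \<in> {1..n}"
    then show "corrected k 1 i j = corrected (k - 1) (Suc n) i j"
      using assms(2) unfolding corrected_def atLeastAtMost_iff by arith
  qed
  then have "pivot_stage (k - 1) (Suc n) x" using x unfolding pivot_stage_def by simp
  then show ?thesis by blast
qed

lemma pivot_stage_end: "\<exists>x. pivot_stage 0 (Suc n) x"
proof -
  have "\<exists>x. pivot_stage (m - d) (Suc n) x" if "d \<le> m" for d
    using that
  proof (induction d)
    case 0
    show ?case using pivot_stage_start by auto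
  next
    case (Suc d)
    have "\<exists>x. pivot_stage (m - d - 1) (Suc n) x"
      by (rule pivot_stage_row) (use Suc in auto)
    then show ?case by simp
  qed
  from this[of m] show ?thesis by simp
qed

definition X :: "nat \<times> nat \<Rightarrow> ((nat \<times> nat) \<Rightarrow>\<^sub>0 int, 'k) lin_op" where
  "X x = (SOME x. pivot_stage 0 (Suc n) x) (fst x) (snd x)"

lemma X_rel: "S.qrel {1..m} {1..n} (\<lambda>i j. True) (\<lambda>i j. X (i, j))"
  and X_low: "x \<in> G \<Longrightarrow> X x - T.M (e x) \<in> T.torus (lower_exponents (fst x) (snd x))"
proof -
  have g: "pivot_stage 0 (Suc n) (\<lambda>i j. X (i, j))"
    using someI_ex[OF pivot_stage_end] unfolding X_def by simp
  show "S.qrel {1..m} {1..n} (\<lambda>i j. True) (\<lambda>i j. X (i, j))"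
  proof (rule S.qrel_cong)
    show "S.qrel {1..m} {1..n} (corrected 0 (Suc n)) (\<lambda>i j. X (i, j))" using g unfolding pivot_stage_def by blast
  qed (simp add: corrected_def)
  assume x: "x \<in> G"
  then have "fst x \<in> {1..m}" "snd x \<in> {1..n}" by auto
  then have "X (fst x, snd x) - T.M (e (fst x, snd x)) \<in> T.torus (lower_exponents (fst x) (snd x))"
    using g unfolding pivot_stage_def by blast
  then show "X x - T.M (e x) \<in> T.torus (lower_exponents (fst x) (snd x))" by simp
qed

lemma ev_pair: "S.ev X (free_var x * free_var y) = X x * X y"
  "S.ev X (free_const c * free_var x * free_var y) = op_scale c (X x * X y)"
  unfolding free_var_pair free_const_pair S.ev_single by simp_all

lemma ev_relation: "s \<in> qmat_relations q m n \<Longrightarrow> S.ev X s = 0"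
proof -
  assume "s \<in> qmat_relations q m n"
  then show ?thesis unfolding qmat_relations_def Let_def
  proof (elim UnE CollectE exE conjE)
    fix i j s' t assume H: "s = free_var (i, j) * free_var (s', t) - free_var (s', t) * free_var (i, j)"
      "{i, s'} \<subseteq> {1..m}" "{j, t} \<subseteq> {1..n}" "i < s'" "t < j"
    show ?thesis unfolding H(1) S.ev_minus ev_pair
      using S.qrelD(3)[OF X_rel, of i j s' t] H by simp
  next
    fix i j s' t assume H: "s = free_var (i, j) * free_var (s', t) - free_const q * free_var (s', t) * free_var (i, j)"
      "{i, s'} \<subseteq> {1..m}" "{j, t} \<subseteq> {1..n}" "i = s' \<and> j < t \<or> i < s' \<and> j = t"
    have "X (i, j) * X (s', t) = op_scale q (X (s', t) * X (i, j))"
      using H(4)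
    proof
      assume "i = s' \<and> j < t"
      then show ?thesis using S.qrelD(1)[OF X_rel, of i j t] H(2,3) by simp
    next
      assume "i < s' \<and> j = t"
      then show ?thesis using S.qrelD(2)[OF X_rel, of i j s'] H(2,3) by simp
    qed
    then show ?thesis unfolding H(1) S.ev_minus ev_pair by simp
  next
    fix i j s' t assume H: "s = free_var (i, j) * free_var (s', t) - (free_var (s', t) * free_var (i, j) +
        free_const (q - inverse q) * free_var (i, t) * free_var (s', j))"
      "{i, s'} \<subseteq> {1..m}" "{j, t} \<subseteq> {1..n}" "i < s'" "j < t"
    show ?thesis unfolding H(1) S.ev_minus S.ev_add ev_pair
      using S.qrelD(5)[OF X_rel, of i j s' t] H by simp
  qed
qed

lemma ev_I: "p \<in> I \<Longrightarrow> S.ev X p = 0"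
  unfolding qmat_ideal_def qmat_free_def by (rule S.ev_genideal[OF relations_over ev_relation])

text \<open>Evaluation at \<open>X\<close> vanishes on the ideal of relations, so any representative of the coset serves.\<close>

definition phi where "phi C = S.ev X (SOME p. p \<in> words_over G \<and> C = \<pi> p)"

lemma phi_proj: assumes p: "p \<in> words_over G" shows "phi (\<pi> p) = S.ev X p"
proof -
  define p' where "p' = (SOME p'. p' \<in> words_over G \<and> \<pi> p = \<pi> p')"
  have p': "p' \<in> words_over G \<and> \<pi> p = \<pi> p'" unfolding p'_def by (rule someI[of _ p]) (rule conjI[OF p refl])
  then have "p - p' \<in> I" using proj_eq_iff[OF p] by blast
  from ev_I[OF this] have "S.ev X p = S.ev X p'" by (simp add: S.ev_minus)
  then show ?thesis unfolding phi_def p'_def[symmetric] by simp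
qed

definition U :: "((nat \<times> nat) \<Rightarrow>\<^sub>0 int) set" where "U = {u. Poly_Mapping.keys u \<subseteq> Y}"

lemma U_closed: "0 \<in> U" "u \<in> U \<Longrightarrow> v \<in> U \<Longrightarrow> u + v \<in> U" "u \<in> U \<Longrightarrow> - u \<in> U" "x \<in> Y \<Longrightarrow> e x \<in> U"
  using keys_add[of u v] unfolding U_def by (auto simp: e_def)

lemma lower_U: "x \<in> Y \<Longrightarrow> lower_exponents (fst x) (snd x) \<subseteq> U"
proof
  fix u assume x: "x \<in> Y" and u: "u \<in> lower_exponents (fst x) (snd x)"
  have xx: "(fst x, snd x) \<in> Y" using x by simp
  have "z \<in> Y" if "z \<in> Poly_Mapping.keys u" for z
  proof -
    have "z \<in> {1..fst x} \<times> {1..snd x}" using u that unfolding lower_exponents_def by blast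
    then show ?thesis using Y_corner[OF xx, of "fst z" "snd z"] by (cases z) simp
  qed
  then show "u \<in> U" unfolding U_def by blast
qed

lemma U_mult: "x \<in> T.torus U \<Longrightarrow> y \<in> T.torus U \<Longrightarrow> x * y \<in> T.torus U"
  by (rule T.torus_mult[of x U y U]) (simp_all add: U_closed)

lemma X_torus: "x \<in> Y \<Longrightarrow> X x \<in> T.torus U"
proof -
  assume x: "x \<in> Y"
  then have "X x - T.M (e x) \<in> T.torus U" using X_low[of x] Y_G lower_U[OF x] T.torus_mono by blast
  from T.torus_add[OF this T.torus_M(2)[OF U_closed(4)[OF x]]] show ?thesis by simp
qed

lemma ev_torus: "p \<in> words_over Y \<Longrightarrow> S.ev X p \<in> T.torus U"
proof -
  assume p: "p \<in> words_over Y"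
  have "prod_list (map X xs) \<in> T.torus U" if "set xs \<subseteq> Y" for xs
    using that
  proof (induction xs)
    case Nil
    show ?case using T.torus_M(2)[OF U_closed(1)] by simp
  next
    case (Cons x xs)
    then show ?case using U_mult[OF X_torus] by simp
  qed
  then show ?thesis unfolding S.ev_def
    by (intro T.torus_sum T.torus_sc) (use p in \<open>simp add: words_over_def\<close>)
qed

lemma X_leads: "x \<in> G \<Longrightarrow> T.leads (X x) (e x)"
proof -
  assume x: "x \<in> G"
  have t: "X x - T.M (e x) \<in> T.torus UNIV" using X_low[OF x] T.torus_mono[of _ UNIV] by blast
  have "w < e x" if "w \<in> T.supp (X x - T.M (e x))" for w
    using T.torus_expansion(2)[OF X_low[OF x]] that unfolding lower_exponents_def by auto
  from T.leads_add[OF T.leads_M t this] show ?thesis by simp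
qed

lemma prod_leads: "set xs \<subseteq> G \<Longrightarrow> T.leads (prod_list (map X xs)) (sum_list (map e xs))"
proof (induction xs)
  case Nil
  show ?case using T.leads_M[of 0] by simp
next
  case (Cons x xs)
  then show ?case using T.leads_mult[OF X_leads] by simp
qed

text \<open>A sorted word is determined by its letters with multiplicities, and the leading exponent records
these.\<close>

lemma content_inj:
  assumes "sorted xs" "sorted ys" "sum_list (map e xs) = sum_list (map e ys)"
  shows "xs = ys"
proof -
  have "Poly_Mapping.lookup (sum_list (map e xs)) z = int (count (mset xs) z)" for xs z
    by (induction xs) (simp_all add: lookup_add lookup_e)
  then have "int (count (mset xs) z) = int (count (mset ys) z)" for z using assms(3) by metis
  then have "mset xs = mset ys" by (intro multiset_eqI) simp
  then show ?thesis using assms(1,2) by (metis properties_for_sort)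
qed

text \<open>The leading exponents of distinct sorted words are distinct, so the largest one survives in every
nontrivial combination. Together with straightening this gives injectivity on the partition
subalgebra, and the linear independence of standard monomials along with it.\<close>

lemma ev_nonzero:
  assumes p: "p \<in> sorted_span Y" and nz: "p \<noteq> 0"
  shows "S.ev X p \<noteq> 0"
proof -
  let ?K = "Poly_Mapping.keys p"
  let ?c = "\<lambda>w. sum_list (map e (letters w))"
  let ?f = "\<lambda>w. op_scale (Poly_Mapping.lookup p w) (prod_list (map X (letters w)))"
  have K: "finite (?c ` ?K)" "?c ` ?K \<noteq> {}" using nz by auto
  obtain w0 where w0: "w0 \<in> ?K" "?c w0 = Max (?c ` ?K)" using Max_in[OF K] by auto
  have G: "set (letters w) \<subseteq> G" "sorted (letters w)" if "w \<in> ?K" for w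
    using p that Y_G unfolding sorted_span_def by auto
  have less: "?c w < ?c w0" if "w \<in> ?K - {w0}" for w
  proof -
    have "?c w \<le> ?c w0" unfolding w0(2) using that K(1) by (intro Max_ge) auto
    moreover have "?c w \<noteq> ?c w0"
    proof
      assume "?c w = ?c w0"
      then have "letters w = letters w0" using content_inj G(2)[of w] G(2)[OF w0(1)] that by simp
      then show False using that by (simp add: free_mon.expand)
    qed
    ultimately show ?thesis by simp
  qed
  have leads: "T.leads (?f w) (?c w)" if "w \<in> ?K" for w
    by (rule T.leads_sc[OF _ prod_leads[OF G(1)[OF that]]]) (use that in \<open>simp add: in_keys_iff\<close>)
  have t: "?f w \<in> T.torus UNIV" if "w \<in> ?K" for w using leads[OF that] unfolding T.leads_def by blast
  have "T.leads (?f w0 + sum ?f (?K - {w0})) (?c w0)"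
  proof (rule T.leads_add[OF leads[OF w0(1)]])
    show "sum ?f (?K - {w0}) \<in> T.torus UNIV" by (rule T.torus_sum) (simp add: t)
    fix u assume "u \<in> T.supp (sum ?f (?K - {w0}))"
    then have "(\<Sum>w\<in>?K - {w0}. coef (?f w) u) \<noteq> 0" unfolding T.supp_def coef_sum by simp
    then obtain w where w: "w \<in> ?K - {w0}" "coef (?f w) u \<noteq> 0" by (rule sum.not_neutral_contains_not_neutral)
    then have "u \<le> ?c w" using leads[of w] unfolding T.leads_def T.supp_def by simp
    then show "u < ?c w0" using less[OF w(1)] by simp
  qed
  moreover have "S.ev X p = ?f w0 + sum ?f (?K - {w0})"
    unfolding S.ev_def by (rule sum.remove[OF finite_keys w0(1)])
  ultimately show ?thesis using T.leads_nonzero by simp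
qed

lemma R_obtain:
  assumes "C \<in> carrier R"
  obtains p where "p \<in> sorted_span Y" "p \<in> words_over G" "p \<in> words_over Y" "C = \<pi> p" "phi C = S.ev X p"
proof -
  obtain p where p: "p \<in> sorted_span Y" "C = \<pi> p" using R_carrier_proj[OF assms] by blast
  have w: "p \<in> words_over Y" by (rule sorted_span_over[OF p(1)])
  have "phi C = S.ev X p" unfolding p(2) by (rule phi_proj[OF over_Y_G[OF w]])
  then show ?thesis by (rule that[OF p(1) over_Y_G[OF w] w p(2)])
qed

text \<open>Elements are represented by sorted combinations, on which evaluation is injective; the absence of zero
divisors is inherited from the torus.\<close>

lemma R_embedded: "embedded_domain R phi"
proof -
  have ops: "mult R = mult Qm" "add R = add Qm" "one R = one Qm" unfolding R_eq by simp_all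
  interpret ring R by (rule R_ring)
  show ?thesis
  proof
    fix C C' assume C: "C \<in> carrier R" "C' \<in> carrier R"
    obtain p where p: "p \<in> sorted_span Y" "p \<in> words_over G" "p \<in> words_over Y" "C = \<pi> p" "phi C = S.ev X p"
      using C(1) by (rule R_obtain)
    obtain p' where p': "p' \<in> sorted_span Y" "p' \<in> words_over G" "p' \<in> words_over Y" "C' = \<pi> p'" "phi C' = S.ev X p'"
      using C(2) by (rule R_obtain)
    show "phi (C \<otimes>\<^bsub>R\<^esub> C') = phi C * phi C'"
      unfolding ops p(4) p'(4) proj_simps(2)[OF p(2) p'(2)] phi_proj[OF over_mult[OF p(2) p'(2)]]
        phi_proj[OF p(2)] phi_proj[OF p'(2)] by (rule S.ev_mult)
    show "phi (C \<oplus>\<^bsub>R\<^esub> C') = phi C + phi C'"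
      unfolding ops p(4) p'(4) proj_simps(1)[OF p(2) p'(2)] phi_proj[OF over_add[OF p(2) p'(2)]]
        phi_proj[OF p(2)] phi_proj[OF p'(2)] by (rule S.ev_add)
    show "C = C'" if "phi C = phi C'"
    proof -
      have "S.ev X (p - p') = 0" using that p(5) p'(5) by (simp add: S.ev_minus)
      moreover have "p - p' \<in> sorted_span Y"
      proof -
        have "- p' \<in> sorted_span Y" using p'(1) unfolding sorted_span_def by simp
        from sorted_span_add[OF p(1) this] show ?thesis by simp
      qed
      ultimately have "p - p' = 0" using ev_nonzero by blast
      then show "C = C'" using p(4) p'(4) by simp
    qed
    show "phi C = 0 \<or> phi C' = 0" if "phi C * phi C' = 0"
      using T.torus_domain[OF ev_torus[OF p(3)] ev_torus[OF p'(3)]] that p(5) p'(5) by simp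
  next
    show "phi \<one>\<^bsub>R\<^esub> = 1" unfolding ops proj_simps(3) phi_proj[OF over_1] by simp
  qed
qed

lemma gens_image: "g \<in> gens \<Longrightarrow> S.ev X g \<in> phi ` carrier R"
proof -
  assume g: "g \<in> gens"
  then have "\<pi> g \<in> carrier R" unfolding R_eq by (simp add: generate_ring.incl)
  moreover have "phi (\<pi> g) = S.ev X g" using g gens_over over_Y_G by (intro phi_proj) blast
  ultimately show ?thesis by (metis imageI)
qed

end

section \<open>Counting and conclusion\<close>

lemma card_equal_fibres:
  assumes "finite P" "\<And>c. c \<in> f ` P \<Longrightarrow> card {v \<in> P. f v = c} = K"
  shows "card P = card (f ` P) * K"
proof -
  have "P = (\<Union>c\<in>f ` P. {v \<in> P. f v = c})" by auto
  then have "card P = card (\<Union>c\<in>f ` P. {v \<in> P. f v = c})" by simp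
  also have "\<dots> = (\<Sum>c\<in>f ` P. card {v \<in> P. f v = c})"
    by (rule card_UN_disjoint) (use assms(1) in auto)
  also have "\<dots> = card (f ` P) * K" using assms(2) by simp
  finally show ?thesis .
qed

text \<open>Image and kernel of a linear map modulo \<open>l\<close>: every fibre is a translate of the kernel.\<close>

lemma card_image_mod_linear:
  fixes b :: "'x \<Rightarrow> 'x \<Rightarrow> int" and l :: int
  assumes fin: "finite Y" and l: "l > 0"
  defines "P \<equiv> Y \<rightarrow>\<^sub>E {0..<l}"
    and "g \<equiv> \<lambda>v. (\<lambda>y\<in>Y. (\<Sum>x\<in>Y. b x y * v x) mod l)"
  shows "card (g ` P) * card {v \<in> P. \<forall>y\<in>Y. l dvd (\<Sum>x\<in>Y. b x y * v x)} = nat l ^ card Y"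
proof -
  let ?K = "{v \<in> P. \<forall>y\<in>Y. l dvd (\<Sum>x\<in>Y. b x y * v x)}"
  have finP: "finite P" unfolding P_def by (rule finite_PiE[OF fin]) simp
  have g_eq: "g v = g w \<longleftrightarrow> (\<forall>y\<in>Y. [(\<Sum>x\<in>Y. b x y * v x) = (\<Sum>x\<in>Y. b x y * w x)] (mod l))" for v w
    unfolding g_def cong_def by (auto simp: fun_eq_iff restrict_def)
  have sum_cong_mod: "[(\<Sum>x\<in>Y. b x y * v x) = (\<Sum>x\<in>Y. b x y * w x)] (mod l)"
    if "\<And>x. x \<in> Y \<Longrightarrow> [v x = w x] (mod l)" for v w y
    by (intro cong_sum cong_scalar_left that)
  have fibre: "card {v \<in> P. g v = c} = card ?K" if cP: "c \<in> g ` P" for c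
  proof -
    obtain v0 where v0: "v0 \<in> P" "c = g v0" using cP by blast
    \<comment> \<open>translation by a point of the fibre\<close>
    let ?f = "\<lambda>v. \<lambda>x\<in>Y. (v x - v0 x) mod l" and ?h = "\<lambda>k. \<lambda>x\<in>Y. (k x + v0 x) mod l"
    have rng: "(\<lambda>x\<in>Y. a x mod l) \<in> P" for a unfolding P_def using l by auto
    have small: "v x mod l = v x" if "v \<in> P" "x \<in> Y" for v x
      using that unfolding P_def by (auto simp: PiE_def Pi_def)
    have out: "v x = undefined" if "v \<in> P" "x \<notin> Y" for v x
      using that unfolding P_def PiE_def extensional_def by simp
    have "bij_betw ?f {v \<in> P. g v = c} ?K"
    proof (rule bij_betw_byWitness[where f' = ?h])
      show "\<forall>v\<in>{v \<in> P. g v = c}. ?h (?f v) = v"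
      proof (intro ballI ext)
        fix v x assume "v \<in> {v \<in> P. g v = c}"
        then have v: "v \<in> P" by simp
        show "?h (?f v) x = v x"
          using small[OF v, of x] out[OF v, of x] by (cases "x \<in> Y") (simp_all add: mod_add_left_eq)
      qed
      show "\<forall>k\<in>?K. ?f (?h k) = k"
      proof (intro ballI ext)
        fix k x assume "k \<in> ?K"
        then have k: "k \<in> P" by simp
        show "?f (?h k) x = k x"
          using small[OF k, of x] out[OF k, of x] by (cases "x \<in> Y") (simp_all add: mod_diff_left_eq)
      qed
      show "?f ` {v \<in> P. g v = c} \<subseteq> ?K"
      proof (intro image_subsetI)
        fix v assume "v \<in> {v \<in> P. g v = c}"
        then have v: "v \<in> P" "g v = g v0" using v0 by simp_all
        have "l dvd (\<Sum>x\<in>Y. b x y * ?f v x)" if y: "y \<in> Y" for y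
        proof -
          have "[(\<Sum>x\<in>Y. b x y * ?f v x) = (\<Sum>x\<in>Y. b x y * (v x - v0 x))] (mod l)"
            by (rule sum_cong_mod) (simp add: cong_def)
          moreover have "(\<Sum>x\<in>Y. b x y * (v x - v0 x)) = (\<Sum>x\<in>Y. b x y * v x) - (\<Sum>x\<in>Y. b x y * v0 x)"
            by (simp only: right_diff_distrib sum_subtractf)
          moreover have "l dvd (\<Sum>x\<in>Y. b x y * v x) - (\<Sum>x\<in>Y. b x y * v0 x)"
            using v(2) y unfolding g_eq by (simp add: cong_iff_dvd_diff)
          ultimately show ?thesis using cong_dvd_iff by metis
        qed
        then show "?f v \<in> ?K" using rng by simp
      qed
      show "?h ` ?K \<subseteq> {v \<in> P. g v = c}"
      proof (intro image_subsetI)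
        fix k assume k: "k \<in> ?K"
        have "g (?h k) = g v0"
          unfolding g_eq
        proof
          fix y assume y: "y \<in> Y"
          have "[(\<Sum>x\<in>Y. b x y * ?h k x) = (\<Sum>x\<in>Y. b x y * (k x + v0 x))] (mod l)"
            by (rule sum_cong_mod) (simp add: cong_def)
          also have "(\<Sum>x\<in>Y. b x y * (k x + v0 x)) = (\<Sum>x\<in>Y. b x y * k x) + (\<Sum>x\<in>Y. b x y * v0 x)"
            by (simp only: distrib_left sum.distrib)
          also have "[\<dots> = 0 + (\<Sum>x\<in>Y. b x y * v0 x)] (mod l)"
            using k y by (intro cong_add cong_refl) (simp add: cong_0_iff)
          finally show "[(\<Sum>x\<in>Y. b x y * ?h k x) = (\<Sum>x\<in>Y. b x y * v0 x)] (mod l)" by simp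
        qed
        then show "?h k \<in> {v \<in> P. g v = c}" using rng v0 by simp
      qed
    qed
    then show ?thesis by (rule bij_betw_same_card)
  qed
  have "card P = nat l ^ card Y" unfolding P_def using fin by (simp add: card_PiE)
  then show ?thesis using card_equal_fibres[OF finP fibre] by simp
qed

locale quantum_matrices_at_root = quantum_matrices q m n lam
  for q :: "'k::field" and m n :: nat and lam :: "nat \<Rightarrow> nat" +
  fixes l :: nat
  assumes root: "primitive_root l q"
begin

lemma l_pos: "l > 0" and q_l: "q ^ l = 1" and q_min: "0 < k \<Longrightarrow> k < l \<Longrightarrow> q ^ k \<noteq> 1"
  using root unfolding primitive_root_def by simp_all

lemma powi_eq_1_iff: "q powi c = 1 \<longleftrightarrow> int l dvd c"
proof -
  have "c = int l * (c div int l) + c mod int l" by simp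
  then have "q powi c = q powi (int l * (c div int l)) * q powi (c mod int l)"
    using power_int_add[of q "int l * (c div int l)" "c mod int l"] q_nonzero by simp
  also have "q powi (int l * (c div int l)) = 1"
    using q_l by (simp add: power_int_mult)
  also have "q powi (c mod int l) = q ^ nat (c mod int l)"
    using l_pos by (simp add: power_int_def)
  finally have e: "q powi c = q ^ nat (c mod int l)" by simp
  have "nat (c mod int l) < l" using l_pos by (simp add: nat_less_iff)
  then have "q ^ nat (c mod int l) = 1 \<longleftrightarrow> nat (c mod int l) = 0"
    using q_min[of "nat (c mod int l)"] by (cases "nat (c mod int l) = 0") simp_all
  also have "\<dots> \<longleftrightarrow> c mod int l = 0" using l_pos by (simp add: order_antisym_conv)
  finally show ?thesis unfolding e by (simp add: dvd_eq_mod_eq_0)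
qed

lemma powi_eq_iff: "q powi a = q powi b \<longleftrightarrow> int l dvd a - b"
  using powi_eq_1_iff[of "a - b"] q_nonzero by (simp add: power_int_diff)

sublocale E: embedded_domain R phi by (rule R_embedded)

definition A where "A = phi ` carrier R"

sublocale TA: torus_subalgebra chi U A l
proof
  show "0 \<in> U" by (rule U_closed)
  show "u \<in> U \<Longrightarrow> v \<in> U \<Longrightarrow> u + v \<in> U" "u \<in> U \<Longrightarrow> - u \<in> U" for u v by (rule U_closed, assumption+)+
  show "a \<in> T.torus U" if a: "a \<in> A" for a
  proof -
    obtain C where C: "C \<in> carrier R" "a = phi C" using a unfolding A_def by blast
    obtain p where "p \<in> words_over Y" "phi C = S.ev X p" using C(1) by (rule R_obtain)
    then show ?thesis using ev_torus C(2) by simp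
  qed
  show "op_scale c 1 \<in> A" for c
    using gens_image[of "free_const c"] unfolding A_def gens_def by (simp add: free_const_def S.ev_single)
  show "a + b \<in> A" if ab: "a \<in> A" "b \<in> A" for a b
  proof -
    obtain C C' where "C \<in> carrier R" "a = phi C" "C' \<in> carrier R" "b = phi C'" using ab unfolding A_def by blast
    then show ?thesis unfolding A_def by (intro image_eqI[of _ _ "C \<oplus>\<^bsub>R\<^esub> C'"]) (simp_all add: E.phi_add)
  qed
  show "a * b \<in> A" if ab: "a \<in> A" "b \<in> A" for a b
  proof -
    obtain C C' where "C \<in> carrier R" "a = phi C" "C' \<in> carrier R" "b = phi C'" using ab unfolding A_def by blast
    then show ?thesis unfolding A_def by (intro image_eqI[of _ _ "C \<otimes>\<^bsub>R\<^esub> C'"]) (simp_all add: E.phi_mult)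
  qed
  show "l > 0" by (rule l_pos)
  show "chi u v ^ l = 1" for u v
    using powi_eq_1_iff[of "beta u v * int l"] unfolding chi_def by (simp add: power_int_mult)
qed

lemma X_A: "x \<in> Y \<Longrightarrow> X x \<in> A"
  using gens_image[of "free_var x"] unfolding A_def gens_def by (simp add: free_var_def S.ev_single)

lemma M_single_D:
  assumes z: "z \<in> Y" "T.M (e z) \<in> TA.D"
  shows "T.M (Poly_Mapping.single z c) \<in> TA.D"
proof -
  have nat: "T.M (Poly_Mapping.single z (int k)) \<in> TA.D" for k
  proof (induction k)
    case 0
    show ?case using TA.A_D[OF TA.A_scalar[of 1]] by simp
  next
    case (Suc k)
    have "e z + Poly_Mapping.single z (int k) = Poly_Mapping.single z (int (Suc k))"
      unfolding e_def single_add[symmetric] by simp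
    then show ?case using TA.D_M_add[OF z(2) Suc] by simp
  qed
  show ?thesis
  proof (cases "c \<ge> 0")
    case True
    then show ?thesis using nat[of "nat c"] by simp
  next
    case False
    have "Poly_Mapping.single z (int (nat (- c))) \<in> U" using z(1) unfolding U_def by simp
    from TA.D_M_neg[OF this nat] show ?thesis using False by (simp add: single_uminus[symmetric])
  qed
qed

lemma M_keys_D:
  assumes u: "u \<in> U" "\<And>z. z \<in> Poly_Mapping.keys u \<Longrightarrow> T.M (e z) \<in> TA.D"
  shows "T.M u \<in> TA.D"
proof -
  have "T.M (\<Sum>z\<in>B. Poly_Mapping.single z (Poly_Mapping.lookup u z)) \<in> TA.D"
    if "finite B" "B \<subseteq> Poly_Mapping.keys u" for B
    using that
  proof (induction B rule: finite_induct)
    case empty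
    show ?case using TA.A_D[OF TA.A_scalar[of 1]] by simp
  next
    case (insert z B)
    have "z \<in> Y" using insert.prems u(1) unfolding U_def by auto
    then have "T.M (Poly_Mapping.single z (Poly_Mapping.lookup u z)) \<in> TA.D"
      using insert.prems u(2) by (intro M_single_D) simp_all
    from TA.D_M_add[OF this insert.IH] show ?case using insert by simp
  qed
  from this[of "Poly_Mapping.keys u"] show ?thesis using pm_expansion[of u] by simp
qed

text \<open>By induction on the position of the box: \<open>X x\<close> lies in \<open>A\<close>, and all monomials of \<open>X x\<close> other than
\<open>M (e x)\<close> involve only boxes of the rectangle above and to the left of \<open>x\<close>, for which the claim
holds already. So \<open>M (e x)\<close> is a difference of central fractions.\<close>

lemma M_e_D: "x \<in> Y \<Longrightarrow> T.M (e x) \<in> TA.D"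
proof (induction "fst x + snd x" arbitrary: x rule: less_induct)
  case less
  let ?d = "X x - T.M (e x)"
  have x: "x \<in> G" using less.prems Y_G by blast
  note L = T.torus_expansion[OF X_low[OF x]]
  have "T.M u \<in> TA.D" if u: "u \<in> lower_exponents (fst x) (snd x)" for u
  proof (rule M_keys_D)
    show uU: "u \<in> U" using lower_U[OF less.prems] u by blast
    fix z assume z: "z \<in> Poly_Mapping.keys u"
    then have "z \<in> {1..fst x} \<times> {1..snd x} - {(fst x, snd x)}" using u unfolding lower_exponents_def by blast
    then have "fst z + snd z < fst x + snd x" by (cases z; cases x) auto
    moreover have "z \<in> Y" using uU z unfolding U_def by blast
    ultimately show "T.M (e z) \<in> TA.D" by (rule less.hyps)
  qed
  then have "(\<Sum>u\<in>T.supp ?d. op_scale (coef ?d u) (T.M u)) \<in> TA.D"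
    using L(2) by (intro TA.D_sum TA.D_sc) blast
  then have "?d \<in> TA.D" using L(3) by simp
  from TA.D_minus[OF TA.A_D[OF X_A[OF less.prems]] this] show ?case by simp
qed

lemma M_D: "u \<in> U \<Longrightarrow> T.M u \<in> TA.D"
  by (rule M_keys_D) (use M_e_D in \<open>auto simp: U_def\<close>)

lemma phi_A: "C \<in> carrier R \<Longrightarrow> phi C \<in> A"
  unfolding A_def by (rule imageI)

lemma center_phi: "C \<in> E.Z \<Longrightarrow> phi C \<in> T.torus (T.rad U)"
proof (rule TA.centralizer_in_rad[OF M_D])
  assume C: "C \<in> E.Z"
  show "phi C \<in> T.torus U" by (rule TA.A_torus[OF phi_A[OF E.ZD[OF C]]])
  fix a assume "a \<in> A"
  then obtain C' where "C' \<in> carrier R" "a = phi C'" unfolding A_def by blast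
  then show "phi C * a = a * phi C" using E.Z_comm[OF C] by simp
qed

lemma center_preimage:
  assumes "a \<in> A" "a \<in> T.torus (T.rad U)"
  obtains C where "C \<in> E.Z" "phi C = a"
proof -
  obtain C where C: "C \<in> carrier R" "a = phi C" using assms(1) unfolding A_def by blast
  have "C \<in> E.Z"
  proof (rule E.ZI[OF C(1)])
    fix C' assume "C' \<in> carrier R"
    then have "phi C' \<in> T.torus U" by (intro TA.A_torus phi_A)
    then show "phi C * phi C' = phi C' * phi C" using T.rad_central assms(2) C(2) by simp
  qed
  then show ?thesis using that C(2) by simp
qed

text \<open>The commutation factor of two monomials depends only on their exponents modulo \<open>l\<close>, and there are
finitely many of these on the boxes of the diagram.\<close>

lemma R_PI: "PI_ring R"
proof (rule E.PI_ringI)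
  define cls where "cls u = (\<lambda>y\<in>Y. Poly_Mapping.lookup u y mod int l)" for u :: "(nat \<times> nat) \<Rightarrow>\<^sub>0 int"
  have fY: "finite Y" by (rule finite_subset[OF Y_G]) simp
  have "cls ` U \<subseteq> Y \<rightarrow>\<^sub>E {0..<int l}" using l_pos unfolding cls_def by auto
  then have fin: "finite (cls ` U)" by (rule finite_subset) (rule finite_PiE[OF fY], simp)
  have lk: "[Poly_Mapping.lookup u x = Poly_Mapping.lookup u' x] (mod int l)"
    if "u \<in> U" "u' \<in> U" "cls u = cls u'" for u u' x
  proof (cases "x \<in> Y")
    case True
    then show ?thesis using fun_cong[OF that(3), of x] unfolding cls_def cong_def by simp
  next
    case False
    then have "Poly_Mapping.lookup u x = 0" "Poly_Mapping.lookup u' x = 0"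
      using that(1,2) unfolding U_def by (auto simp: in_keys_iff)
    then show ?thesis by simp
  qed
  have cls: "chi u v = chi u' v'"
    if "u \<in> U" "u' \<in> U" "v \<in> U" "v' \<in> U" "cls u = cls u'" "cls v = cls v'" for u u' v v'
  proof -
    have "[beta u v = beta u' v'] (mod int l)"
      unfolding beta_def
      by (intro cong_sum cong_mult cong_refl lk[OF that(1,2,5)] lk[OF that(3,4,6)])
    then show ?thesis unfolding chi_def powi_eq_iff by (simp add: cong_iff_dvd_diff)
  qed
  fix x :: "nat \<Rightarrow> ((nat \<times> nat) \<Rightarrow>\<^sub>0 int, 'k) lin_op" assume x: "\<And>i. x i \<in> phi ` carrier R"
  show "standard_sum (Suc (card (cls ` U))) x = 0"
  proof (rule T.standard_identity[OF cls fin])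
    show "card (cls ` U) < Suc (card (cls ` U))" by simp
    show "x i \<in> T.torus U" for i using x[of i] TA.A_torus unfolding A_def by blast
  qed
qed

text \<open>A transversal \<open>V\<close> of the radical gives the basis \<open>M v\<close> of the torus over its centre. A common central
denominator \<open>c\<close> moves these monomials into the image of \<open>R\<close>, and for each element to be spanned a
further one, \<open>w\<close>, moves the central coefficients there.\<close>

theorem PI_deg_of_transversal:
  assumes V: "finite V" "V \<subseteq> U" "card V = d\<^sup>2"
    and ex: "\<And>u. u \<in> U \<Longrightarrow> \<exists>v\<in>V. u - v \<in> T.rad U"
    and uniq: "\<And>v v'. v \<in> V \<Longrightarrow> v' \<in> V \<Longrightarrow> v' - v \<in> T.rad U \<Longrightarrow> v = v'"
  shows "PI_deg R = d"
proof -
  have "T.M ` V \<subseteq> TA.D" using M_D V(2) by blast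
  from TA.common_multiplier[OF finite_imageI[OF V(1)] this]
  obtain c where c: "c \<in> A" "c \<in> T.torus (T.rad U)" "c \<noteq> 0" "\<And>v. v \<in> V \<Longrightarrow> c * T.M v \<in> A" by blast
  obtain vs where vs: "set vs = V" "distinct vs" using finite_distinct_list[OF V(1)] by blast
  have len: "length vs = card V" using distinct_card[OF vs(2)] vs(1) by simp
  have "\<forall>v\<in>V. \<exists>b\<in>carrier R. phi b = c * T.M v" using c(4) unfolding A_def by fastforce
  then obtain f where f: "\<And>v. v \<in> V \<Longrightarrow> f v \<in> carrier R \<and> phi (f v) = c * T.M v" by metis
  let ?bs = "map f vs"
  have lb: "length ?bs = length vs" by simp
  define ix where "ix = inv_into {..<length vs} (nth vs)"
  have ix: "ix (vs ! i) = i" if "i < length vs" for i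
    unfolding ix_def using that vs(2) by (intro inv_into_f_f) (auto simp: inj_on_nth)
  have to_V: "(\<Sum>i<length vs. g (vs ! i)) = (\<Sum>v\<in>V. g v)" for g :: "_ \<Rightarrow> ((nat \<times> nat) \<Rightarrow>\<^sub>0 int, 'k) lin_op"
    by (rule sum.reindex_bij_betw) (use bij_betw_nth[OF vs(2), of "{..<length vs}" V] vs(1) in simp)
  have ixV: "ix v < length vs \<and> vs ! ix v = v" if v: "v \<in> V" for v
  proof -
    obtain i where "i < length vs" "v = vs ! i" using v vs(1) by (metis in_set_conv_nth)
    then show ?thesis using ix by simp
  qed
  show ?thesis
  proof (rule E.PI_deg_eqI[OF R_PI, where bs = ?bs])
    show "set ?bs \<subseteq> carrier R" by (rule set_map_subsetI) (use f vs(1) in blast)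
    show "length ?bs = d\<^sup>2" using len V(3) by simp
  next
    fix zs assume zs: "length zs = length ?bs" "set zs \<subseteq> E.Z"
      and sum0: "(\<Sum>i<length ?bs. phi (zs ! i) * phi (?bs ! i)) = 0"
    \<comment> \<open>a relation among the \<open>c * M v\<close> is one among the \<open>M v\<close> with coefficients multiplied by \<open>c\<close>\<close>
    define z where "z v = phi (zs ! ix v) * c" for v
    have zC: "phi (zs ! i) \<in> T.torus (T.rad U)" if "i < length vs" for i
      by (rule center_phi, rule subsetD[OF zs(2)], rule nth_mem) (use that zs(1) in simp)
    have zr: "z v \<in> T.torus (T.rad U)" if "v \<in> V" for v
      unfolding z_def by (rule TA.rad_torus_mult[OF zC c(2)]) (use ixV[OF that] in simp)
    have "(\<Sum>v\<in>V. z v * T.M v) = (\<Sum>i<length vs. z (vs ! i) * T.M (vs ! i))"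
      by (rule to_V[symmetric])
    also have "\<dots> = (\<Sum>i<length ?bs. phi (zs ! i) * phi (?bs ! i))"
    proof (rule sum.cong)
      fix i assume "i \<in> {..<length ?bs}"
      then have i: "i < length vs" by simp
      then have "vs ! i \<in> V" using vs(1) nth_mem by blast
      then show "z (vs ! i) * T.M (vs ! i) = phi (zs ! i) * phi (?bs ! i)"
        using f i by (simp add: z_def ix mult.assoc)
    qed simp
    finally have s0: "(\<Sum>v\<in>V. z v * T.M v) = 0" using sum0 by simp
    show "\<forall>y\<in>set zs. phi y = 0"
    proof
      fix y assume "y \<in> set zs"
      then obtain i where i: "i < length vs" "y = zs ! i" using zs(1) by (metis in_set_conv_nth lb)
      have vV: "vs ! i \<in> V" using i(1) vs(1) nth_mem by blast
      have "z (vs ! i) = 0" by (rule TA.rank_independent[OF V(1,2) uniq zr s0 vV])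
      then have "phi y * c = 0" unfolding z_def ix[OF i(1)] i(2) .
      then show "phi y = 0" using T.torus_domain[OF zC[OF i(1)] c(2)] c(3) i(2) by simp
    qed
  next
    fix a assume a: "a \<in> carrier R"
    have aU: "phi a \<in> T.torus U" by (rule TA.A_torus[OF phi_A[OF a]])
    obtain y where y: "\<And>v. v \<in> V \<Longrightarrow> y v \<in> T.torus (T.rad U)" "phi a = (\<Sum>v\<in>V. y v * T.M v)"
      using TA.rank_span[OF V(1,2) ex aU] by blast
    have "y ` V \<subseteq> TA.D" using TA.torus_D[OF M_D T.rad_torus[OF y(1)]] by blast
    from TA.common_multiplier[OF finite_imageI[OF V(1)] this]
    obtain w where w: "w \<in> A" "w \<in> T.torus (T.rad U)" "w \<noteq> 0" "\<And>v. v \<in> V \<Longrightarrow> w * y v \<in> A" by blast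
    have "\<exists>C. C \<in> E.Z \<and> phi C = w * y v" if "v \<in> V" for v
      using center_preimage[OF w(4)[OF that] TA.rad_torus_mult[OF w(2) y(1)[OF that]]] by blast
    then obtain C where C: "\<And>v. v \<in> V \<Longrightarrow> C v \<in> E.Z \<and> phi (C v) = w * y v" by metis
    obtain s where s: "s \<in> E.Z" "phi s = c * w"
      by (rule center_preimage[OF TA.A_mult[OF c(1) w(1)] TA.rad_torus_mult[OF c(2) w(2)]])
    have "phi s \<noteq> 0" unfolding s(2) using T.torus_domain[OF c(2) w(2)] c(3) w(3) by blast
    moreover have "length (map C vs) = length ?bs" by simp
    moreover have "set (map C vs) \<subseteq> E.Z" by (rule set_map_subsetI) (use C vs(1) in blast)
    moreover have "phi s * phi a = (\<Sum>i<length ?bs. phi (map C vs ! i) * phi (?bs ! i))"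
    proof -
      have "phi s * phi a = (\<Sum>v\<in>V. (w * y v) * (c * T.M v))"
        unfolding s(2) y(2) sum_distrib_left
      proof (rule sum.cong)
        fix v assume v: "v \<in> V"
        have "c * w * (y v * T.M v) = c * (w * y v) * T.M v" by (simp only: mult.assoc)
        also have "c * (w * y v) = (w * y v) * c"
          by (rule T.rad_central[OF c(2) U_mult[OF T.rad_torus[OF w(2)] T.rad_torus[OF y(1)[OF v]]]])
        finally show "c * w * (y v * T.M v) = (w * y v) * (c * T.M v)" by (simp only: mult.assoc)
      qed simp
      also have "\<dots> = (\<Sum>i<length vs. (w * y (vs ! i)) * (c * T.M (vs ! i)))" by (rule to_V[symmetric])
      also have "\<dots> = (\<Sum>i<length ?bs. phi (map C vs ! i) * phi (?bs ! i))"
      proof (rule sum.cong)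
        fix i assume "i \<in> {..<length ?bs}"
        then have i: "i < length vs" by simp
        then have "vs ! i \<in> V" using vs(1) nth_mem by blast
        then show "(w * y (vs ! i)) * (c * T.M (vs ! i)) = phi (map C vs ! i) * phi (?bs ! i)"
          using f C i by simp
      qed simp
      finally show ?thesis .
    qed
    ultimately show "\<exists>s\<in>E.Z. phi s \<noteq> 0 \<and> (\<exists>zs. length zs = length ?bs \<and> set zs \<subseteq> E.Z \<and>
        phi s * phi a = (\<Sum>i<length ?bs. phi (zs ! i) * phi (?bs ! i)))"
      using s(1) by blast
  qed
qed

lemma finite_Y: "finite Y"
  by (rule finite_subset[OF Y_G]) simp

text \<open>\<open>M u\<close> and the monomial \<open>M (e y)\<close> of a box \<open>y\<close> commute up to \<open>q\<close> to the power \<open>pairing u y\<close>.\<close>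

definition pairing :: "((nat \<times> nat) \<Rightarrow>\<^sub>0 int) \<Rightarrow> nat \<times> nat \<Rightarrow> int" where
  "pairing u y = (\<Sum>x\<in>Y. comm_exp x y * Poly_Mapping.lookup u x)"

lemma beta_restrict: "u \<in> U \<Longrightarrow> v \<in> U \<Longrightarrow>
    beta u v = (\<Sum>x\<in>Y. \<Sum>y\<in>Y. of_bool (precedes x y) * Poly_Mapping.lookup u x * Poly_Mapping.lookup v y)"
proof -
  assume uv: "u \<in> U" "v \<in> U"
  have z: "Poly_Mapping.lookup u x = 0" "Poly_Mapping.lookup v x = 0" if "x \<notin> Y" for x
    using uv that unfolding U_def by (auto simp: in_keys_iff)
  have "(\<Sum>y\<in>G. of_bool (precedes x y) * Poly_Mapping.lookup u x * Poly_Mapping.lookup v y) =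
      (\<Sum>y\<in>Y. of_bool (precedes x y) * Poly_Mapping.lookup u x * Poly_Mapping.lookup v y)" for x
    by (rule sum.mono_neutral_right) (use Y_G z in auto)
  then have "beta u v = (\<Sum>x\<in>G. \<Sum>y\<in>Y. of_bool (precedes x y) * Poly_Mapping.lookup u x * Poly_Mapping.lookup v y)"
    unfolding beta_def by simp
  also have "\<dots> = (\<Sum>x\<in>Y. \<Sum>y\<in>Y. of_bool (precedes x y) * Poly_Mapping.lookup u x * Poly_Mapping.lookup v y)"
    by (rule sum.mono_neutral_right) (use Y_G z in auto)
  finally show ?thesis .
qed

lemma beta_skew: "u \<in> U \<Longrightarrow> v \<in> U \<Longrightarrow> beta u v - beta v u = (\<Sum>y\<in>Y. pairing u y * Poly_Mapping.lookup v y)"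
proof -
  assume uv: "u \<in> U" "v \<in> U"
  have "beta u v = (\<Sum>y\<in>Y. \<Sum>x\<in>Y. of_bool (precedes x y) * Poly_Mapping.lookup u x * Poly_Mapping.lookup v y)"
    unfolding beta_restrict[OF uv] by (rule sum.swap)
  moreover have "(\<Sum>y\<in>Y. pairing u y * Poly_Mapping.lookup v y) =
    (\<Sum>y\<in>Y. \<Sum>x\<in>Y. of_bool (precedes x y) * Poly_Mapping.lookup u x * Poly_Mapping.lookup v y) -
    (\<Sum>y\<in>Y. \<Sum>x\<in>Y. of_bool (precedes y x) * Poly_Mapping.lookup v y * Poly_Mapping.lookup u x)"
    unfolding pairing_def sum_distrib_right sum_subtractf[symmetric]
    by (intro sum.cong refl) (simp add: comm_exp_def left_diff_distrib)
  ultimately show ?thesis unfolding beta_restrict[OF uv(2,1)] by simp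
qed

lemma rad_iff: "u \<in> U \<Longrightarrow> u \<in> T.rad U \<longleftrightarrow> (\<forall>y\<in>Y. int l dvd pairing u y)"
proof -
  assume u: "u \<in> U"
  have c: "chi u v = chi v u \<longleftrightarrow> int l dvd (\<Sum>y\<in>Y. pairing u y * Poly_Mapping.lookup v y)" if "v \<in> U" for v
    unfolding chi_def powi_eq_iff beta_skew[OF u that] by (rule refl)
  show ?thesis
  proof
    assume r: "u \<in> T.rad U"
    show "\<forall>y\<in>Y. int l dvd pairing u y"
    proof
      fix y assume y: "y \<in> Y"
      have "(\<Sum>y'\<in>Y. pairing u y' * Poly_Mapping.lookup (e y) y') = (\<Sum>y'\<in>Y. if y' = y then pairing u y' else 0)"
        by (rule sum.cong) (simp_all add: lookup_e)
      also have "\<dots> = pairing u y" using finite_Y y by simp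
      finally show "int l dvd pairing u y"
        using c[OF U_closed(4)[OF y]] r U_closed(4)[OF y] unfolding T.rad_def by simp
    qed
  next
    assume "\<forall>y\<in>Y. int l dvd pairing u y"
    then have "int l dvd (\<Sum>y\<in>Y. pairing u y * Poly_Mapping.lookup v y)" for v
      by (intro dvd_sum dvd_mult2) blast
    then show "u \<in> T.rad U" using u c unfolding T.rad_def by simp
  qed
qed

text \<open>Exponents are congruent modulo the radical if and only if the commutation matrix gives them the same values
modulo \<open>l\<close>. So the cosets correspond to the image of this matrix modulo \<open>l\<close>, whose size is \<open>l ^ card Y\<close>
divided by that of the kernel.\<close>

lemma transversal_exists:
  "\<exists>V. finite V \<and> V \<subseteq> U \<and> card V * card (mod_kernel (int l) Y) = l ^ card Y \<and>
    (\<forall>u\<in>U. \<exists>v\<in>V. u - v \<in> T.rad U) \<and> (\<forall>v\<in>V. \<forall>v'\<in>V. v' - v \<in> T.rad U \<longrightarrow> v = v')"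
proof -
  let ?P = "Y \<rightarrow>\<^sub>E {0..<int l}"
  define g0 where "g0 v = (\<lambda>y\<in>Y. (\<Sum>x\<in>Y. comm_exp x y * v x) mod int l)" for v :: "nat \<times> nat \<Rightarrow> int"
  define g where "g u = g0 (Poly_Mapping.lookup u)" for u
  have g_eq: "g u = g v \<longleftrightarrow> u - v \<in> T.rad U" if uv: "u \<in> U" "v \<in> U" for u v
  proof -
    have d: "u - v \<in> U" using U_closed(2)[OF uv(1) U_closed(3)[OF uv(2)]] by simp
    have "pairing (u - v) y = pairing u y - pairing v y" for y
      unfolding pairing_def by (simp only: lookup_minus right_diff_distrib sum_subtractf)
    then have "u - v \<in> T.rad U \<longleftrightarrow> (\<forall>y\<in>Y. pairing u y mod int l = pairing v y mod int l)"
      unfolding rad_iff[OF d] by (simp add: mod_eq_dvd_iff)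
    then show ?thesis unfolding g_def g0_def pairing_def by (auto simp: fun_eq_iff restrict_def)
  qed
  have g0_mod: "g0 v = g0 w" if "\<And>x. x \<in> Y \<Longrightarrow> v x mod int l = w x mod int l" for v w
  proof -
    have "[(\<Sum>x\<in>Y. comm_exp x y * v x) = (\<Sum>x\<in>Y. comm_exp x y * w x)] (mod int l)" for y
      by (intro cong_sum cong_scalar_left) (simp add: cong_def that)
    then show ?thesis unfolding g0_def cong_def by simp
  qed
  have img: "g ` U = g0 ` ?P"
  proof (intro equalityI image_subsetI)
    fix u assume "u \<in> U"
    let ?v = "\<lambda>x\<in>Y. Poly_Mapping.lookup u x mod int l"
    have "g u = g0 ?v" unfolding g_def by (rule g0_mod) simp
    moreover have "?v \<in> ?P" using l_pos by auto
    ultimately show "g u \<in> g0 ` ?P" by simp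
  next
    fix v assume "v \<in> ?P"
    define u where "u = (\<Sum>x\<in>Y. Poly_Mapping.single x (v x))"
    have "Poly_Mapping.lookup u z = (\<Sum>x\<in>Y. if x = z then v x else 0)" for z
      unfolding u_def lookup_sum by (rule sum.cong) (simp_all add: lookup_single when_def)
    then have lk: "Poly_Mapping.lookup u z = (if z \<in> Y then v z else 0)" for z using finite_Y by simp
    have "u \<in> U" unfolding U_def using lk by (auto simp: in_keys_iff split: if_splits)
    moreover have "g u = g0 v" unfolding g_def by (rule g0_mod) (simp add: lk)
    ultimately show "g0 v \<in> g ` U" by (metis imageI)
  qed
  have "finite ?P" by (rule finite_PiE[OF finite_Y]) simp
  then have fin: "finite (g ` U)" unfolding img by (rule finite_imageI)
  define h where "h = inv_into U g"
  have h: "h c \<in> U" "g (h c) = c" if "c \<in> g ` U" for c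
    unfolding h_def using that by (simp_all add: inv_into_into f_inv_into_f)
  \<comment> \<open>one exponent for each value of the commutation matrix modulo \<open>l\<close>\<close>
  let ?V = "h ` (g ` U)"
  have "inj_on h (g ` U)" by (rule inj_on_inverseI[of _ g]) (rule h(2))
  then have "card ?V = card (g0 ` ?P)" unfolding img[symmetric] by (rule card_image)
  moreover have "card (g0 ` ?P) * card (mod_kernel (int l) Y) = l ^ card Y"
    using card_image_mod_linear[OF finite_Y, of "int l" comm_exp] l_pos
    unfolding mod_kernel_def g0_def[abs_def] by simp
  moreover have "\<exists>v\<in>?V. u - v \<in> T.rad U" if u: "u \<in> U" for u
  proof (rule bexI)
    have gu: "g u \<in> g ` U" using u by (rule imageI)
    show "u - h (g u) \<in> T.rad U" using g_eq[OF u h(1)[OF gu]] h(2)[OF gu] by simp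
    show "h (g u) \<in> ?V" using gu by (rule imageI)
  qed
  moreover have "v = v'" if v: "v \<in> ?V" "v' \<in> ?V" and r: "v' - v \<in> T.rad U" for v v'
  proof -
    obtain c c' where c: "c \<in> g ` U" "v = h c" "c' \<in> g ` U" "v' = h c'" using v by blast
    have "g v' = g v" using g_eq[of v' v] h(1) c r by simp
    then show ?thesis using h(2) c by simp
  qed
  ultimately show ?thesis using fin h(1) by (intro exI[of _ ?V]) auto
qed

lemma Y_diagram: "Y = diagram m n (\<lambda>i j. j \<le> lam i)"
  unfolding Y_def diagram_def using lam_le by fastforce

lemma card_Y: "card Y = (\<Sum>i=1..m. lam i)"
proof -
  have "Y = Sigma {1..m} (\<lambda>i. {1..lam i})" unfolding Y_def by auto
  then show ?thesis by simp
qed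

text \<open>The squared PI degree is \<open>l ^ (card Y - r)\<close>; the exponent is even since both \<open>card Y\<close> and \<open>r\<close> give the
sign of the toric permutation.\<close>

theorem PI_deg_partition:
  assumes odd: "odd l" and l: "l > 2"
  shows "\<exists>k. card Y = odd_cycle_count (partition_toric m n lam) {1..m + n} + 2 * k \<and> PI_deg R = l ^ k"
proof -
  let ?t = "partition_toric m n lam" and ?L = "{1..m + n}"
  let ?r = "odd_cycle_count ?t ?L"
  have t: "?t = toric_permutation m n (\<lambda>i j. j \<le> lam i)" unfolding partition_toric_def by (rule refl)
  have perm: "?t permutes ?L" unfolding t by (rule toric_permutation_permutes)
  note C = permutation_cycle_parity_and_count[OF perm finite_atLeastAtMost odd l_pos]
  have sgn: "(- 1 :: int) ^ card Y = (- 1) ^ ?r"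
    using C sign_toric_permutation[of m n "\<lambda>i j. j \<le> lam i"] unfolding t Y_diagram by simp
  have ker: "card (mod_kernel (int l) Y) = l ^ ?r"
    using C card_mod_kernel[of "int l" m n "\<lambda>i j. j \<le> lam i"] odd l_pos unfolding t Y_diagram by simp
  obtain V where V: "finite V" "V \<subseteq> U" "card V * l ^ ?r = l ^ card Y"
      "\<And>u. u \<in> U \<Longrightarrow> \<exists>v\<in>V. u - v \<in> T.rad U" "\<And>v v'. v \<in> V \<Longrightarrow> v' \<in> V \<Longrightarrow> v' - v \<in> T.rad U \<Longrightarrow> v = v'"
    using transversal_exists unfolding ker by blast
  have "card V \<noteq> 0" using V(3) l_pos by (metis mult_0 power_eq_0_iff less_numeral_extra(3))
  then have "l ^ ?r \<le> l ^ card Y" unfolding V(3)[symmetric] by simp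
  then have le: "?r \<le> card Y" using l by (simp add: power_increasing_iff)
  have "even (card Y) \<longleftrightarrow> even ?r" using sgn by (metis neg_one_even_power neg_one_odd_power one_neq_neg_one)
  then have "even (card Y - ?r)" using le by simp
  then obtain k where k: "card Y - ?r = 2 * k" by (rule evenE)
  then have N: "card Y = ?r + 2 * k" using le by simp
  have "l ^ card Y = (l ^ k)\<^sup>2 * l ^ ?r" unfolding N by (simp add: power_add power_mult[symmetric] mult.commute)
  then have "card V = (l ^ k)\<^sup>2" using V(3) l_pos by simp
  then have "PI_deg R = l ^ k" by (rule PI_deg_of_transversal[OF V(1,2) _ V(4,5)])
  then show ?thesis using N by blast
qed

end

theorem theorem1:
  fixes q :: "'k::field" and l m n :: nat and lam :: "nat \<Rightarrow> nat"
  assumes "q \<noteq> 0" and "primitive_root l q" and "l > 2" and "odd l"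
    and "is_partition m lam" and "\<forall>i\<in>{1..m}. lam i \<le> n"
  shows "real (PI_deg (partition_subalgebra q m n lam)) =
    real l powr
      ((real (\<Sum>i=1..m. lam i) -
        real (odd_cycle_count (partition_toric m n lam) {1..m + n})) / 2)"
proof -
  interpret quantum_matrices_at_root q m n lam l
    by unfold_locales (use assms in simp_all)
  obtain k where k: "card Y = odd_cycle_count (partition_toric m n lam) {1..m + n} + 2 * k"
      "PI_deg (partition_subalgebra q m n lam) = l ^ k"
    using PI_deg_partition[OF assms(4,3)] by blast
  have "(real (\<Sum>i=1..m. lam i) - real (odd_cycle_count (partition_toric m n lam) {1..m + n})) / 2 = real k"
    unfolding card_Y[symmetric] k(1) by simp
  then show ?thesis unfolding k(2) using assms(3) by (simp add: powr_realpow)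
qed

end
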